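(* Let $f,g$ be two (orientation-preserving) $C^{1+bv}$ diffeomorphisms of the circle $\mathrm{S}^1$ with the same irrational rotation number, both having absolutely continuous derivative. Then there exists a sequence $(h_n)$ of $C^{1+bv}$ circle diffeomorphisms such that the conjugates $h_n f h_n^{-1}$ converge to $g$ in the $C^{1+bv}$ sense; that is, $h_n f h_n^{-1}\to g$ in the $C^1$ topology, and $$\mathrm{var}\big(\log D(g^{-1}(h_n f h_n^{-1}))\big)\to 0,\qquad \mathrm{var}\big(\log D((h_n f h_n^{-1})g^{-1})\big)\to 0$$ as $n\to\infty$.
   Context: All diffeomorphisms are orientation preserving. $\mathrm{S}^1=\mathbb{R}/\mathbb{Z}$. A $C^{1+bv}$ diffeomorphism is a $C^1$ diffeomorphism $f$ such that $\log(Df)$ has finite total variation; $\mathrm{var}$ denotes total variation on $\mathrm{S}^1$. *)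

theory Defs
  imports "HOL-Analysis.Analysis"
begin

quotient_type circle = real / "\<lambda>x y :: real. x - y \<in> \<int>"
  morphisms circle_rep to_circle
proof (rule equivpI)
  show "reflp (\<lambda>x y :: real. x - y \<in> \<int>)"
    by (simp add: reflp_def)
  show "symp (\<lambda>x y :: real. x - y \<in> \<int>)"
    by (metis (no_types, lifting) Ints_minus minus_diff_eq sympI)
  show "transp (\<lambda>x y :: real. x - y \<in> \<int>)"
    by (rule transpI) (metis Ints_add diff_add_cancel add_diff_eq)
qed

lemma to_circle_eq_iff: "to_circle x = to_circle y \<longleftrightarrow> x - y \<in> \<int>"
  by (rule circle.abs_eq_iff)

lemma to_circle_surj: "\<exists>x. to_circle x = p"
  by (induction p) auto

text \<open>The quotient metric, i.e. the length of a shortest arc, \<open>dist [x] [y] = min {\<bar>x - y - m\<bar> | m \<in> \<int>}\<close>.\<close>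

definition Z_dist :: "real \<Rightarrow> real" where
  "Z_dist z = (INF m::int. \<bar>z - of_int m\<bar>)"

lemma Z_dist_round: "Z_dist z = \<bar>z - of_int (round z)\<bar>"
proof -
  have "Z_dist z \<le> \<bar>z - of_int (round z)\<bar>"
    unfolding Z_dist_def by (rule cINF_lower) (auto intro: bdd_belowI2[where m = 0])
  moreover have "\<bar>z - of_int (round z)\<bar> \<le> Z_dist z"
    unfolding Z_dist_def by (rule cINF_greatest) (auto intro: round_diff_minimal)
  ultimately show ?thesis by (rule antisym)
qed

lemma Z_dist_le: "Z_dist z \<le> \<bar>z - of_int m\<bar>"
  by (simp add: Z_dist_round round_diff_minimal)

lemma Z_dist_cong:
  assumes "z - w \<in> \<int>"
  shows "Z_dist z = Z_dist w"
proof -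
  from assms obtain k where k: "z = w + of_int k"
    by (metis Ints_cases add.commute diff_add_cancel)
  have "Z_dist z \<le> Z_dist w"
    using Z_dist_le[of z "round w + k"] by (simp add: k Z_dist_round[of w])
  moreover have "Z_dist w \<le> Z_dist z"
    using Z_dist_le[of w "round z - k"] unfolding Z_dist_round[of z] by (simp add: k algebra_simps)
  ultimately show ?thesis by simp
qed

instantiation circle :: metric_space
begin

lift_definition dist_circle :: "circle \<Rightarrow> circle \<Rightarrow> real" is "\<lambda>x y. Z_dist (x - y)"
  by (rule Z_dist_cong) (metis Ints_diff diff_diff_eq2 diff_diff_add add.commute diff_add_eq)

definition uniformity_circle :: "(circle \<times> circle) filter" where
  "uniformity_circle = (INF e\<in>{0 <..}. principal {(p, q). dist p q < e})"

definition open_circle :: "circle set \<Rightarrow> bool" where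
  "open_circle U \<longleftrightarrow> (\<forall>p\<in>U. eventually (\<lambda>(p', q). p' = p \<longrightarrow> q \<in> U) uniformity)"

instance
proof
  fix p q r :: circle
  show "dist p q = 0 \<longleftrightarrow> p = q"
  proof transfer
    fix x y :: real
    show "Z_dist (x - y) = 0 \<longleftrightarrow> x - y \<in> \<int>"
      by (metis Z_dist_round Z_dist_le Ints_cases Ints_of_int abs_eq_0 abs_ge_zero
          cancel_comm_monoid_add_class.diff_cancel eq_iff_diff_eq_0 order_antisym)
  qed
  show "dist p q \<le> dist p r + dist q r"
  proof transfer
    fix x y z :: real
    show "Z_dist (x - y) \<le> Z_dist (x - z) + Z_dist (y - z)"
      using Z_dist_le[of "x - y" "round (x - z) - round (y - z)"]
      by (simp add: Z_dist_round[of "x - z"] Z_dist_round[of "y - z"])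
  qed
qed (simp_all add: uniformity_circle_def open_circle_def)

end

lemma dist_to_circle: "dist (to_circle x) (to_circle y) = (INF m::int. \<bar>x - y - of_int m\<bar>)"
  by (simp add: dist_circle.abs_eq Z_dist_def)

definition is_lift :: "(circle \<Rightarrow> circle) \<Rightarrow> (real \<Rightarrow> real) \<Rightarrow> bool" where
  "is_lift f F \<longleftrightarrow> continuous_on UNIV F \<and> (\<forall>x. to_circle (F x) = f (to_circle x))"

lemma is_lift_unique:
  assumes "is_lift f F" "is_lift f G"
  shows "\<exists>k::int. \<forall>x. G x = F x + of_int k"
proof -
  have Z: "G x - F x \<in> \<int>" for x
    using assms by (metis is_lift_def to_circle_eq_iff)
  have cont: "continuous_on UNIV (\<lambda>x. G x - F x)"
    using assms by (auto simp: is_lift_def intro!: continuous_intros)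
  have "(\<lambda>x. G x - F x) constant_on UNIV"
  proof (rule continuous_discrete_range_constant[OF connected_UNIV cont])
    fix x :: real
    show "\<exists>e>0. \<forall>y. y \<in> UNIV \<and> G y - F y \<noteq> G x - F x \<longrightarrow> e \<le> norm (G y - F y - (G x - F x))"
    proof (intro exI[of _ 1] conjI allI impI)
      fix y assume "y \<in> UNIV \<and> G y - F y \<noteq> G x - F x"
      then show "1 \<le> norm (G y - F y - (G x - F x))"
        by (metis Ints_diff Ints_nonzero_abs_ge1 Z real_norm_def right_minus_eq)
    qed simp
  qed
  then obtain c where c: "\<And>x. G x - F x = c"
    by (auto simp: constant_on_def)
  with Z obtain k where "c = of_int k"
    by (metis Ints_cases)
  with c show ?thesis
    by (metis add.commute diff_add_cancel)
qed

definition has_circle_derivative :: "(circle \<Rightarrow> circle) \<Rightarrow> real \<Rightarrow> circle \<Rightarrow> bool" where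
  "has_circle_derivative f d p \<longleftrightarrow>
     (\<exists>F x. is_lift f F \<and> to_circle x = p \<and> (F has_real_derivative d) (at x))"

lemma has_circle_derivative_unique:
  assumes "has_circle_derivative f d p" "has_circle_derivative f e p"
  shows "d = e"
proof -
  from assms obtain F x G y where
    F: "is_lift f F" "to_circle x = p" "(F has_real_derivative d) (at x)" and
    G: "is_lift f G" "to_circle y = p" "(G has_real_derivative e) (at y)"
    by (auto simp: has_circle_derivative_def)
  from F(2) G(2) obtain m :: int where m: "y = x + of_int m"
    by (metis to_circle_eq_iff Ints_cases add.commute diff_add_cancel)
  have "is_lift f (\<lambda>x. G (x + of_int m))"
    unfolding is_lift_def
  proof (intro conjI allI)
    show "continuous_on UNIV (\<lambda>x. G (x + of_int m))"
      using G(1) by (auto simp: is_lift_def intro!: continuous_intros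
          continuous_on_compose2[of UNIV G])
    fix z
    have "to_circle (z + of_int m) = to_circle z"
      by (simp add: to_circle_eq_iff)
    then show "to_circle (G (z + of_int m)) = f (to_circle z)"
      using G(1) by (simp add: is_lift_def)
  qed
  from is_lift_unique[OF F(1) this] obtain k where
    k: "\<And>x. G (x + of_int m) = F x + of_int k" by blast
  have "((\<lambda>x. G (x + of_int m)) has_real_derivative e) (at x)"
    using G(3) by (simp add: m DERIV_shift)
  moreover have "((\<lambda>x. G (x + of_int m)) has_real_derivative d) (at x)"
    unfolding k using F(3) by (auto intro!: derivative_eq_intros)
  ultimately show ?thesis
    by (metis DERIV_unique)
qed

definition circle_deriv :: "(circle \<Rightarrow> circle) \<Rightarrow> circle \<Rightarrow> real" where
  "circle_deriv f p = (THE d. has_circle_derivative f d p)"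

definition circle_C1 :: "(circle \<Rightarrow> circle) \<Rightarrow> bool" where
  "circle_C1 f \<longleftrightarrow>
     (\<forall>p. has_circle_derivative f (circle_deriv f p) p) \<and> continuous_on UNIV (circle_deriv f)"

text \<open>Positivity of the derivative expresses that \<open>f\<close> preserves the orientation.\<close>

definition circle_C1_diffeo :: "(circle \<Rightarrow> circle) \<Rightarrow> bool" where
  "circle_C1_diffeo f \<longleftrightarrow>
     bij f \<and> circle_C1 f \<and> circle_C1 (inv f) \<and> (\<forall>p. circle_deriv f p > 0)"

text \<open>A partition of the circle is given by real representatives \<open>x 0 \<le> \<dots> \<le> x n = x 0 + 1\<close> of
  cyclically ordered points.\<close>

definition circle_var :: "(circle \<Rightarrow> real) \<Rightarrow> ennreal" where
  "circle_var u =
     (SUP (n, x) \<in> {(n, x :: nat \<Rightarrow> real). (\<forall>i<n. x i \<le> x (Suc i)) \<and> x n = x 0 + 1}.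
        \<Sum>i<n. ennreal \<bar>u (to_circle (x (Suc i))) - u (to_circle (x i))\<bar>)"

definition circle_C1bv_diffeo :: "(circle \<Rightarrow> circle) \<Rightarrow> bool" where
  "circle_C1bv_diffeo f \<longleftrightarrow>
     circle_C1_diffeo f \<and> circle_var (\<lambda>p. ln (circle_deriv f p)) < \<infinity>"

definition abs_continuous_on_interval :: "real \<Rightarrow> real \<Rightarrow> (real \<Rightarrow> real) \<Rightarrow> bool" where
  "abs_continuous_on_interval a b u \<longleftrightarrow>
     (\<forall>\<epsilon>>0. \<exists>\<delta>>0. \<forall>(n::nat) s t.
        (\<forall>i<n. a \<le> s i \<and> s i \<le> t i \<and> t i \<le> b) \<and>
        disjoint_family_on (\<lambda>i. {s i<..<t i}) {..<n} \<and>
        (\<Sum>i<n. t i - s i) < \<delta> \<longrightarrow>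
        (\<Sum>i<n. \<bar>u (t i) - u (s i)\<bar>) < \<epsilon>)"

definition circle_abs_continuous :: "(circle \<Rightarrow> real) \<Rightarrow> bool" where
  "circle_abs_continuous u \<longleftrightarrow> abs_continuous_on_interval 0 1 (\<lambda>x. u (to_circle x))"

text \<open>For an orientation-preserving homeomorphism \<open>f\<close> with lift \<open>F\<close>, the limit of \<open>F\<^sup>n(x)/n\<close> exists,
  does not depend on \<open>x\<close>, and modulo the integers does not depend on \<open>F\<close> either.\<close>

definition rotation_number :: "(circle \<Rightarrow> circle) \<Rightarrow> circle" where
  "rotation_number f =
     (THE \<rho>. \<exists>F x r. is_lift f F \<and> (\<lambda>n. (F ^^ n) x / real n) \<longlonglongrightarrow> r \<and> \<rho> = to_circle r)"

definition C1_tendsto :: "(nat \<Rightarrow> circle \<Rightarrow> circle) \<Rightarrow> (circle \<Rightarrow> circle) \<Rightarrow> bool" where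
  "C1_tendsto fs g \<longleftrightarrow>
     uniform_limit UNIV fs g sequentially \<and>
     uniform_limit UNIV (\<lambda>n. circle_deriv (fs n)) (circle_deriv g) sequentially"

end

theory Submission
  imports Defs "HOL-Complex_Analysis.Great_Picard"
begin

text \<open>Let \<open>F\<close>, \<open>G\<close> be lifts with the same irrational translation number and \<open>A\<^sub>n\<^sup>M u\<close> the average of
  \<open>u \<circ> M\<^sup>j\<close> over \<open>j < n\<close>. One looks for \<open>H\<close> such that \<open>M = H \<circ> F \<circ> H\<^sup>-\<^sup>1\<close> satisfies
  \<open>log DM = log DG - e\<close> with a small error \<open>e\<close>. With \<open>u = log DG \<circ> H - log DF\<close>, this is the cohomological equation
  \<open>log DH \<circ> F - log DH = u - e \<circ> H\<close>; its approximate solution by averaging determines \<open>DH\<close> in terms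
  of \<open>H\<close>, and Schauder's fixed point theorem yields \<open>H\<close>. The error is
  \<open>e = A\<^sub>n\<^sup>M (log DG) - A\<^sub>n\<^sup>F (log DF) \<circ> H\<^sup>-\<^sup>1\<close>. By the Denjoy-Koksma inequality its oscillation
  tends to \<open>0\<close>, at a rate depending only on the translation number, and \<open>e\<close> vanishes somewhere, so that
  \<open>DM \<rightarrow> DG\<close> uniformly; equality of the irrational translation numbers then forces \<open>M \<rightarrow> G\<close>.

  For the variation of \<open>e\<close> one shows that \<open>var (A\<^sub>n\<^sup>F u) \<rightarrow> 0\<close> for absolutely continuous \<open>u\<close>. Up to small
  variation, \<open>u\<close> is piecewise linear, i.e. a combination with total weight \<open>0\<close> of distribution
  functions of uniform measures on arcs. Bounded distortion of Denjoy intervals allows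
  each of them to be replaced, without affecting the asymptotics of the averages, by one that
  dominates a fixed multiple of a common one; the common part cancels, and the limiting variation is
  smaller than the variation of \<open>u\<close> by a constant factor. Applied to the averages themselves this
  gives the limit \<open>0\<close>.\<close>

section \<open>Variation of periodic functions\<close>

text \<open>The fixed point theorem gives no control of \<open>H\<close> as the averaging time n
  grows. Hence every estimate either uses a quantity that composition with lifts does not increase,
  such as variation, or depends on the map only through its translation number, such as the return
  times in the Denjoy-Koksma inequality. The term of the error that contains the moving map M is
  treated in two stages: a time m is fixed by the target G, averages of length m depend continuously
  on M near G with respect to variation, and passing from m to a much larger n costs O(m / n).

  Absolute continuity is used through approximation by finite combinations of distribution functions
  of arcs, which come from a polygon inscribed in the graph with nearly maximal length. Birkhoff
  sums of a coboundary have bounded variation, which averaging removes in the limit; this is the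
  freedom used to move an arc. Differences of distribution functions are estimated by cancelling the
  mass that the two measures share.\<close>

definition periodic :: "(real \<Rightarrow> 'a) \<Rightarrow> bool" where
  "periodic u \<longleftrightarrow> (\<forall>x. u (x + 1) = u x)"

definition degree_one :: "(real \<Rightarrow> real) \<Rightarrow> bool" where
  "degree_one F \<longleftrightarrow> (\<forall>x. F (x + 1) = F x + 1)"

definition partition_seq :: "real \<Rightarrow> real \<Rightarrow> nat \<Rightarrow> (nat \<Rightarrow> real) \<Rightarrow> bool" where
  "partition_seq a b n x \<longleftrightarrow> (\<forall>i<n. x i \<le> x (Suc i)) \<and> x 0 = a \<and> x n = b"

text \<open>A bound rather than a value, so that no supremum has to exist. The base point
  \<open>a\<close> is free, as in \<open>circle_var\<close>, which makes the notion stable under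
  monotone changes of variable of degree one.\<close>

definition var_le :: "(real \<Rightarrow> real) \<Rightarrow> real \<Rightarrow> bool" where
  "var_le u V \<longleftrightarrow>
     (\<forall>a n x. partition_seq a (a + 1) n x \<longrightarrow> (\<Sum>i<n. \<bar>u (x (Suc i)) - u (x i)\<bar>) \<le> V)"

lemma partition_seq_mono:
  assumes "partition_seq a b n x" "i \<le> j" "j \<le> n"
  shows "x i \<le> x j"
  using assms(2,3)
proof (induction j rule: dec_induct)
  case (step m)
  then have "x i \<le> x m" "m < n" by auto
  moreover have "x m \<le> x (Suc m)" using assms(1) \<open>m < n\<close> by (auto simp: partition_seq_def)
  ultimately show ?case by linarith
qed simp

lemma partition_seq_bounds:
  assumes "partition_seq a b n x" "i \<le> n"
  shows "a \<le> x i" "x i \<le> b"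
  using partition_seq_mono[OF assms(1), of 0 i] partition_seq_mono[OF assms(1), of i n] assms
  by (auto simp: partition_seq_def)

lemma partition_seq_comp:
  assumes "partition_seq a b n x" "mono F"
  shows "partition_seq (F a) (F b) n (\<lambda>i. F (x i))"
  using assms by (auto simp: partition_seq_def mono_def)

lemma partition_seq_append:
  assumes "partition_seq a b n x" "b \<le> c"
  shows "partition_seq a c (Suc n) (\<lambda>i. if i \<le> n then x i else c)"
  using assms by (auto simp: partition_seq_def less_Suc_eq)

lemma sum_partition_append:
  fixes c :: "real \<Rightarrow> real \<Rightarrow> real"
  assumes "partition_seq a b n x"
  shows "(\<Sum>i<Suc n. c ((\<lambda>i. if i \<le> n then x i else y) i) ((\<lambda>i. if i \<le> n then x i else y) (Suc i)))
       = (\<Sum>i<n. c (x i) (x (Suc i))) + c b y"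
  using assms by (auto simp: partition_seq_def intro!: sum.cong)

lemma periodic_int:
  assumes "periodic u" shows "u (x + of_int k) = u x"
proof (induction k arbitrary: x rule: int_induct[where k = 0])
  case (step1 i)
  have "u (x + of_int (i + 1)) = u ((x + of_int i) + 1)" by (simp add: algebra_simps)
  then show ?case using step1 assms by (simp add: periodic_def)
next
  case (step2 i)
  have "u (x + of_int (i - 1)) = u ((x + of_int (i - 1)) + 1)"
    using assms unfolding periodic_def by metis
  also have "\<dots> = u x" using step2(2)[of x] by (simp add: algebra_simps)
  finally show ?case .
qed simp

lemma degree_one_int:
  assumes "degree_one F" shows "F (x + of_int k) = F x + of_int k"
proof -
  have "periodic (\<lambda>x. F x - x)" using assms by (auto simp: periodic_def degree_one_def)
  from periodic_int[OF this, of x k] show ?thesis by simp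
qed

lemma periodic_comp: "periodic u \<Longrightarrow> degree_one F \<Longrightarrow> periodic (\<lambda>x. u (F x))"
  by (simp add: periodic_def degree_one_def)

lemma degree_one_comp: "degree_one G \<Longrightarrow> degree_one F \<Longrightarrow> degree_one (\<lambda>x. G (F x))"
  by (simp add: degree_one_def)

lemma periodic_diff_degree_one: "degree_one F \<Longrightarrow> degree_one G \<Longrightarrow> periodic (\<lambda>x. F x - G x)"
  by (simp add: periodic_def degree_one_def)

lemma degree_one_funpow: "degree_one F \<Longrightarrow> degree_one (F ^^ n)"
  by (induction n) (auto simp: degree_one_def)

lemma periodic_reduce:
  assumes "periodic u" obtains y where "a \<le> y" "y < a + 1" "u y = u x" "\<exists>k::int. y = x + of_int k"
proof
  let ?y = "x + of_int (- \<lfloor>x - a\<rfloor>)"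
  show "a \<le> ?y" "?y < a + 1" by (simp, linarith)+
  show "u ?y = u x" by (rule periodic_int[OF assms])
  show "\<exists>k::int. ?y = x + of_int k" by blast
qed

lemma var_leD: "var_le u V \<Longrightarrow> partition_seq a (a + 1) n x \<Longrightarrow>
    (\<Sum>i<n. \<bar>u (x (Suc i)) - u (x i)\<bar>) \<le> V"
  by (auto simp: var_le_def)

lemma var_le_mono: "var_le u V \<Longrightarrow> V \<le> W \<Longrightarrow> var_le u W"
  by (force simp: var_le_def)

lemma var_le_nonneg: assumes "var_le u V" shows "0 \<le> V"
proof -
  have "partition_seq 0 (0 + 1) 1 (\<lambda>i. real i)" by (simp add: partition_seq_def)
  from var_leD[OF assms this] show ?thesis by (rule order_trans[rotated]) (simp add: sum_nonneg)
qed

lemma var_le_add: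
  assumes "var_le u V" "var_le v W"
  shows "var_le (\<lambda>x. u x + v x) (V + W)"
  unfolding var_le_def
proof (intro allI impI)
  fix a n x assume p: "partition_seq a (a + 1) n x"
  have "(\<Sum>i<n. \<bar>u (x (Suc i)) + v (x (Suc i)) - (u (x i) + v (x i))\<bar>)
      \<le> (\<Sum>i<n. \<bar>u (x (Suc i)) - u (x i)\<bar> + \<bar>v (x (Suc i)) - v (x i)\<bar>)"
    by (intro sum_mono) linarith
  also have "\<dots> \<le> V + W"
    unfolding sum.distrib using var_leD[OF assms(1) p] var_leD[OF assms(2) p] by linarith
  finally show "(\<Sum>i<n. \<bar>u (x (Suc i)) + v (x (Suc i)) - (u (x i) + v (x i))\<bar>) \<le> V + W" .
qed

lemma var_le_cmult:
  assumes "var_le u V" shows "var_le (\<lambda>x. c * u x) (\<bar>c\<bar> * V)"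
  unfolding var_le_def
proof (intro allI impI)
  fix a n x assume p: "partition_seq a (a + 1) n x"
  have "(\<Sum>i<n. \<bar>c * u (x (Suc i)) - c * u (x i)\<bar>) = \<bar>c\<bar> * (\<Sum>i<n. \<bar>u (x (Suc i)) - u (x i)\<bar>)"
    by (simp add: sum_distrib_left abs_mult right_diff_distrib[symmetric])
  also have "\<dots> \<le> \<bar>c\<bar> * V" using var_leD[OF assms p] by (simp add: mult_left_mono)
  finally show "(\<Sum>i<n. \<bar>c * u (x (Suc i)) - c * u (x i)\<bar>) \<le> \<bar>c\<bar> * V" .
qed

lemma var_le_uminus: "var_le u V \<Longrightarrow> var_le (\<lambda>x. - u x) V"
  using var_le_cmult[of u V "-1"] by simp

lemma var_le_diff: "var_le u V \<Longrightarrow> var_le v W \<Longrightarrow> var_le (\<lambda>x. u x - v x) (V + W)"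
  using var_le_add[of u V "\<lambda>x. - v x" W] var_le_uminus[of v W] by simp

lemma var_le_const: "0 \<le> V \<Longrightarrow> var_le (\<lambda>x. c) V"
  by (simp add: var_le_def)

lemma var_le_add_const: "var_le u V \<Longrightarrow> var_le (\<lambda>x. u x + c) V"
  by (simp add: var_le_def)

lemma var_le_sum:
  assumes "\<And>i. i \<in> A \<Longrightarrow> var_le (u i) (V i)"
  shows "var_le (\<lambda>x. \<Sum>i\<in>A. u i x) (\<Sum>i\<in>A. V i)"
  using assms
proof (induction A rule: infinite_finite_induct)
  case (insert i A)
  then have "var_le (\<lambda>x. u i x + (\<Sum>i\<in>A. u i x)) (V i + (\<Sum>i\<in>A. V i))"
    by (intro var_le_add) auto
  then show ?case using insert by simp
qed (auto intro: var_le_const)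

lemma var_le_comp:
  assumes "var_le u V" "mono F" "degree_one F"
  shows "var_le (\<lambda>x. u (F x)) V"
  unfolding var_le_def
proof (intro allI impI)
  fix a n x assume p: "partition_seq a (a + 1) n x"
  from partition_seq_comp[OF this assms(2)] have "partition_seq (F a) (F a + 1) n (\<lambda>i. F (x i))"
    using assms(3) by (simp add: degree_one_def)
  from var_leD[OF assms(1) this] show "(\<Sum>i<n. \<bar>u (F (x (Suc i))) - u (F (x i))\<bar>) \<le> V" .
qed

lemma var_le_osc_interval:
  assumes "var_le u V" "x \<le> y" "y \<le> x + 1"
  shows "\<bar>u x - u y\<bar> \<le> V"
proof -
  let ?p = "\<lambda>i::nat. if i = 0 then x else if i = 1 then y else x + 1"
  have "partition_seq x (x + 1) 2 ?p"
    using assms by (auto simp: partition_seq_def)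
  from var_leD[OF assms(1) this] show ?thesis by (simp add: numeral_2_eq_2)
qed

lemma var_le_osc:
  assumes "var_le u V" "periodic u"
  shows "\<bar>u x - u y\<bar> \<le> V"
proof -
  obtain z where z: "x \<le> z" "z < x + 1" "u z = u y"
    using periodic_reduce[OF assms(2), of x y] by metis
  with var_le_osc_interval[OF assms(1), of x z] show ?thesis by simp
qed

text \<open>For a distribution function the partition sums telescope to the mass of one
  period.\<close>

lemma var_le_mono_fun:
  assumes "mono \<Lambda>" "\<And>x. \<Lambda> (x + 1) = \<Lambda> x + c"
  shows "var_le \<Lambda> c"
  unfolding var_le_def
proof (intro allI impI)
  fix a n x assume p: "partition_seq a (a + 1) n x"
  have "(\<Sum>i<n. \<bar>\<Lambda> (x (Suc i)) - \<Lambda> (x i)\<bar>) = (\<Sum>i<n. \<Lambda> (x (Suc i)) - \<Lambda> (x i))"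
    using p assms(1) by (intro sum.cong) (auto simp: partition_seq_def mono_def)
  also have "\<dots> = \<Lambda> (x n) - \<Lambda> (x 0)" by (rule sum_lessThan_telescope)
  finally show "(\<Sum>i<n. \<bar>\<Lambda> (x (Suc i)) - \<Lambda> (x i)\<bar>) \<le> c"
    using p assms(2)[of a] by (simp add: partition_seq_def)
qed

text \<open>A cost whose sums over partitions are bounded is dominated by the increments of a monotone
  function; this makes it possible to compare partition sums without common refinements.\<close>

lemma monotone_majorant:
  fixes c :: "real \<Rightarrow> real \<Rightarrow> real"
  assumes ab: "a \<le> b" and nn: "\<And>x y. 0 \<le> c x y"
    and bd: "\<And>n x. partition_seq a b n x \<Longrightarrow> (\<Sum>i<n. c (x i) (x (Suc i))) \<le> B"
  obtains \<Phi> where "\<And>x y. a \<le> x \<Longrightarrow> x \<le> y \<Longrightarrow> y \<le> b \<Longrightarrow> c x y \<le> \<Phi> y - \<Phi> x"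
    and "\<Phi> a \<ge> 0"
    and "\<And>\<epsilon>. \<epsilon> > 0 \<Longrightarrow> \<exists>n x. partition_seq a b n x \<and> \<Phi> b - \<epsilon> < (\<Sum>i<n. c (x i) (x (Suc i)))"
    and "\<Phi> b \<le> B"
proof -
  \<comment> \<open>\<open>\<Phi> t\<close> is the supremum of the partition sums on
    \<open>[a, t]\<close>. Appending a point to a partition adds one cost, and this is the claimed
    domination of \<open>c\<close> by increments of \<open>\<Phi>\<close>.\<close>
  define S where "S t = {(\<Sum>i<n. c (x i) (x (Suc i))) | n x. partition_seq a t n x}" for t
  define \<Phi> where "\<Phi> t = Sup (S t)" for t
  have bdd: "s \<le> B" if "s \<in> S t" "t \<le> b" for s t
  proof -
    from that obtain n x where p: "partition_seq a t n x" and s: "s = (\<Sum>i<n. c (x i) (x (Suc i)))"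
      by (auto simp: S_def)
    have "s + c t b \<le> B"
      using bd[OF partition_seq_append[OF p that(2)]] unfolding sum_partition_append[OF p] s by simp
    with nn[of t b] show ?thesis by linarith
  qed
  have bdd': "bdd_above (S t)" if "t \<le> b" for t
    using bdd that by (intro bdd_aboveI[of _ B]) auto
  have ne: "S t \<noteq> {}" if "a \<le> t" for t
  proof -
    have "partition_seq a t 1 (\<lambda>i. if i = 0 then a else t)" using that by (simp add: partition_seq_def)
    then show ?thesis unfolding S_def by blast
  qed
  show thesis
  proof (rule that[of \<Phi>])
    fix x y assume xy: "a \<le> x" "x \<le> y" "y \<le> b"
    have "\<Phi> x \<le> \<Phi> y - c x y"
      unfolding \<Phi>_def[of x]
    proof (rule cSup_least)
      show "S x \<noteq> {}" using ne xy by simp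
      fix s assume "s \<in> S x"
      then obtain n z where p: "partition_seq a x n z" and s: "s = (\<Sum>i<n. c (z i) (z (Suc i)))"
        by (auto simp: S_def)
      have "s + c x y \<in> S y"
        unfolding S_def mem_Collect_eq s sum_partition_append[OF p, of c y, symmetric]
        using partition_seq_append[OF p xy(2)] by (intro exI conjI) (rule refl)
      then have "s + c x y \<le> \<Phi> y" unfolding \<Phi>_def using bdd' xy by (intro cSup_upper) auto
      then show "s \<le> \<Phi> y - c x y" by simp
    qed
    then show "c x y \<le> \<Phi> y - \<Phi> x" by simp
  next
    have "partition_seq a a 0 (\<lambda>i. a)" by (simp add: partition_seq_def)
    then have m: "(\<Sum>i<(0::nat). c ((\<lambda>i. a) i) ((\<lambda>i. a) (Suc i))) \<in> S a"
      unfolding S_def mem_Collect_eq by (intro exI conjI) (rule refl)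
    from cSup_upper[OF m bdd'[OF ab]] show "\<Phi> a \<ge> 0" by (simp add: \<Phi>_def)
  next
    fix \<epsilon> :: real assume "\<epsilon> > 0"
    then have "\<Phi> b - \<epsilon> < Sup (S b)" by (simp add: \<Phi>_def)
    then obtain s where "s \<in> S b" "\<Phi> b - \<epsilon> < s" using less_cSupD[OF ne] ab by metis
    then show "\<exists>n x. partition_seq a b n x \<and> \<Phi> b - \<epsilon> < (\<Sum>i<n. c (x i) (x (Suc i)))"
      by (auto simp: S_def)
  next
    show "\<Phi> b \<le> B" unfolding \<Phi>_def using ne bdd ab by (intro cSup_least) auto
  qed
qed

text \<open>\<open>\<Psi>\<close> behaves like a lift of the total variation function. Unlike a
  bound for partition sums, its increments can be added up over any family of arcs that do not
  overlap modulo 1.\<close>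

definition var_majorant :: "(real \<Rightarrow> real) \<Rightarrow> real \<Rightarrow> (real \<Rightarrow> real) \<Rightarrow> bool" where
  "var_majorant u V \<Psi> \<longleftrightarrow>
     (\<forall>x y. x \<le> y \<longrightarrow> \<bar>u y - u x\<bar> \<le> \<Psi> y - \<Psi> x) \<and> (\<forall>x. \<Psi> (x + 1) = \<Psi> x + V)"

lemma var_majorant_mono: "var_majorant u V \<Psi> \<Longrightarrow> x \<le> y \<Longrightarrow> \<Psi> x \<le> \<Psi> y"
  unfolding var_majorant_def by (meson abs_ge_zero diff_ge_0_iff_ge order_trans)

lemma var_majorant_int:
  assumes "var_majorant u V \<Psi>" shows "\<Psi> (x + of_int k) = \<Psi> x + of_int k * V"
proof -
  have "periodic (\<lambda>x. \<Psi> x - x * V)" using assms by (auto simp: periodic_def var_majorant_def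
      algebra_simps)
  from periodic_int[OF this, of x k] show ?thesis by (simp add: algebra_simps)
qed

lemma var_majorant_imp_var_le:
  assumes "var_majorant u V \<Psi>" shows "var_le u V"
  unfolding var_le_def
proof (intro allI impI)
  fix a n x assume p: "partition_seq a (a + 1) n x"
  have "(\<Sum>i<n. \<bar>u (x (Suc i)) - u (x i)\<bar>) \<le> (\<Sum>i<n. \<Psi> (x (Suc i)) - \<Psi> (x i))"
    using p assms by (intro sum_mono) (auto simp: partition_seq_def var_majorant_def)
  also have "\<dots> = \<Psi> (x n) - \<Psi> (x 0)" by (rule sum_lessThan_telescope)
  finally show "(\<Sum>i<n. \<bar>u (x (Suc i)) - u (x i)\<bar>) \<le> V"
    using p assms by (simp add: partition_seq_def var_majorant_def)
qed

text \<open>Cutting at the integers reduces arbitrary base points to partitions of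
  \<open>[0, 1]\<close>: the majorant of the unit interval is continued by adding \<open>V\<close>
  per period.\<close>

lemma periodic_majorant:
  assumes per: "periodic u"
    and bd: "\<And>n x. partition_seq 0 1 n x \<Longrightarrow> (\<Sum>i<n. \<bar>u (x (Suc i)) - u (x i)\<bar>) \<le> V"
  obtains \<Psi> where "var_majorant u V \<Psi>"
proof -
  obtain \<Phi> where \<Phi>: "\<And>x y. 0 \<le> x \<Longrightarrow> x \<le> y \<Longrightarrow> y \<le> 1 \<Longrightarrow> \<bar>u y - u x\<bar> \<le> \<Phi> y - \<Phi> x"
      and \<Phi>0: "\<Phi> 0 \<ge> 0" and \<Phi>1: "\<Phi> 1 \<le> V"
    by (rule monotone_majorant[of 0 1 "\<lambda>x y. \<bar>u y - u x\<bar>" V]) (use bd in auto)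
  \<comment> \<open>Each period contributes \<open>V\<close>, which may exceed
    \<open>\<Phi> 1 - \<Phi> 0\<close>; the surplus becomes a jump at the integers and keeps
    \<open>\<Psi>\<close> increasing.\<close>
  define \<Psi> where "\<Psi> x = of_int \<lfloor>x\<rfloor> * V + \<Phi> (frac x)" for x
  have fr: "0 \<le> frac x" "frac x \<le> 1" for x :: real
    using frac_lt_1[of x] by (auto simp: frac_ge_0)
  have uf: "u (frac x) = u x" for x
    using periodic_int[OF per, of "frac x" "\<lfloor>x\<rfloor>"] by (simp add: frac_def)
  have u01: "u 1 = u 0" using per[unfolded periodic_def, rule_format, of 0] by simp
  have mm: "\<bar>u y - u x\<bar> \<le> \<Psi> y - \<Psi> x" if "x \<le> y" for x y
  proof (cases "\<lfloor>x\<rfloor> = \<lfloor>y\<rfloor>")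
    case True
    then have "frac x \<le> frac y" using that by (simp add: frac_def)
    from \<Phi>[OF fr(1) this fr(2)] show ?thesis using True by (simp add: \<Psi>_def uf)
  next
    case False
    with that have "\<lfloor>x\<rfloor> + 1 \<le> \<lfloor>y\<rfloor>" using floor_mono[OF that] by linarith
    then have "of_int (\<lfloor>y\<rfloor> - \<lfloor>x\<rfloor>) \<ge> (1::real)" by linarith
    moreover have V: "V \<ge> 0" using \<Phi>[of 0 1] \<Phi>0 \<Phi>1 by simp
    ultimately have "of_int (\<lfloor>y\<rfloor> - \<lfloor>x\<rfloor>) * V \<ge> V" using mult_right_mono[of 1 _ V] by simp
    then have 1: "of_int \<lfloor>y\<rfloor> * V - of_int \<lfloor>x\<rfloor> * V \<ge> V" by (simp add: algebra_simps)
    have "\<bar>u y - u 0\<bar> \<le> \<Phi> (frac y) - \<Phi> 0" using \<Phi>[of 0 "frac y"] fr by (simp add: uf)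
    moreover have "\<bar>u 1 - u x\<bar> \<le> \<Phi> 1 - \<Phi> (frac x)" using \<Phi>[of "frac x" 1] fr by (simp add: uf)
    ultimately show ?thesis using 1 u01 \<Phi>0 \<Phi>1 by (simp add: \<Psi>_def)
  qed
  moreover have "\<Psi> (x + 1) = \<Psi> x + V" for x
    by (simp add: \<Psi>_def frac_def algebra_simps)
  ultimately show ?thesis using that by (auto simp: var_majorant_def)
qed

lemma var_le_majorant:
  assumes "var_le u V" "periodic u"
  obtains \<Psi> where "var_majorant u V \<Psi>"
  by (rule periodic_majorant[OF assms(2)]) (use var_leD[OF assms(1), of 0] in auto)

lemma var_le_periodicI:
  assumes "periodic u"
    and "\<And>n x. partition_seq 0 1 n x \<Longrightarrow> (\<Sum>i<n. \<bar>u (x (Suc i)) - u (x i)\<bar>) \<le> V"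
  shows "var_le u V"
  by (rule periodic_majorant[OF assms]) (auto intro: var_majorant_imp_var_le)

text \<open>Induction on the intervals sorted by left endpoint: all others end before the last one
  begins.\<close>

lemma sum_nonoverlapping:
  fixes \<Psi> :: "real \<Rightarrow> real" and a b :: "'i \<Rightarrow> real"
  assumes "finite A" and mono: "\<And>x y. x \<le> y \<Longrightarrow> \<Psi> x \<le> \<Psi> y"
    and "\<And>i. i \<in> A \<Longrightarrow> c \<le> a i \<and> a i < b i \<and> b i \<le> e"
    and "\<And>i j. i \<in> A \<Longrightarrow> j \<in> A \<Longrightarrow> i \<noteq> j \<Longrightarrow> b i \<le> a j \<or> b j \<le> a i"
    and "c \<le> e"
  shows "(\<Sum>i\<in>A. \<Psi> (b i) - \<Psi> (a i)) \<le> \<Psi> e - \<Psi> c"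
  using assms(1,3,4,5)
proof (induction A arbitrary: e rule: finite_ranking_induct[where f = a])
  case empty
  then show ?case using mono by simp
next
  case (insert x S)
  show ?case
  proof (cases "x \<in> S")
    case True
    with insert show ?thesis by (simp add: insert_absorb)
  next
    case False
    have "(\<Sum>i\<in>S. \<Psi> (b i) - \<Psi> (a i)) \<le> \<Psi> (a x) - \<Psi> c"
    proof (rule insert.IH)
      fix i assume "i \<in> S"
      moreover have "b i \<le> a x"
        using insert.prems(2)[of i x] insert.prems(1)[of x] insert.hyps(2)[of i] \<open>i \<in> S\<close> False
        by force
      ultimately show "c \<le> a i \<and> a i < b i \<and> b i \<le> a x" using insert.prems(1) by auto
    qed (use insert.prems in auto)
    moreover have "\<Psi> (b x) \<le> \<Psi> e" using insert.prems(1)[of x] by (intro mono) auto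
    ultimately show ?thesis using False insert.hyps(1) by simp
  qed
qed

text \<open>Integer translations move all left endpoints into the period that begins at the left
  endpoint of a chosen interval \<open>k\<close>, where the real-line version applies.\<close>

lemma sum_nonoverlapping_mod_1:
  fixes a b :: "'i \<Rightarrow> real"
  assumes \<Psi>: "var_majorant u V \<Psi>" and V: "V \<ge> 0" and "finite A"
    and lt: "\<And>i. i \<in> A \<Longrightarrow> a i < b i"
    and dj: "\<And>i j m. i \<in> A \<Longrightarrow> j \<in> A \<Longrightarrow> i \<noteq> j \<or> m \<noteq> 0 \<Longrightarrow>
                b i \<le> a j + of_int m \<or> b j + of_int m \<le> a i"
  shows "(\<Sum>i\<in>A. \<Psi> (b i) - \<Psi> (a i)) \<le> V"
proof (cases "A = {}")
  case False
  then obtain k where k: "k \<in> A" by blast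
  define s where "s i = - \<lfloor>a i - a k\<rfloor>" for i
  define a' b' where "a' i = a i + of_int (s i)" and "b' i = b i + of_int (s i)" for i
  have a': "a k \<le> a' i" "a' i < a k + 1" for i
    unfolding a'_def s_def by linarith+
  have sk: "s k = 0" by (simp add: s_def)
  have shift: "\<Psi> (b i) - \<Psi> (a i) = \<Psi> (b' i) - \<Psi> (a' i)" for i
    unfolding a'_def b'_def var_majorant_int[OF \<Psi>] by simp
  have "(\<Sum>i\<in>A. \<Psi> (b' i) - \<Psi> (a' i)) \<le> \<Psi> (a k + 1) - \<Psi> (a k)"
  proof (rule sum_nonoverlapping[OF \<open>finite A\<close>, where a = a' and b = b' and \<Psi> = \<Psi>])
    fix i assume i: "i \<in> A"
    \<comment> \<open>The next translate of interval \<open>k\<close> begins at the end of the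
      period. Interval \<open>i\<close> does not overlap it and therefore does not reach beyond the
      period.\<close>
    have "b i \<le> a k + of_int (1 - s i) \<or> b k + of_int (1 - s i) \<le> a i"
    proof (cases "i = k \<and> 1 - s i = 0")
      case True
      with sk have "s i = 0" "s i = 1" by auto
      then show ?thesis by simp
    next
      case False
      then show ?thesis using dj[OF i k, of "1 - s i"] by auto
    qed
    moreover have "\<not> b k + of_int (1 - s i) \<le> a i" using a'(2)[of i] lt[OF k] by (simp add: a'_def)
    ultimately have "b' i \<le> a k + 1" by (simp add: b'_def)
    then show "a k \<le> a' i \<and> a' i < b' i \<and> b' i \<le> a k + 1" using a' lt[OF i] by (simp add: a'_def b'_def)
  next
    fix i j assume "i \<in> A" "j \<in> A" "i \<noteq> j"
    then show "b' i \<le> a' j \<or> b' j \<le> a' i" using dj[of i j "s j - s i"] by (auto simp: a'_def b'_def)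
  qed (use var_majorant_mono[OF \<Psi>] in auto)
  also have "\<dots> = V" using \<Psi> by (simp add: var_majorant_def)
  finally show ?thesis by (simp add: shift)
qed (use V in simp)

section \<open>Ramps\<close>

text \<open>The lift of the distribution function of the uniform distribution on the arc \<open>[a, b]\<close>.\<close>

definition ramp :: "real \<Rightarrow> real \<Rightarrow> real \<Rightarrow> real" where
  "ramp a b x = of_int \<lfloor>x - a\<rfloor> + min 1 (frac (x - a) / (b - a))"

lemma ramp_degree_one: "degree_one (ramp a b)"
proof -
  have e: "x + 1 - a = (x - a) + 1" for x by simp
  show ?thesis unfolding degree_one_def ramp_def e frac_def by simp
qed

lemma ramp_affine:
  assumes "a < b" "b \<le> a + 1" "a \<le> x" "x \<le> b"
  shows "ramp a b x = (x - a) / (b - a)"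
proof (cases "x < a + 1")
  case True
  then have "\<lfloor>x - a\<rfloor> = 0" using assms by linarith
  then show ?thesis using assms by (simp add: ramp_def frac_def)
next
  case False
  with assms have [simp]: "x = a + 1" "b = a + 1" by auto
  show ?thesis by (simp add: ramp_def frac_def)
qed

lemma ramp_flat:
  assumes "a < b" "b \<le> a + 1" "b \<le> x" "x \<le> a + 1"
  shows "ramp a b x = 1"
proof (cases "x < a + 1")
  case True
  then have "\<lfloor>x - a\<rfloor> = 0" using assms by linarith
  then show ?thesis using assms by (simp add: ramp_def frac_def)
next
  case False
  with assms have [simp]: "x = a + 1" by auto
  show ?thesis by (simp add: ramp_def frac_def)
qed

lemma degree_one_mono_onI:
  assumes per: "\<And>x. D (x + 1) = D x + c" and on: "\<And>x y. a \<le> x \<Longrightarrow> x \<le> y \<Longrightarrow> y \<le> a + 1 \<Longrightarrow> D x \<le> D y"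
  shows "mono (D :: real \<Rightarrow> real)"
proof (rule monoI)
  fix x y :: real assume xy: "x \<le> y"
  have "periodic (\<lambda>x. D x - x * c)" using per by (auto simp: periodic_def algebra_simps)
  from periodic_int[OF this] have D: "D (x + of_int k) = D x + of_int k * c" for x k
    by (simp add: algebra_simps)
  have c: "c \<ge> 0" using on[of a "a + 1"] per[of a] by simp
  define i j where "i = \<lfloor>x - a\<rfloor>" and "j = \<lfloor>y - a\<rfloor>"
  define x' y' where "x' = x - of_int i" and "y' = y - of_int j"
  have x': "a \<le> x'" "x' \<le> a + 1" and y': "a \<le> y'" "y' \<le> a + 1"
    unfolding x'_def y'_def i_def j_def by linarith+
  have Dx: "D x = D x' + of_int i * c" and Dy: "D y = D y' + of_int j * c"
    using D[of x' i] D[of y' j] by (simp_all add: x'_def y'_def)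
  have ij: "i \<le> j" unfolding i_def j_def using xy by (intro floor_mono) simp
  show "D x \<le> D y"
  proof (cases "i = j")
    case True
    then show ?thesis using on[of x' y'] x' y' xy by (simp add: Dx Dy x'_def y'_def)
  next
    case False
    with ij have "of_int (j - i) \<ge> (1::real)" by linarith
    then have "of_int (j - i) * c \<ge> c" using mult_right_mono[of 1 _ c] c by simp
    moreover have "D x' \<le> D (a + 1)" "D a \<le> D y'" using on x' y' by auto
    ultimately show ?thesis using per[of a] by (simp add: Dx Dy algebra_simps)
  qed
qed

text \<open>In terms of measures: a density of at least \<open>\<kappa>\<close> on the arc allows
  the uniform mass \<open>\<kappa> * (b - a)\<close> to be taken away from it.\<close>

lemma mono_minus_ramp:
  assumes "mono \<Lambda>" "\<And>x. \<Lambda> (x + 1) = \<Lambda> x + d" "a < b" "b \<le> a + 1"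
    and slope: "\<And>s t. a \<le> s \<Longrightarrow> s \<le> t \<Longrightarrow> t \<le> b \<Longrightarrow> \<kappa> * (t - s) \<le> \<Lambda> t - \<Lambda> s"
  shows "mono (\<lambda>x. \<Lambda> x - \<kappa> * (b - a) * ramp a b x)"
proof (rule degree_one_mono_onI[where a = a])
  fix x
  show "\<Lambda> (x + 1) - \<kappa> * (b - a) * ramp a b (x + 1) = \<Lambda> x - \<kappa> * (b - a) * ramp a b x + (d - \<kappa> * (b - a))"
    unfolding assms(2) ramp_degree_one[of a b, unfolded degree_one_def, rule_format]
    by (simp add: algebra_simps)
next
  have low: "\<Lambda> x - \<kappa> * (b - a) * ramp a b x \<le> \<Lambda> y - \<kappa> * (b - a) * ramp a b y"
    if "a \<le> x" "x \<le> y" "y \<le> b" for x y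
  proof -
    have "\<kappa> * (b - a) * ramp a b z = \<kappa> * (z - a)" if "a \<le> z" "z \<le> b" for z
      using ramp_affine[OF assms(3,4) that] assms(3) by simp
    from this[of x] this[of y] show ?thesis using slope[of x y] that by (simp add: algebra_simps)
  qed
  have high: "\<Lambda> x - \<kappa> * (b - a) * ramp a b x \<le> \<Lambda> y - \<kappa> * (b - a) * ramp a b y"
    if "b \<le> x" "x \<le> y" "y \<le> a + 1" for x y
    using ramp_flat[OF assms(3,4), of x] ramp_flat[OF assms(3,4), of y] that assms(1)
    by (auto simp: mono_def)
  fix x y assume xy: "a \<le> x" "x \<le> y" "y \<le> a + 1"
  consider "y \<le> b" | "b \<le> x" | "x \<le> b" "b \<le> y" by linarith
  then show "\<Lambda> x - \<kappa> * (b - a) * ramp a b x \<le> \<Lambda> y - \<kappa> * (b - a) * ramp a b y"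
  proof cases
    case 3
    then show ?thesis using low[of x b] high[of b y] xy by linarith
  qed (use low high xy in auto)
qed

lemma ramp_mono:
  assumes "a < b" "b \<le> a + 1" shows "mono (ramp a b)"
proof (rule degree_one_mono_onI[where a = a and c = 1])
  fix x y assume xy: "a \<le> x" "x \<le> y" "y \<le> a + 1"
  consider "y \<le> b" | "b \<le> x" | "x \<le> b" "b \<le> y" by linarith
  then show "ramp a b x \<le> ramp a b y"
    by cases (use xy assms in \<open>simp_all add: ramp_affine ramp_flat divide_right_mono\<close>)
qed (use ramp_degree_one in \<open>simp add: degree_one_def\<close>)

text \<open>The weights are the relative lengths of the subarcs, as for a uniform distribution
  conditioned on each of them. This permits cutting a long arc into Denjoy intervals one at a
  time.\<close>

lemma ramp_split:
  assumes "a < c" "c < b" "b \<le> a + 1"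
  shows "ramp a b x = (c - a) / (b - a) * ramp a c x + (b - c) / (b - a) * ramp c b x"
proof -
  define s t where "s = (c - a) / (b - a)" and "t = (b - c) / (b - a)"
  have st: "s + t = 1" using assms by (simp add: s_def t_def add_divide_distrib[symmetric])
  have *: "ramp a b x = s * ramp a c x + t * ramp c b x"
    if x: "a \<le> x" "x < a + 1" for x
  proof -
    have cb: "ramp c b x = 0" if "x \<le> c"
    proof -
      have "ramp c b (x + 1) = 1" using that x assms by (intro ramp_flat) auto
      then show ?thesis using ramp_degree_one[of c b] by (simp add: degree_one_def)
    qed
    consider "x \<le> c" | "c \<le> x" "x \<le> b" | "b \<le> x" by linarith
    then show ?thesis
    proof cases
      case 1
      then show ?thesis using x assms cb by (simp add: s_def ramp_affine)
    next
      case 2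
      then show ?thesis using x assms
        by (simp add: s_def t_def ramp_affine ramp_flat add_divide_distrib[symmetric])
    next
      case 3
      then show ?thesis using x assms st by (simp add: ramp_flat)
    qed
  qed
  have "periodic (\<lambda>x. ramp a b x - (s * ramp a c x + t * ramp c b x))"
    unfolding periodic_def
  proof
    fix x
    have "ramp a b x + 1 - (s * (ramp a c x + 1) + t * (ramp c b x + 1))
        = ramp a b x - (s * ramp a c x + t * ramp c b x) + (1 - (s + t))" by algebra
    then show "ramp a b (x + 1) - (s * ramp a c (x + 1) + t * ramp c b (x + 1))
        = ramp a b x - (s * ramp a c x + t * ramp c b x)"
      using ramp_degree_one st by (simp add: degree_one_def)
  qed
  then obtain y where "a \<le> y" "y < a + 1"
     "ramp a b y - (s * ramp a c y + t * ramp c b y) = ramp a b x - (s * ramp a c x + t * ramp c b x)"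
    using periodic_reduce[of "\<lambda>x. ramp a b x - (s * ramp a c x + t * ramp c b x)" a x] by metis
  with *[of y] show ?thesis by (simp add: s_def t_def)
qed

text \<open>The common mass \<open>c\<close> cancels in the difference; what remains of either
  measure has mass \<open>1 - c\<close>.\<close>

lemma var_le_common_part:
  assumes "\<And>x. \<Lambda>\<^sub>1 (x + 1) = \<Lambda>\<^sub>1 x + 1" "\<And>x. \<Lambda>\<^sub>2 (x + 1) = \<Lambda>\<^sub>2 x + 1" "\<And>x. m (x + 1) = m x + c"
    and "mono (\<lambda>x. \<Lambda>\<^sub>1 x - m x)" "mono (\<lambda>x. \<Lambda>\<^sub>2 x - m x)"
  shows "var_le (\<lambda>x. \<Lambda>\<^sub>1 x - \<Lambda>\<^sub>2 x) (2 * (1 - c))"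
proof -
  have "var_le (\<lambda>x. (\<Lambda>\<^sub>1 x - m x) - (\<Lambda>\<^sub>2 x - m x)) ((1 - c) + (1 - c))"
    by (intro var_le_diff var_le_mono_fun assms(4,5)) (simp_all add: assms(1-3))
  then show ?thesis by simp
qed

section \<open>Absolutely continuous functions\<close>

lemma ramp_zero:
  assumes "a < b" "b \<le> x + 1" "x \<le> a"
  shows "ramp a b x = 0"
proof -
  have "ramp a b (x + 1) = 1" using assms by (intro ramp_flat) auto
  then show ?thesis using ramp_degree_one[of a b] by (simp add: degree_one_def)
qed

lemma abs_continuous_finite:
  assumes "abs_continuous_on_interval a b u" "\<epsilon> > 0"
  obtains \<delta> where "\<delta> > 0"
    "\<And>(A :: 'i set) s t. finite A \<Longrightarrow> (\<And>i. i \<in> A \<Longrightarrow> a \<le> s i \<and> s i \<le> t i \<and> t i \<le> b) \<Longrightarrow>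
        disjoint_family_on (\<lambda>i. {s i<..<t i}) A \<Longrightarrow> (\<Sum>i\<in>A. t i - s i) < \<delta> \<Longrightarrow>
        (\<Sum>i\<in>A. \<bar>u (t i) - u (s i)\<bar>) < \<epsilon>"
proof -
  obtain \<delta> where \<delta>: "\<delta> > 0" and "\<forall>(n::nat) s t.
        (\<forall>i<n. a \<le> s i \<and> s i \<le> t i \<and> t i \<le> b) \<and>
        disjoint_family_on (\<lambda>i. {s i<..<t i}) {..<n} \<and>
        (\<Sum>i<n. t i - s i) < \<delta> \<longrightarrow> (\<Sum>i<n. \<bar>u (t i) - u (s i)\<bar>) < \<epsilon>"
    using assms unfolding abs_continuous_on_interval_def by meson
  then have *: "(\<Sum>i<n. \<bar>u (t i) - u (s i)\<bar>) < \<epsilon>" if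
        "\<forall>i<n. a \<le> s i \<and> s i \<le> t i \<and> t i \<le> b"
        "disjoint_family_on (\<lambda>i. {s i<..<t i}) {..<n}"
        "(\<Sum>i<n. t i - s i) < \<delta>" for n :: nat and s t
    using that by simp
  show thesis
  proof (rule that[OF \<delta>])
    fix A :: "'i set" and s t :: "'i \<Rightarrow> real"
    assume A: "finite A" and st: "\<And>i. i \<in> A \<Longrightarrow> a \<le> s i \<and> s i \<le> t i \<and> t i \<le> b"
      and dj: "disjoint_family_on (\<lambda>i. {s i<..<t i}) A" and len: "(\<Sum>i\<in>A. t i - s i) < \<delta>"
    obtain h where h: "bij_betw h {..<card A} A"
      using ex_bij_betw_nat_finite[OF A] by (auto simp: lessThan_atLeast0)
    have hA: "h i \<in> A" if "i < card A" for i using h that by (auto simp: bij_betw_def)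
    have "(\<Sum>i<card A. \<bar>u (t (h i)) - u (s (h i))\<bar>) < \<epsilon>"
    proof (rule *)
      show "\<forall>i<card A. a \<le> s (h i) \<and> s (h i) \<le> t (h i) \<and> t (h i) \<le> b" using st hA by blast
      show "disjoint_family_on (\<lambda>i. {s (h i)<..<t (h i)}) {..<card A}"
        unfolding disjoint_family_on_def
      proof (intro ballI impI)
        fix i j assume "i \<in> {..<card A}" "j \<in> {..<card A}" "i \<noteq> j"
        then show "{s (h i)<..<t (h i)} \<inter> {s (h j)<..<t (h j)} = {}"
          using dj hA h unfolding disjoint_family_on_def bij_betw_def inj_on_def by blast
      qed
      show "(\<Sum>i<card A. t (h i) - s (h i)) < \<delta>"
        using len sum.reindex_bij_betw[OF h, of "\<lambda>i. t i - s i"] by simp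
    qed
    then show "(\<Sum>i\<in>A. \<bar>u (t i) - u (s i)\<bar>) < \<epsilon>"
      using sum.reindex_bij_betw[OF h, of "\<lambda>i. \<bar>u (t i) - u (s i)\<bar>"] by simp
  qed
qed

text \<open>For a segment \<open>(\<alpha>, \<beta>)\<close> the deviation from the slope \<open>m\<close> is controlled by the defect between
  its length and the length of its projection to the direction \<open>(1, m)\<close>.\<close>

lemma slope_deviation:
  fixes \<alpha> \<beta> m \<eta> :: real
  assumes "\<eta> > 0"
  shows "\<bar>\<beta> - m * \<alpha>\<bar> \<le> sqrt (1 + m\<^sup>2) * (\<eta> * sqrt (\<alpha>\<^sup>2 + \<beta>\<^sup>2)
           + (sqrt (\<alpha>\<^sup>2 + \<beta>\<^sup>2) - (\<alpha> + m * \<beta>) / sqrt (1 + m\<^sup>2)) / (2 * \<eta>))"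
    and "(\<alpha> + m * \<beta>) / sqrt (1 + m\<^sup>2) \<le> sqrt (\<alpha>\<^sup>2 + \<beta>\<^sup>2)"
proof -
  \<comment> \<open>\<open>r\<close> is the length of the segment, \<open>a\<close> its component
    along \<open>(1, m)\<close> and \<open>b\<close> the absolute value of its normal
    component.\<close>
  define r q a b where "r = sqrt (\<alpha>\<^sup>2 + \<beta>\<^sup>2)" and "q = sqrt (1 + m\<^sup>2)"
    and "a = (\<alpha> + m * \<beta>) / q" and "b = \<bar>\<beta> - m * \<alpha>\<bar> / q"
  have "1 + m\<^sup>2 > 0" by (simp add: add_pos_nonneg)
  then have q: "q > 0" "q\<^sup>2 = 1 + m\<^sup>2" by (simp_all add: q_def)
  have r: "r \<ge> 0" "r\<^sup>2 = \<alpha>\<^sup>2 + \<beta>\<^sup>2" by (simp_all add: r_def)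
  have "(r * q)\<^sup>2 = (a * q)\<^sup>2 + (b * q)\<^sup>2"
    using q by (simp add: a_def b_def power_mult_distrib r) (simp add: power2_eq_square algebra_simps)
  then have pyth: "r\<^sup>2 = a\<^sup>2 + b\<^sup>2"
    using q(1) by (simp add: power_mult_distrib flip: distrib_right)
  then have "\<bar>a\<bar> \<le> r" using r(1) by (metis abs_le_square_iff abs_of_nonneg le_add_same_cancel1
      zero_le_power2)
  then have ar: "a \<le> r" "- r \<le> a" by auto
  then show "(\<alpha> + m * \<beta>) / sqrt (1 + m\<^sup>2) \<le> sqrt (\<alpha>\<^sup>2 + \<beta>\<^sup>2)" by (simp add: a_def r_def q_def)
  have "b\<^sup>2 \<le> (\<eta> * r + (r - a) / (2 * \<eta>))\<^sup>2"
  proof -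
    \<comment> \<open>The defect \<open>r - a\<close> controls only the square of \<open>b\<close>.
      The inequality of arithmetic and geometric means with weight \<open>\<eta>\<close> makes the
      bound linear in \<open>r\<close> and \<open>r - a\<close>, so that it can be summed.\<close>
    have "b\<^sup>2 = (r + a) * (r - a)" using pyth by algebra
    also have "\<dots> \<le> (2 * r) * (r - a)" using ar by (intro mult_right_mono) auto
    also have "\<dots> = 4 * (\<eta> * r) * ((r - a) / (2 * \<eta>))" using assms by (simp add: field_simps)
    also have "\<dots> \<le> (\<eta> * r + (r - a) / (2 * \<eta>))\<^sup>2"
      using sum_squares_bound[of "\<eta> * r" "(r - a) / (2 * \<eta>)"] unfolding power2_sum by linarith
    finally show ?thesis .
  qed
  moreover have "0 \<le> \<eta> * r + (r - a) / (2 * \<eta>)" using assms r ar by simp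
  ultimately have "b \<le> \<eta> * r + (r - a) / (2 * \<eta>)" by (rule power2_le_imp_le)
  then have "q * b \<le> q * (\<eta> * r + (r - a) / (2 * \<eta>))" using q(1) by (intro mult_left_mono) auto
  then show "\<bar>\<beta> - m * \<alpha>\<bar> \<le> sqrt (1 + m\<^sup>2) * (\<eta> * sqrt (\<alpha>\<^sup>2 + \<beta>\<^sup>2)
           + (sqrt (\<alpha>\<^sup>2 + \<beta>\<^sup>2) - (\<alpha> + m * \<beta>) / sqrt (1 + m\<^sup>2)) / (2 * \<eta>))"
    using q(1) by (simp add: b_def a_def r_def q_def)
qed

definition clamp :: "real \<Rightarrow> real \<Rightarrow> real \<Rightarrow> real" where
  "clamp a b x = max a (min b x)"

lemma clamp_mono: "x \<le> y \<Longrightarrow> clamp a b x \<le> clamp a b y"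
  by (auto simp: clamp_def)

lemma clamp_bounds: "a \<le> b \<Longrightarrow> a \<le> clamp a b x \<and> clamp a b x \<le> b"
  by (auto simp: clamp_def)

lemma sum_clamp:
  fixes u :: "real \<Rightarrow> real" and p :: "nat \<Rightarrow> real"
  assumes "\<And>i. i < k \<Longrightarrow> p i \<le> p (Suc i)" "p 0 \<le> x"
  shows "(\<Sum>i<k. u (clamp (p i) (p (Suc i)) x) - u (p i)) = u (min x (p k)) - u (p 0)"
  using assms
proof (induction k)
  case (Suc k)
  have k: "p k \<le> p (Suc k)" using Suc.prems by simp
  have IH: "(\<Sum>i<k. u (clamp (p i) (p (Suc i)) x) - u (p i)) = u (min x (p k)) - u (p 0)"
    by (rule Suc.IH) (use Suc.prems in auto)
  show ?case
  proof (cases "x \<le> p k")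
    case True
    then have "clamp (p k) (p (Suc k)) x = p k" "min x (p k) = x" "min x (p (Suc k)) = x"
      using k by (auto simp: clamp_def)
    with IH show ?thesis by simp
  next
    case False
    then have "clamp (p k) (p (Suc k)) x = min x (p (Suc k))" "min x (p k) = p k"
      using k by (auto simp: clamp_def)
    with IH show ?thesis by simp
  qed
qed simp

text \<open>Clamping every point of \<open>y\<close> to every cell of \<open>p\<close> cuts
  \<open>y\<close> along \<open>p\<close> and stands in for a common refinement.\<close>

lemma partition_variation_clamp:
  fixes u :: "real \<Rightarrow> real"
  assumes p: "partition_seq a b k p" and y: "partition_seq a b n y"
  shows "(\<Sum>j<n. \<bar>u (y (Suc j)) - u (y j)\<bar>) \<le> (\<Sum>i<k. \<Sum>j<n.
    \<bar>u (clamp (p i) (p (Suc i)) (y (Suc j))) - u (clamp (p i) (p (Suc i)) (y j))\<bar>)"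
proof -
  let ?c = "\<lambda>i. clamp (p i) (p (Suc i))"
  have tel: "(\<Sum>i<k. u (?c i x) - u (p i)) = u x - u a" if "a \<le> x" "x \<le> b" for x
    using sum_clamp[of k p x u] p that by (auto simp: partition_seq_def min_def)
  have "(\<Sum>j<n. \<bar>u (y (Suc j)) - u (y j)\<bar>) \<le> (\<Sum>j<n. \<Sum>i<k. \<bar>u (?c i (y (Suc j))) - u (?c i (y j))\<bar>)"
  proof (intro sum_mono)
    fix j assume "j \<in> {..<n}"
    then have "u (y (Suc j)) - u (y j) = (\<Sum>i<k. u (?c i (y (Suc j))) - u (p i)) - (\<Sum>i<k. u (?c i (y
        j)) - u (p i))"
      using partition_seq_bounds[OF y] by (simp add: tel Suc_leI)
    also have "\<dots> = (\<Sum>i<k. u (?c i (y (Suc j))) - u (?c i (y j)))"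
      by (simp add: sum_subtractf[symmetric])
    finally show "\<bar>u (y (Suc j)) - u (y j)\<bar> \<le> (\<Sum>i<k. \<bar>u (?c i (y (Suc j))) - u (?c i (y j))\<bar>)"
      by (metis sum_abs)
  qed
  also have "\<dots> = (\<Sum>i<k. \<Sum>j<n. \<bar>u (?c i (y (Suc j))) - u (?c i (y j))\<bar>)" by (rule sum.swap)
  finally show ?thesis .
qed

text \<open>Weights with sum 0 make a combination of degree one functions periodic. The error is
  measured by its variation, which composition with lifts does not increase.\<close>

definition ramp_approximable :: "(real \<Rightarrow> real) \<Rightarrow> real \<Rightarrow> real \<Rightarrow> bool" where
  "ramp_approximable w V \<epsilon> \<longleftrightarrow> (\<exists>(A :: nat set) a b \<Delta>. finite A \<and> (\<forall>i\<in>A. a i < b i \<and> b i \<le> a i + 1) \<and>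
     (\<Sum>i\<in>A. \<Delta> i) = 0 \<and> (\<Sum>i\<in>A. \<bar>\<Delta> i\<bar>) \<le> V \<and>
     var_le (\<lambda>x. w x - (\<Sum>i\<in>A. \<Delta> i * ramp (a i) (b i) x)) \<epsilon>)"

text \<open>A partition is chosen whose inscribed polygon nearly attains the length of the graph of
  \<open>w\<close>. With \<open>\<Delta> i\<close> the increments over its cells, the combination of
  ramps is this polygon up to a constant. On cells of slope at most \<open>M\<close> the defect of
  length bounds the variation of \<open>w\<close> around its chord by
  \<open>slope_deviation\<close>. The steep cells have small total length, and there absolute
  continuity bounds both \<open>w\<close> and the chords.\<close>

lemma abs_continuous_ramp_approximable:
  assumes per: "periodic w" and ac: "abs_continuous_on_interval 0 1 w" and var: "var_le w V"
    and \<epsilon>: "\<epsilon> > 0"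
  shows "ramp_approximable w V \<epsilon>"
proof -
  have V: "V \<ge> 0" using var_le_nonneg[OF var] .
  obtain \<delta> where \<delta>: "\<delta> > 0" and AC:
    "\<And>(A :: (nat \<times> nat) set) s t. finite A \<Longrightarrow> (\<And>i. i \<in> A \<Longrightarrow> 0 \<le> s i \<and> s i \<le> t i \<and> t i \<le> 1) \<Longrightarrow>
        disjoint_family_on (\<lambda>i. {s i<..<t i}) A \<Longrightarrow> (\<Sum>i\<in>A. t i - s i) < \<delta> \<Longrightarrow>
        (\<Sum>i\<in>A. \<bar>w (t i) - w (s i)\<bar>) < \<epsilon> / 4"
    by (rule abs_continuous_finite[OF ac, of "\<epsilon> / 4", where 'i = "nat \<times> nat"]) (use \<epsilon> that in auto)
  \<comment> \<open>Steep cells have total length at most \<open>V / M\<close>, which is below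
    \<open>\<delta>\<close>. With \<open>\<eta>\<close> and \<open>\<epsilon>'\<close> as chosen
    next, the two terms of \<open>slope_deviation\<close>, summed over the other cells, are at most
    \<open>\<epsilon> / 8\<close> each.\<close>
  define M where "M = (V + 1) / \<delta>"
  define K where "K = sqrt (1 + M\<^sup>2)"
  have M: "M > 0" using V \<delta> by (simp add: M_def)
  have K: "K > 0" by (simp add: K_def add_pos_nonneg)
  define \<eta> where "\<eta> = \<epsilon> / (8 * K * (1 + V))"
  have \<eta>: "\<eta> > 0" using \<epsilon> K V by (simp add: \<eta>_def)
  define \<epsilon>' where "\<epsilon>' = \<eta> * \<epsilon> / (4 * K)"
  have \<epsilon>': "\<epsilon>' > 0" using \<epsilon> \<eta> K by (simp add: \<epsilon>'_def)
  define r where "r x y = sqrt ((y - x)\<^sup>2 + (w y - w x)\<^sup>2)" for x y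
  have len: "(\<Sum>i<n. r (x i) (x (Suc i))) \<le> 1 + V" if p: "partition_seq 0 1 n x" for n x
  proof -
    have "(\<Sum>i<n. r (x i) (x (Suc i))) \<le> (\<Sum>i<n. (x (Suc i) - x i) + \<bar>w (x (Suc i)) - w (x i)\<bar>)"
    proof (intro sum_mono)
      fix i assume "i \<in> {..<n}"
      then have "x i \<le> x (Suc i)" using p by (auto simp: partition_seq_def)
      then show "r (x i) (x (Suc i)) \<le> (x (Suc i) - x i) + \<bar>w (x (Suc i)) - w (x i)\<bar>"
        unfolding r_def using sqrt_sum_squares_le_sum_abs[of "x (Suc i) - x i"] by simp
    qed
    also have "\<dots> = x n - x 0 + (\<Sum>i<n. \<bar>w (x (Suc i)) - w (x i)\<bar>)"
      by (simp add: sum.distrib sum_lessThan_telescope)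
    also have "\<dots> \<le> 1 + V" using p var_leD[OF var, of 0 n x] by (simp add: partition_seq_def)
    finally show ?thesis .
  qed
  obtain \<Phi> where \<Phi>: "\<And>x y. 0 \<le> x \<Longrightarrow> x \<le> y \<Longrightarrow> y \<le> 1 \<Longrightarrow> r x y \<le> \<Phi> y - \<Phi> x"
    and \<Phi>0: "\<Phi> 0 \<ge> 0" and \<Phi>1: "\<Phi> 1 \<le> 1 + V"
    and P: "\<And>\<epsilon>. \<epsilon> > 0 \<Longrightarrow> \<exists>n x. partition_seq 0 1 n x \<and> \<Phi> 1 - \<epsilon> < (\<Sum>i<n. r (x i) (x (Suc i)))"
    by (rule monotone_majorant[of 0 1 r "1 + V"]) (use len in \<open>auto simp: r_def\<close>)
  from P[OF \<epsilon>'] obtain k p where p: "partition_seq 0 1 k p"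
    and pl: "\<Phi> 1 - \<epsilon>' < (\<Sum>i<k. r (p i) (p (Suc i)))" by blast
  have p01: "p 0 = 0" "p k = 1" and ple: "\<And>i. i < k \<Longrightarrow> p i \<le> p (Suc i)"
    using p by (auto simp: partition_seq_def)
  have pb: "0 \<le> p i" "p i \<le> 1" if "i \<le> k" for i using partition_seq_bounds[OF p that] by auto
  define A where "A = {i. i < k \<and> p i < p (Suc i)}"
  have finA: "finite A" by (simp add: A_def)
  define \<Delta> where "\<Delta> i = w (p (Suc i)) - w (p i)" for i
  define m where "m i = \<Delta> i / (p (Suc i) - p i)" for i
  have \<Delta>0: "\<Delta> i = 0" if "i < k" "i \<notin> A" for i using that ple[of i] by (auto simp: A_def \<Delta>_def)
  have sumA: "(\<Sum>i\<in>A. \<Delta> i) = 0"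
  proof -
    have "(\<Sum>i\<in>A. \<Delta> i) = (\<Sum>i<k. \<Delta> i)" by (rule sum.mono_neutral_left) (auto simp: A_def \<Delta>0)
    also have "\<dots> = w (p k) - w (p 0)" unfolding \<Delta>_def by (rule sum_lessThan_telescope)
    also have "\<dots> = 0" using per[unfolded periodic_def, rule_format, of 0] by (simp add: p01)
    finally show ?thesis .
  qed
  have absA: "(\<Sum>i\<in>A. \<bar>\<Delta> i\<bar>) \<le> V"
  proof -
    have "(\<Sum>i\<in>A. \<bar>\<Delta> i\<bar>) \<le> (\<Sum>i<k. \<bar>\<Delta> i\<bar>)" by (rule sum_mono2) (auto simp: A_def)
    also have "\<dots> \<le> V" unfolding \<Delta>_def using var_leD[OF var, of 0 k p] p by simp
    finally show ?thesis .
  qed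
  define d where "d x = w x - (\<Sum>i\<in>A. \<Delta> i * ramp (p i) (p (Suc i)) x)" for x
  \<comment> \<open>Inside a cell every ramp except its own is constant.\<close>
  have cell: "d t - d s = w t - w s - m i * (t - s)"
    if i: "i \<in> A" and st: "p i \<le> s" "s \<le> t" "t \<le> p (Suc i)" for i s t
  proof -
    have ik: "i < k" using i by (simp add: A_def)
    have other: "ramp (p l) (p (Suc l)) t = ramp (p l) (p (Suc l)) s" if l: "l \<in> A - {i}" for l
    proof -
      have lk: "l < k" "p l < p (Suc l)" using l by (auto simp: A_def)
      consider "l < i" | "i < l" using l by force
      then show ?thesis
      proof cases
        case 1
        then have "p (Suc l) \<le> p i" using partition_seq_mono[OF p] ik by simp
        moreover have "t \<le> p l + 1" "s \<le> p l + 1" using st pb[of l] pb[of "Suc i"] ik lk by auto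
        ultimately show ?thesis using st lk pb[of "Suc l"] pb[of l]
          by (subst (1 2) ramp_flat) auto
      next
        case 2
        then have "p (Suc i) \<le> p l" using partition_seq_mono[OF p] lk by simp
        moreover have "p (Suc l) \<le> t + 1" "p (Suc l) \<le> s + 1" using st pb[of "Suc l"] pb[of i] ik lk
            by auto
        ultimately show ?thesis using st lk by (subst (1 2) ramp_zero) auto
      qed
    qed
    have own: "\<Delta> i * ramp (p i) (p (Suc i)) x = m i * (x - p i)" if "p i \<le> x" "x \<le> p (Suc i)" for x
      using ramp_affine[of "p i" "p (Suc i)" x] that i pb[of "Suc i"] pb[of i] ik
      by (auto simp: A_def m_def)
    have "(\<Sum>i\<in>A. \<Delta> i * ramp (p i) (p (Suc i)) t) - (\<Sum>i\<in>A. \<Delta> i * ramp (p i) (p (Suc i)) s)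
       = \<Delta> i * ramp (p i) (p (Suc i)) t - \<Delta> i * ramp (p i) (p (Suc i)) s"
      unfolding sum.remove[OF finA i] using other by simp
    also have "\<dots> = m i * (t - s)" using own[of t] own[of s] st by (simp add: algebra_simps)
    finally show ?thesis by (simp add: d_def)
  qed
  have main: "(\<Sum>j<n. \<bar>d (y (Suc j)) - d (y j)\<bar>) \<le> \<epsilon>" if y: "partition_seq 0 1 n y" for n y
  proof -
    define c where "c i j = clamp (p i) (p (Suc i)) (y j)" for i j
    have cmono: "c i j \<le> c i j'" if "j \<le> j'" "j' \<le> n" for i j j'
      unfolding c_def using partition_seq_mono[OF y that] by (rule clamp_mono)
    have cb: "p i \<le> c i j" "c i j \<le> p (Suc i)" if "i < k" for i j
      using clamp_bounds[OF ple[OF that]] by (auto simp: c_def)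
    have c0: "c i 0 = p i" "c i n = p (Suc i)" if "i < k" for i
      using pb[of i] pb[of "Suc i"] ple[of i] that y by (auto simp: c_def clamp_def partition_seq_def)
    define \<alpha> \<beta> where "\<alpha> i j = c i (Suc j) - c i j" and "\<beta> i j = w (c i (Suc j)) - w (c i j)" for i j
    define R q where "R i j = r (c i j) (c i (Suc j))" and "q i j = (\<alpha> i j + m i * \<beta> i j) / sqrt (1
        + (m i)\<^sup>2)" for i j
    have sum\<alpha>: "(\<Sum>j<n. \<alpha> i j) = p (Suc i) - p i" if "i < k" for i
      unfolding \<alpha>_def sum_lessThan_telescope using c0[OF that] by simp
    have sum\<beta>: "(\<Sum>j<n. \<beta> i j) = \<Delta> i" if "i < k" for i
      unfolding \<beta>_def sum_lessThan_telescope[of "\<lambda>j. w (c i j)"] using c0[OF that] by (simp add: \<Delta>_def)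
    define G where "G = {i \<in> A. \<bar>m i\<bar> \<le> M}"
    define B where "B = {i \<in> A. \<not> \<bar>m i\<bar> \<le> M}"
    have AGB: "A = G \<union> B" "G \<inter> B = {}" and fin: "finite G" "finite B" using finA by (auto simp:
        G_def B_def)
    have Ak: "i < k" if "i \<in> A" for i using that by (simp add: A_def)
    have sumR: "(\<Sum>j<n. R i j) \<le> \<Phi> (p (Suc i)) - \<Phi> (p i)" if i: "i < k" for i
    proof -
      have "(\<Sum>j<n. R i j) \<le> (\<Sum>j<n. \<Phi> (c i (Suc j)) - \<Phi> (c i j))"
      proof (intro sum_mono)
        fix j assume "j \<in> {..<n}"
        then show "R i j \<le> \<Phi> (c i (Suc j)) - \<Phi> (c i j)"
          unfolding R_def using cmono[of j "Suc j" i] cb[OF i, of j] cb[OF i, of "Suc j"] pb[of i]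
              pb[of "Suc i"] i
          by (intro \<Phi>) auto
      qed
      also have "\<dots> = \<Phi> (p (Suc i)) - \<Phi> (p i)"
        unfolding sum_lessThan_telescope[of "\<lambda>j. \<Phi> (c i j)"] using c0[OF i] by simp
      finally show ?thesis .
    qed
    have Rn: "R i j \<ge> 0" for i j by (simp add: R_def r_def)
    \<comment> \<open>Projections to the direction of the chord telescope to the length of the
      chord, so the defects of the pieces add up to at most the defect of the cell.\<close>
    have sumq: "(\<Sum>j<n. q i j) = r (p i) (p (Suc i))" if "i \<in> A" for i
    proof -
      define l where "l = p (Suc i) - p i"
      have l: "l > 0" using that by (simp add: A_def l_def)
      have "(\<Sum>j<n. q i j) = (l + m i * \<Delta> i) / sqrt (1 + (m i)\<^sup>2)"
        unfolding q_def sum_divide_distrib[symmetric] sum.distrib sum_distrib_left[symmetric]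
        using sum\<alpha> sum\<beta> Ak[OF that] by (simp add: l_def)
      also have "\<Delta> i = m i * l" using l by (simp add: m_def l_def)
      also have "l + m i * (m i * l) = l * (1 + (m i)\<^sup>2)" by algebra
      also have "l * (1 + (m i)\<^sup>2) / sqrt (1 + (m i)\<^sup>2) = l * sqrt (1 + (m i)\<^sup>2)"
        by (metis times_divide_eq_right real_div_sqrt add_nonneg_nonneg zero_le_one zero_le_power2)
      also have "\<dots> = sqrt (l\<^sup>2 * (1 + (m i)\<^sup>2))" using l by (simp add: real_sqrt_mult)
      also have "l\<^sup>2 * (1 + (m i)\<^sup>2) = l\<^sup>2 + (m i * l)\<^sup>2" by algebra
      also have "m i * l = \<Delta> i" using l by (simp add: m_def l_def)
      finally show ?thesis by (simp add: r_def l_def \<Delta>_def)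
    qed
    have good: "(\<Sum>i\<in>G. \<Sum>j<n. \<bar>\<beta> i j - m i * \<alpha> i j\<bar>) \<le> \<epsilon> / 4"
    proof -
      have "(\<Sum>i\<in>G. \<Sum>j<n. \<bar>\<beta> i j - m i * \<alpha> i j\<bar>) \<le> (\<Sum>i\<in>G. \<Sum>j<n. K * (\<eta> * R i j + (R i j - q i j) / (2
          * \<eta>)))"
      proof (intro sum_mono)
        fix i j assume i: "i \<in> G"
        have mK: "sqrt (1 + (m i)\<^sup>2) \<le> K"
          unfolding K_def using i M by (auto simp: G_def intro!: real_sqrt_le_mono
              power2_le_iff_abs_le[THEN iffD2])
        have "\<bar>\<beta> i j - m i * \<alpha> i j\<bar> \<le> sqrt (1 + (m i)\<^sup>2) * (\<eta> * R i j + (R i j - q i j) / (2 * \<eta>))"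
          using slope_deviation(1)[OF \<eta>, of "\<beta> i j" "m i" "\<alpha> i j"] by (simp add: R_def r_def q_def
              \<alpha>_def \<beta>_def)
        also have "\<dots> \<le> K * (\<eta> * R i j + (R i j - q i j) / (2 * \<eta>))"
        proof (intro mult_right_mono mK)
          have "q i j \<le> R i j"
            using slope_deviation(2)[OF \<eta>, of "\<alpha> i j" "m i" "\<beta> i j"] by (simp add: R_def r_def q_def
                \<alpha>_def \<beta>_def)
          then show "0 \<le> \<eta> * R i j + (R i j - q i j) / (2 * \<eta>)" using \<eta> Rn by simp
        qed
        finally show "\<bar>\<beta> i j - m i * \<alpha> i j\<bar> \<le> K * (\<eta> * R i j + (R i j - q i j) / (2 * \<eta>))" .
      qed
      also have "\<dots> = (\<Sum>i\<in>G. K * (\<eta> * (\<Sum>j<n. R i j) + ((\<Sum>j<n. R i j) - (\<Sum>j<n. q i j)) / (2 * \<eta>)))"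
        by (simp only: sum_distrib_left[symmetric] sum.distrib sum_divide_distrib[symmetric]
            sum_subtractf)
      also have "\<dots> \<le> (\<Sum>i\<in>G. K * (\<eta> * (\<Phi> (p (Suc i)) - \<Phi> (p i)) +
           (\<Phi> (p (Suc i)) - \<Phi> (p i) - r (p i) (p (Suc i))) / (2 * \<eta>)))"
        using sumR sumq Ak K \<eta> AGB(1)
        by (intro sum_mono mult_left_mono add_mono divide_right_mono) auto
      \<comment> \<open>The terms are nonnegative. Extending the sum to all cells lets
        \<open>\<Phi>\<close> telescope and brings in the choice of \<open>p\<close>.\<close>
      also have "\<dots> \<le> (\<Sum>i<k. K * (\<eta> * (\<Phi> (p (Suc i)) - \<Phi> (p i)) +
           (\<Phi> (p (Suc i)) - \<Phi> (p i) - r (p i) (p (Suc i))) / (2 * \<eta>)))"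
      proof (rule sum_mono2)
        fix i assume "i \<in> {..<k} - G"
        then have i: "i < k" by simp
        have "r (p i) (p (Suc i)) \<le> \<Phi> (p (Suc i)) - \<Phi> (p i)"
          using pb[of i] pb[of "Suc i"] ple[OF i] i by (intro \<Phi>) auto
        moreover have "0 \<le> r (p i) (p (Suc i))" by (simp add: r_def)
        ultimately show "0 \<le> K * (\<eta> * (\<Phi> (p (Suc i)) - \<Phi> (p i)) +
           (\<Phi> (p (Suc i)) - \<Phi> (p i) - r (p i) (p (Suc i))) / (2 * \<eta>))"
          using K \<eta> by (intro mult_nonneg_nonneg add_nonneg_nonneg divide_nonneg_nonneg) auto
      qed (auto simp: G_def A_def)
      also have "\<dots> = K * (\<eta> * (\<Sum>i<k. \<Phi> (p (Suc i)) - \<Phi> (p i)) +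
           ((\<Sum>i<k. \<Phi> (p (Suc i)) - \<Phi> (p i)) - (\<Sum>i<k. r (p i) (p (Suc i)))) / (2 * \<eta>))"
        by (simp only: sum_distrib_left[symmetric] sum.distrib sum_divide_distrib[symmetric]
            sum_subtractf)
      also have "(\<Sum>i<k. \<Phi> (p (Suc i)) - \<Phi> (p i)) = \<Phi> 1 - \<Phi> 0"
        unfolding sum_lessThan_telescope[of "\<lambda>i. \<Phi> (p i)"] by (simp add: p01)
      also have "K * (\<eta> * (\<Phi> 1 - \<Phi> 0) + (\<Phi> 1 - \<Phi> 0 - (\<Sum>i<k. r (p i) (p (Suc i)))) / (2 * \<eta>))
          \<le> K * (\<eta> * (1 + V) + \<epsilon>' / (2 * \<eta>))"
        using K \<eta> \<Phi>0 \<Phi>1 pl by (intro mult_left_mono add_mono divide_right_mono) auto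
      also have "\<dots> = \<epsilon> / 4"
      proof -
        have "1 + V \<noteq> 0" using V by linarith
        then have "K * (\<eta> * (1 + V)) = \<epsilon> / 8" unfolding \<eta>_def using K by simp
        moreover have "K * (\<epsilon>' / (2 * \<eta>)) = \<epsilon> / 8" unfolding \<epsilon>'_def using K \<eta> by (simp add: field_simps)
        ultimately show ?thesis by (simp add: distrib_left)
      qed
      finally show ?thesis .
    qed
    have lenB: "(\<Sum>i\<in>B. p (Suc i) - p i) < \<delta>"
    proof -
      have "(\<Sum>i\<in>B. p (Suc i) - p i) \<le> (\<Sum>i\<in>B. \<bar>\<Delta> i\<bar> / M)"
      proof (intro sum_mono)
        fix i assume i: "i \<in> B"
        then have l: "p (Suc i) - p i > 0" and "\<bar>m i\<bar> > M" by (auto simp: B_def A_def)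
        then have "M * (p (Suc i) - p i) \<le> \<bar>m i\<bar> * (p (Suc i) - p i)" by (intro mult_right_mono) auto
        also have "\<dots> = \<bar>\<Delta> i\<bar>" using l by (simp add: m_def abs_divide)
        finally show "p (Suc i) - p i \<le> \<bar>\<Delta> i\<bar> / M" using M by (simp add: field_simps)
      qed
      also have "\<dots> = (\<Sum>i\<in>B. \<bar>\<Delta> i\<bar>) / M" by (simp add: sum_divide_distrib)
      also have "\<dots> \<le> V / M"
      proof -
        have "(\<Sum>i\<in>B. \<bar>\<Delta> i\<bar>) \<le> (\<Sum>i\<in>A. \<bar>\<Delta> i\<bar>)" by (rule sum_mono2) (use finA AGB in auto)
        then show ?thesis using absA M by (intro divide_right_mono) auto
      qed
      also have "\<dots> < \<delta>" unfolding M_def using V \<delta> by (simp add: field_simps)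
      finally show ?thesis .
    qed
    \<comment> \<open>The clamped pieces of the steep cells are together as long as these cells, so
      the choice of \<open>\<delta>\<close> bounds the variation of \<open>w\<close> on them.
      \<open>bad2\<close> applies the same choice to the cells themselves and bounds the
      chords.\<close>
    have bad1: "(\<Sum>i\<in>B. \<Sum>j<n. \<bar>\<beta> i j\<bar>) < \<epsilon> / 4"
    proof -
      have "(\<Sum>(i, j)\<in>B \<times> {..<n}. \<bar>w (c i (Suc j)) - w (c i j)\<bar>) < \<epsilon> / 4"
        unfolding split_def
      proof (rule AC)
        show "finite (B \<times> {..<n})" using fin by simp
        fix ij assume ij: "ij \<in> B \<times> {..<n}"
        then have ik: "fst ij < k" "snd ij < n" using Ak AGB by auto
        then show "0 \<le> c (fst ij) (snd ij) \<and> c (fst ij) (snd ij) \<le> c (fst ij) (Suc (snd ij)) \<and> c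
            (fst ij) (Suc (snd ij)) \<le> 1"
          using cb[of "fst ij" "snd ij"] cb[of "fst ij" "Suc (snd ij)"] pb[of "fst ij"] pb[of "Suc
              (fst ij)"]
            cmono[of "snd ij" "Suc (snd ij)"] by force
      next
        have sep: "c i (Suc j) \<le> c i' j'" if "i < k" "i' < k" "j < n" "j' < n" "i < i' \<or> i = i' \<and> j
            < j'" for i j i' j'
        proof (cases "i < i'")
          case True
          then have "p (Suc i) \<le> p i'" using partition_seq_mono[OF p, of "Suc i" i'] that by simp
          then show ?thesis using cb[of i "Suc j"] cb[of i' j'] that by simp
        next
          case False
          then show ?thesis using that cmono[of "Suc j" j' i] by simp
        qed
        show "disjoint_family_on (\<lambda>i. {c (fst i) (snd i)<..<c (fst i) (Suc (snd i))}) (B \<times> {..<n})"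
          unfolding disjoint_family_on_def
        proof (intro ballI impI)
          fix x y assume xy: "x \<in> B \<times> {..<n}" "y \<in> B \<times> {..<n}" "x \<noteq> y"
          obtain i j i' j' where e: "x = (i, j)" "y = (i', j')" by (cases x, cases y) auto
          have k: "i < k" "i' < k" "j < n" "j' < n" using xy Ak AGB e by auto
          consider "i < i' \<or> i = i' \<and> j < j'" | "i' < i \<or> i' = i \<and> j' < j" using xy(3) e by fastforce
          then show "{c (fst x) (snd x)<..<c (fst x) (Suc (snd x))} \<inter> {c (fst y) (snd y)<..<c (fst
              y) (Suc (snd y))} = {}"
          proof cases
            case 1
            from sep[OF k this] show ?thesis by (auto simp: e)
          next
            case 2
            from sep[OF k(2,1) k(4,3) this] show ?thesis by (auto simp: e)
          qed
        qed
        have "(\<Sum>i\<in>B \<times> {..<n}. c (fst i) (Suc (snd i)) - c (fst i) (snd i)) = (\<Sum>i\<in>B. \<Sum>j<n. \<alpha> i j)"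
          by (simp add: sum.cartesian_product split_def \<alpha>_def)
        also have "\<dots> = (\<Sum>i\<in>B. p (Suc i) - p i)" using sum\<alpha> Ak AGB by (intro sum.cong) auto
        finally show "(\<Sum>i\<in>B \<times> {..<n}. c (fst i) (Suc (snd i)) - c (fst i) (snd i)) < \<delta>" using lenB
            by simp
      qed
      then show ?thesis by (simp add: sum.cartesian_product split_def \<beta>_def)
    qed
    have bad2: "(\<Sum>i\<in>B. \<bar>\<Delta> i\<bar>) < \<epsilon> / 4"
    proof -
      have "(\<Sum>ij\<in>B \<times> {0::nat}. \<bar>w (p (Suc (fst ij))) - w (p (fst ij))\<bar>) < \<epsilon> / 4"
      proof (rule AC)
        show "finite (B \<times> {0::nat})" using fin by simp
        fix ij assume "ij \<in> B \<times> {0::nat}"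
        then have "fst ij < k" using Ak AGB by auto
        then show "0 \<le> p (fst ij) \<and> p (fst ij) \<le> p (Suc (fst ij)) \<and> p (Suc (fst ij)) \<le> 1"
          using pb[of "fst ij"] pb[of "Suc (fst ij)"] ple by auto
      next
        show "disjoint_family_on (\<lambda>i. {p (fst i)<..<p (Suc (fst i))}) (B \<times> {0::nat})"
          unfolding disjoint_family_on_def
        proof (intro ballI impI)
          fix x y assume xy: "x \<in> B \<times> {0::nat}" "y \<in> B \<times> {0::nat}" "x \<noteq> y"
          then have k: "fst x < k" "fst y < k" and "fst x < fst y \<or> fst y < fst x" using Ak AGB by auto
          then consider "p (Suc (fst x)) \<le> p (fst y)" | "p (Suc (fst y)) \<le> p (fst x)"
            using partition_seq_mono[OF p, of "Suc (fst x)" "fst y"] partition_seq_mono[OF p, of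
                "Suc (fst y)" "fst x"] by auto
          then show "{p (fst x)<..<p (Suc (fst x))} \<inter> {p (fst y)<..<p (Suc (fst y))} = {}"
            by cases auto
        qed
        show "(\<Sum>ij\<in>B \<times> {0::nat}. p (Suc (fst ij)) - p (fst ij)) < \<delta>"
          using lenB sum.cartesian_product[of "\<lambda>i j. p (Suc i) - p i" "{0::nat}" B] by (simp add:
              split_def)
      qed
      then show ?thesis
        using sum.cartesian_product[of "\<lambda>i j. \<bar>\<Delta> i\<bar>" "{0::nat}" B] by (simp add: split_def \<Delta>_def)
    qed
    have bad: "(\<Sum>i\<in>B. \<Sum>j<n. \<bar>\<beta> i j - m i * \<alpha> i j\<bar>) \<le> (\<Sum>i\<in>B. \<Sum>j<n. \<bar>\<beta> i j\<bar>) + (\<Sum>i\<in>B. \<bar>\<Delta> i\<bar>)"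
      unfolding sum.distrib[symmetric]
    proof (intro sum_mono)
      fix i assume "i \<in> B"
      then have i: "i < k" "p i < p (Suc i)" using AGB by (auto simp: A_def)
      have "(\<Sum>j<n. \<bar>\<beta> i j - m i * \<alpha> i j\<bar>) \<le> (\<Sum>j<n. \<bar>\<beta> i j\<bar> + \<bar>m i\<bar> * \<alpha> i j)"
      proof (intro sum_mono)
        fix j assume "j \<in> {..<n}"
        then have "\<alpha> i j \<ge> 0" using cmono[of j "Suc j" i] by (simp add: \<alpha>_def)
        then show "\<bar>\<beta> i j - m i * \<alpha> i j\<bar> \<le> \<bar>\<beta> i j\<bar> + \<bar>m i\<bar> * \<alpha> i j"
          using abs_triangle_ineq4[of "\<beta> i j" "m i * \<alpha> i j"] by (simp add: abs_mult)
      qed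
      also have "\<dots> = (\<Sum>j<n. \<bar>\<beta> i j\<bar>) + \<bar>m i\<bar> * (p (Suc i) - p i)"
        unfolding sum.distrib sum_distrib_left[symmetric] sum\<alpha>[OF i(1)] by simp
      also have "\<bar>m i\<bar> * (p (Suc i) - p i) = \<bar>\<Delta> i\<bar>" using i by (simp add: m_def abs_divide)
      finally show "(\<Sum>j<n. \<bar>\<beta> i j - m i * \<alpha> i j\<bar>) \<le> (\<Sum>j<n. \<bar>\<beta> i j\<bar>) + \<bar>\<Delta> i\<bar>" .
    qed
    have "(\<Sum>j<n. \<bar>d (y (Suc j)) - d (y j)\<bar>) \<le> (\<Sum>i<k. \<Sum>j<n. \<bar>d (c i (Suc j)) - d (c i j)\<bar>)"
      unfolding c_def by (rule partition_variation_clamp[OF p y])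
    also have "\<dots> = (\<Sum>i\<in>A. \<Sum>j<n. \<bar>d (c i (Suc j)) - d (c i j)\<bar>)"
    proof (rule sum.mono_neutral_right)
      show "\<forall>i\<in>{..<k} - A. (\<Sum>j<n. \<bar>d (c i (Suc j)) - d (c i j)\<bar>) = 0"
      proof
        fix i assume "i \<in> {..<k} - A"
        then have "i < k" "p (Suc i) = p i" using ple[of i] by (auto simp: A_def)
        then have "c i j = p i" for j using cb[of i j] by simp
        then show "(\<Sum>j<n. \<bar>d (c i (Suc j)) - d (c i j)\<bar>) = 0" by simp
      qed
    qed (auto simp: A_def)
    also have "\<dots> = (\<Sum>i\<in>A. \<Sum>j<n. \<bar>\<beta> i j - m i * \<alpha> i j\<bar>)"
    proof (intro sum.cong refl)
      fix i j assume "i \<in> A" "j \<in> {..<n}"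
      then show "\<bar>d (c i (Suc j)) - d (c i j)\<bar> = \<bar>\<beta> i j - m i * \<alpha> i j\<bar>"
        using cell[of i "c i j" "c i (Suc j)"] cb[of i] cmono[of j "Suc j" i] Ak
        by (simp add: \<alpha>_def \<beta>_def)
    qed
    also have "\<dots> = (\<Sum>i\<in>G. \<Sum>j<n. \<bar>\<beta> i j - m i * \<alpha> i j\<bar>) + (\<Sum>i\<in>B. \<Sum>j<n. \<bar>\<beta> i j - m i * \<alpha> i j\<bar>)"
      unfolding AGB(1) by (rule sum.union_disjoint) (use fin AGB in auto)
    also have "\<dots> \<le> \<epsilon>" using good bad bad1 bad2 \<epsilon> by linarith
    finally show ?thesis .
  qed
  have "periodic d"
    unfolding periodic_def
  proof
    fix x
    have "(\<Sum>i\<in>A. \<Delta> i * ramp (p i) (p (Suc i)) (x + 1)) = (\<Sum>i\<in>A. \<Delta> i * ramp (p i) (p (Suc i)) x) +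
        (\<Sum>i\<in>A. \<Delta> i)"
      using ramp_degree_one by (simp add: degree_one_def distrib_left sum.distrib)
    then show "d (x + 1) = d x" using per by (simp add: d_def periodic_def sumA)
  qed
  then have "var_le d \<epsilon>" using main by (rule var_le_periodicI)
  moreover have "p i < p (Suc i) \<and> p (Suc i) \<le> p i + 1" if "i \<in> A" for i
    using that pb[of i] pb[of "Suc i"] by (auto simp: A_def)
  ultimately show ?thesis
    unfolding ramp_approximable_def d_def using finA sumA absA
    by (intro exI[of _ A] exI[of _ p] exI[of _ "\<lambda>i. p (Suc i)"] exI[of _ \<Delta>] conjI ballI) simp_all
qed

section \<open>Lifts of circle homeomorphisms and Denjoy intervals\<close>

definition circle_lift :: "(real \<Rightarrow> real) \<Rightarrow> bool" where
  "circle_lift F \<longleftrightarrow> strict_mono F \<and> continuous_on UNIV F \<and> degree_one F"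

text \<open>A bounded deviation at every time replaces the limit of \<open>F^n x / n\<close>, which
  it implies (\<open>translation_number_limit\<close>). The constant 1 is the same for all maps,
  which matters for a varying family of conjugates.\<close>

definition translation_number :: "(real \<Rightarrow> real) \<Rightarrow> real \<Rightarrow> bool" where
  "translation_number F \<rho> \<longleftrightarrow> (\<forall>n x. \<bar>(F ^^ n) x - x - real n * \<rho>\<bar> \<le> 1)"

lemma circle_lift_mono: "circle_lift F \<Longrightarrow> mono F"
  by (simp add: circle_lift_def strict_mono_mono)

lemma circle_lift_id: "circle_lift (\<lambda>x. x)"
  by (simp add: circle_lift_def strict_mono_def degree_one_def)

lemma circle_lift_comp: "circle_lift F \<Longrightarrow> circle_lift G \<Longrightarrow> circle_lift (\<lambda>x. F (G x))"
  by (auto simp: circle_lift_def strict_mono_def degree_one_def intro: continuous_on_compose2)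

lemma circle_lift_add_const: "circle_lift F \<Longrightarrow> circle_lift (\<lambda>x. F x + c)"
  by (auto simp: circle_lift_def strict_mono_def degree_one_def intro!: continuous_intros)

lemma circle_lift_funpow: "circle_lift F \<Longrightarrow> circle_lift (F ^^ n)"
  by (induction n) (auto simp: id_def circle_lift_id o_def intro: circle_lift_comp)

lemma circle_lift_bij:
  assumes "circle_lift F" shows "bij F"
proof (rule bijI)
  show "inj F" using assms by (simp add: circle_lift_def strict_mono_imp_inj_on)
  show "surj F"
    unfolding surj_def
  proof
    fix y
    have d: "degree_one F" using assms by (simp add: circle_lift_def)
    define k where "k = \<lfloor>y - F 0\<rfloor>"
    have "F (of_int k) \<le> y" "y \<le> F (of_int k + 1)"
      using degree_one_int[OF d, of 0 k] degree_one_int[OF d, of 0 "k + 1"] by (simp_all add: k_def)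
          linarith+
    moreover have "continuous_on {of_int k..of_int k + 1} F"
      using assms by (auto simp: circle_lift_def intro: continuous_on_subset)
    ultimately obtain x where "F x = y" using IVT'[of F "of_int k" y "of_int k + 1"] by auto
    then show "\<exists>x. y = F x" by blast
  qed
qed

lemma circle_lift_inv:
  assumes F: "circle_lift F" shows "circle_lift (inv F)"
proof -
  have b: "bij F" by (rule circle_lift_bij[OF F])
  then have F': "F (inv F x) = x" and F'': "inv F (F x) = x" for x
    by (simp_all add: bij_is_surj surj_f_inv_f bij_is_inj)
  have sm: "strict_mono (inv F)"
    using F unfolding circle_lift_def by (metis F' strict_mono_def strict_mono_less)
  have "degree_one (inv F)"
    using F unfolding circle_lift_def degree_one_def by (metis F' F'')
  moreover have "continuous_on UNIV (inv F)"
  proof -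
    have "isCont (inv F) (F x)" for x
    proof (rule isCont_inverse_function[where d = 1 and f = F and x = x])
      show "isCont F z" for z using F by (simp add: circle_lift_def continuous_on_eq_continuous_at)
    qed (use F'' in auto)
    then show ?thesis using F' by (metis continuous_at_imp_continuous_on)
  qed
  ultimately show ?thesis using sm by (simp add: circle_lift_def)
qed

section \<open>Existence and conjugacy invariance of the translation number\<close>

lemma displacement_osc:
  assumes "mono F" "degree_one F"
  shows "\<bar>(F x - x) - (F y - y)\<bar> \<le> 1"
proof -
  have p: "periodic (\<lambda>x. F x - x)" using assms(2) by (simp add: periodic_def degree_one_def)
  obtain z where z: "x \<le> z" "z < x + 1" "F z - z = F y - y"
    using periodic_reduce[OF p, of x y] by metis
  have "F x \<le> F z" "F z \<le> F (x + 1)" using assms(1) z by (auto simp: mono_def)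
  then show ?thesis using z assms(2) by (auto simp: degree_one_def abs_le_iff)
qed

lemma displacement_iterate:
  assumes "mono F" "degree_one F"
  shows "\<bar>(F ^^ m) x - x - real m * (F y - y)\<bar> \<le> real m"
proof (induction m)
  case (Suc m)
  have "\<bar>(F ((F ^^ m) x) - (F ^^ m) x) - (F y - y)\<bar> \<le> 1" by (rule displacement_osc[OF assms])
  then show ?case using Suc by (simp add: algebra_simps abs_le_iff)
qed simp

text \<open>\<open>F^(n m)\<close> is estimated both as an m-fold iterate of \<open>F^n\<close> and
  as an n-fold iterate of \<open>F^m\<close>, so the mean displacements at times n and m differ by
  at most \<open>1 / n + 1 / m\<close>. Letting m tend to infinity leaves the deviation 1 of the
  definition.\<close>

lemma translation_number_exists:
  assumes F: "mono F" "degree_one F"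
  shows "\<exists>\<rho>. translation_number F \<rho>"
proof -
  define b where "b n y = ((F ^^ n) y - y) / real n" for n y
  have mono_n: "mono (F ^^ n)" for n using F(1) by (induction n) (auto simp: mono_def)
  have deg_n: "degree_one (F ^^ n)" for n using F(2) by (rule degree_one_funpow)
  have cmp: "\<bar>b n y - b m z\<bar> \<le> 1 / real n + 1 / real m" if "n > 0" "m > 0" for m n y z
  proof -
    have "\<bar>(F ^^ (n * m)) 0 - 0 - real m * ((F ^^ n) y - y)\<bar> \<le> real m"
      using displacement_iterate[OF mono_n[of n] deg_n[of n], of m 0 y] by (simp only: funpow_mult)
    moreover have "\<bar>(F ^^ (n * m)) 0 - 0 - real n * ((F ^^ m) z - z)\<bar> \<le> real n"
      using displacement_iterate[OF mono_n[of m] deg_n[of m], of n 0 z]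
      by (simp only: funpow_mult mult.commute[of n m])
    ultimately have "\<bar>real m * ((F ^^ n) y - y) - real n * ((F ^^ m) z - z)\<bar> \<le> real m + real n" by
        linarith
    then have "\<bar>real m * ((F ^^ n) y - y) - real n * ((F ^^ m) z - z)\<bar> / (real n * real m)
       \<le> (real m + real n) / (real n * real m)"
      by (intro divide_right_mono) auto
    also have "\<bar>real m * ((F ^^ n) y - y) - real n * ((F ^^ m) z - z)\<bar> / (real n * real m)
      = \<bar>(real m * ((F ^^ n) y - y) - real n * ((F ^^ m) z - z)) / (real n * real m)\<bar>"
      using that by (simp add: abs_divide)
    also have "(real m * ((F ^^ n) y - y) - real n * ((F ^^ m) z - z)) / (real n * real m) = b n y -
        b m z"
      unfolding b_def using that by (simp add: field_simps)
    also have "(real m + real n) / (real n * real m) = 1 / real n + 1 / real m"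
      using that by (simp add: field_simps)
    finally show ?thesis .
  qed
  have inv0: "(\<lambda>n. 1 / real (Suc n)) \<longlonglongrightarrow> 0" by (rule LIMSEQ_Suc[OF lim_1_over_n])
  have "Cauchy (\<lambda>n. b (Suc n) 0)"
  proof (rule CauchyI)
    fix e :: real assume "e > 0"
    then obtain N where N: "\<And>n. n \<ge> N \<Longrightarrow> 1 / real (Suc n) < e / 2"
      using order_tendstoD(2)[OF inv0, of "e / 2"] by (auto simp: eventually_sequentially)
    show "\<exists>M. \<forall>m\<ge>M. \<forall>n\<ge>M. norm (b (Suc m) 0 - b (Suc n) 0) < e"
    proof (intro exI allI impI)
      fix m n assume "m \<ge> N" "n \<ge> N"
      then show "norm (b (Suc m) 0 - b (Suc n) 0) < e"
        using cmp[of "Suc m" "Suc n" 0 0] N[of m] N[of n] by (simp del: of_nat_Suc)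
    qed
  qed
  then obtain \<rho> where \<rho>: "(\<lambda>n. b (Suc n) 0) \<longlonglongrightarrow> \<rho>" by (auto simp: Cauchy_convergent_iff convergent_def)
  have "\<bar>(F ^^ n) x - x - real n * \<rho>\<bar> \<le> 1" for n x
  proof (cases "n = 0")
    case False
    have "(\<lambda>m. \<bar>b n x - b (Suc m) 0\<bar>) \<longlonglongrightarrow> \<bar>b n x - \<rho>\<bar>" by (intro tendsto_intros \<rho>)
    moreover have "(\<lambda>m. 1 / real n + 1 / real (Suc m)) \<longlonglongrightarrow> 1 / real n + 0" by (intro tendsto_intros inv0)
    ultimately have "\<bar>b n x - \<rho>\<bar> \<le> 1 / real n + 0"
      by (rule LIMSEQ_le) (use cmp[of n "Suc _" x 0] False in \<open>simp del: of_nat_Suc\<close>)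
    then have "real n * \<bar>b n x - \<rho>\<bar> \<le> 1" using False by (simp add: field_simps)
    also have "real n * \<bar>b n x - \<rho>\<bar> = \<bar>real n * (b n x - \<rho>)\<bar>" by (simp add: abs_mult)
    also have "real n * (b n x - \<rho>) = (F ^^ n) x - x - real n * \<rho>" using False by (simp add: b_def
        field_simps)
    finally show ?thesis .
  qed simp
  then show ?thesis by (auto simp: translation_number_def)
qed

lemma bounded_displacement_limit:
  assumes "\<And>n. \<bar>s n - c - real n * \<rho>\<bar> \<le> C"
  shows "(\<lambda>n. s n / real n) \<longlonglongrightarrow> \<rho>"
proof -
  have "(\<lambda>n. (s n - real n * \<rho>) / real n) \<longlonglongrightarrow> 0"
  proof (rule Lim_null_comparison)
    show "(\<lambda>n. (C + \<bar>c\<bar>) * (1 / real n)) \<longlonglongrightarrow> 0"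
      by (rule tendsto_mult_right_zero[OF lim_1_over_n])
    have "\<bar>s n - real n * \<rho>\<bar> \<le> C + \<bar>c\<bar>" for n using assms[of n] by linarith
    then show "\<forall>\<^sub>F n in sequentially. norm ((s n - real n * \<rho>) / real n) \<le> (C + \<bar>c\<bar>) * (1 / real n)"
      by (intro always_eventually allI) (simp add: abs_divide divide_right_mono)
  qed
  moreover have "\<forall>\<^sub>F n in sequentially. (s n - real n * \<rho>) / real n + \<rho> = s n / real n"
    using eventually_gt_at_top[of 0] by eventually_elim (simp add: field_simps)
  ultimately show ?thesis using tendsto_add[of _ 0 sequentially "\<lambda>n. \<rho>" \<rho>]
    by (auto intro: Lim_transform_eventually)
qed

lemma translation_number_limit:
  assumes "translation_number F \<rho>" shows "(\<lambda>n. (F ^^ n) x / real n) \<longlonglongrightarrow> \<rho>"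
  using assms by (intro bounded_displacement_limit[where c = x and C = 1]) (auto simp:
      translation_number_def)

text \<open>The displacement of \<open>H\<close> varies by at most 1, so conjugate orbits stay at
  bounded distance.\<close>

lemma translation_number_conj:
  assumes F: "mono F" "degree_one F" "translation_number F \<rho>" and H: "circle_lift H"
    and M: "mono M" "degree_one M" "\<And>x. M (H x) = H (F x)"
  shows "translation_number M \<rho>"
proof -
  obtain \<sigma> where \<sigma>: "translation_number M \<sigma>" using translation_number_exists[OF M(1,2)] by blast
  have it: "(M ^^ n) (H 0) = H ((F ^^ n) 0)" for n by (induction n) (simp_all add: M(3))
  have "(\<lambda>n. (M ^^ n) (H 0) / real n) \<longlonglongrightarrow> \<rho>"
  proof (rule bounded_displacement_limit[where c = "H 0" and C = 2])
    fix n
    have "\<bar>(H ((F ^^ n) 0) - (F ^^ n) 0) - (H 0 - 0)\<bar> \<le> 1"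
      using H by (intro displacement_osc) (auto simp: circle_lift_def strict_mono_mono)
    moreover have "\<bar>(F ^^ n) 0 - 0 - real n * \<rho>\<bar> \<le> 1" using F(3) unfolding translation_number_def by
        blast
    ultimately show "\<bar>(M ^^ n) (H 0) - H 0 - real n * \<rho>\<bar> \<le> 2" unfolding it by linarith
  qed
  with translation_number_limit[OF \<sigma>] have "\<sigma> = \<rho>" by (rule LIMSEQ_unique)
  with \<sigma> show ?thesis by simp
qed

text \<open>Integer iterates are needed because the closest return time \<open>a\<close> in
  \<open>denjoy_data\<close> may be negative.\<close>

definition zpow :: "(real \<Rightarrow> real) \<Rightarrow> int \<Rightarrow> real \<Rightarrow> real" where
  "zpow F k = (if k \<ge> 0 then F ^^ nat k else inv F ^^ nat (- k))"

lemma zpow_of_nat [simp]: "zpow F (int n) = F ^^ n"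
  by (simp add: zpow_def)

lemma zpow_plus1:
  assumes "bij F" shows "zpow F (k + 1) x = F (zpow F k x)"
proof (cases "k \<ge> 0")
  case True
  then have "nat (k + 1) = Suc (nat k)" by simp
  then show ?thesis using True by (simp add: zpow_def)
next
  case False
  then have e: "nat (- k) = Suc (nat (- (k + 1)))" by simp
  have "F (inv F y) = y" for y using assms by (simp add: bij_is_surj surj_f_inv_f)
  then show ?thesis using False by (cases "k = -1") (auto simp: zpow_def e)
qed

lemma zpow_minus1:
  assumes "bij F" shows "zpow F (k - 1) x = inv F (zpow F k x)"
  using zpow_plus1[OF assms, of "k - 1" x] assms by (simp add: bij_is_inj)

lemma zpow_add:
  assumes "bij F" shows "zpow F (j + k) x = zpow F j (zpow F k x)"
proof (induction j rule: int_induct[where k = 0])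
  case base
  then show ?case by (simp add: zpow_def)
next
  case (step1 i)
  have "zpow F (i + 1 + k) x = F (zpow F (i + k) x)" using zpow_plus1[OF assms, of "i + k" x] by
      (simp add: ac_simps)
  then show ?case using step1 by (simp add: zpow_plus1[OF assms])
next
  case (step2 i)
  have "zpow F (i - 1 + k) x = inv F (zpow F (i + k) x)" using zpow_minus1[OF assms, of "i + k" x]
      by (simp add: algebra_simps)
  then show ?case using step2 by (simp add: zpow_minus1[OF assms])
qed

lemma circle_lift_zpow: "circle_lift F \<Longrightarrow> circle_lift (zpow F k)"
  by (auto simp: zpow_def intro: circle_lift_funpow circle_lift_inv)

section \<open>Order of orbits and closest returns for an irrational translation number\<close>

locale irrational_lift =
  fixes F :: "real \<Rightarrow> real" and \<rho> :: real
  assumes lift: "circle_lift F" and trans: "translation_number F \<rho>" and irr: "\<rho> \<notin> \<rat>"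
begin

lemma bijF: "bij F" by (rule circle_lift_bij[OF lift])

lemma zpow_lift: "circle_lift (zpow F k)" by (rule circle_lift_zpow[OF lift])

lemma zpow_mono: "x \<le> y \<Longrightarrow> zpow F k x \<le> zpow F k y"
  using circle_lift_mono[OF zpow_lift] by (auto simp: mono_def)

lemma zpow_int: "zpow F k (x + of_int m) = zpow F k x + of_int m"
  using zpow_lift by (intro degree_one_int) (simp add: circle_lift_def)

lemma zpow_displacement: "\<bar>zpow F k x - x - of_int k * \<rho>\<bar> \<le> 1"
proof (cases "k \<ge> 0")
  case True
  then obtain n where "k = int n" by (metis nonneg_int_cases)
  then show ?thesis using trans by (simp add: translation_number_def)
next
  case False
  then obtain n where n: "k = - int n" by (metis int_cases4 of_nat_0_le_iff)
  have "zpow F (int n) (zpow F k x) = zpow F (int n + k) x" by (simp only: zpow_add[OF bijF])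
  also have "\<dots> = x" by (simp add: n zpow_def)
  finally have "(F ^^ n) (zpow F k x) = x" by simp
  moreover have "\<bar>(F ^^ n) (zpow F k x) - zpow F k x - real n * \<rho>\<bar> \<le> 1"
    using trans by (simp add: translation_number_def)
  ultimately show ?thesis by (simp add: n abs_le_iff)
qed

text \<open>Otherwise \<open>x\<close> would be an upper bound for its orbit under
  \<open>zpow F k\<close> followed by translation by \<open>m\<close>, whereas the translation
  number sends this orbit to infinity.\<close>

lemma zpow_positive:
  assumes "of_int k * \<rho> + of_int m > 0" shows "x < zpow F k x + of_int m"
proof (rule ccontr)
  assume "\<not> x < zpow F k x + of_int m"
  then have le: "zpow F k x + of_int m \<le> x" by simp
  have it: "zpow F (int n * k) x + of_int (int n * m) \<le> x" for n
  proof (induction n)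
    case 0
    then show ?case by (simp add: zpow_def)
  next
    case (Suc n)
    have "zpow F (int (Suc n) * k) x + of_int (int (Suc n) * m)
       = zpow F (int n * k) (zpow F k x) + of_int (int n * m) + of_int m"
      using zpow_add[OF bijF, of "int n * k" k x] by (simp add: distrib_right add.commute)
    also have "\<dots> = zpow F (int n * k) (zpow F k x + of_int m) + of_int (int n * m)"
      by (simp add: zpow_int)
    also have "\<dots> \<le> zpow F (int n * k) x + of_int (int n * m)" using zpow_mono[OF le] by simp
    finally show ?case using Suc by simp
  qed
  obtain n :: nat where "real n * (of_int k * \<rho> + of_int m) > 1" using reals_Archimedean3[OF assms]
      by metis
  moreover have "real n * (of_int k * \<rho> + of_int m) \<le> 1"
    using zpow_displacement[of "int n * k" x] it[of n] by (simp add: algebra_simps abs_le_iff)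
  ultimately show False by simp
qed

text \<open>Poincare's theorem on the order of orbits. It reduces to a positive displacement by
  starting at the point \<open>zpow F j x\<close>.\<close>

lemma orbit_less:
  assumes "of_int j * \<rho> + of_int m < of_int j' * \<rho> + of_int m'"
  shows "zpow F j x + of_int m < zpow F j' x + of_int m'"
proof -
  have "zpow F j x < zpow F (j' - j) (zpow F j x) + of_int (m' - m)"
    using assms by (intro zpow_positive) (simp add: algebra_simps)
  then show ?thesis by (simp add: zpow_add[OF bijF, symmetric])
qed

lemma lin_eq_0_iff: "of_int k * \<rho> + of_int m = 0 \<longleftrightarrow> k = 0 \<and> m = 0"
proof
  assume e: "of_int k * \<rho> + of_int m = 0"
  have "k = 0"
  proof (rule ccontr)
    assume "k \<noteq> 0"
    with e have "\<rho> = - of_int m / of_int k" by (simp add: field_simps add_eq_0_iff)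
    then have "\<rho> \<in> \<rat>" by simp
    with irr show False by simp
  qed
  with e show "k = 0 \<and> m = 0" by simp
qed simp

lemma orbit_le:
  assumes "of_int j * \<rho> + of_int m \<le> of_int j' * \<rho> + of_int m'"
  shows "zpow F j x + of_int m \<le> zpow F j' x + of_int m'"
proof (cases "of_int j * \<rho> + of_int m = of_int j' * \<rho> + of_int m'")
  case True
  then have "of_int (j - j') * \<rho> + of_int (m - m') = 0" by (simp add: algebra_simps)
  then have "j = j'" "m = m'" unfolding lin_eq_0_iff by auto
  then show ?thesis by simp
qed (use assms orbit_less[of j m j' m' x] in auto)

end

text \<open>\<open>\<bar>a\<bar>\<close> and \<open>Q\<close> are consecutive closest return times of the rotation by \<open>\<rho>\<close>; the sign of \<open>a\<close> is
  chosen such that the displacement \<open>a \<rho> + b\<close> is positive.\<close>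

definition denjoy_data :: "real \<Rightarrow> int \<Rightarrow> int \<Rightarrow> nat \<Rightarrow> bool" where
  "denjoy_data \<rho> a b Q \<longleftrightarrow> 0 < of_int a * \<rho> + of_int b \<and> of_int a * \<rho> + of_int b < 1 \<and> a \<noteq> 0 \<and> \<bar>a\<bar> <
      int Q \<and>
     (\<forall>k m. 0 < \<bar>k\<bar> \<and> \<bar>k\<bar> < int Q \<longrightarrow> of_int a * \<rho> + of_int b \<le> \<bar>of_int k * \<rho> + of_int m\<bar>) \<and>
     (\<exists>m. \<bar>of_nat Q * \<rho> + of_int m\<bar> < of_int a * \<rho> + of_int b)"

text \<open>Up to sign, \<open>a\<close> is the time that comes closest among those up to N, where N
  is large and Dirichlet's theorem makes the distance small. \<open>Q\<close> is the first time that
  comes strictly closer, and its leastness is the separation property.\<close>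

lemma denjoy_data_exists:
  assumes irr: "\<rho> \<notin> \<rat>" and \<eta>: "\<eta> > 0"
  obtains a b Q where "denjoy_data \<rho> a b Q" "of_int a * \<rho> + of_int b < \<eta>"
proof -
  define nd where "nd k = \<bar>of_nat k * \<rho> - of_int (round (of_nat k * \<rho>))\<bar>" for k :: nat
  have nd_le: "nd k \<le> \<bar>of_nat k * \<rho> + of_int m\<bar>" for k m
    using round_diff_minimal[of "of_nat k * \<rho>" "- m"] by (simp add: nd_def)
  have nd_pos: "nd k > 0" if "k > 0" for k
  proof (rule ccontr)
    assume "\<not> nd k > 0"
    then have "of_nat k * \<rho> = of_int (round (of_nat k * \<rho>))" by (simp add: nd_def)
    then have "\<rho> = of_int (round (of_nat k * \<rho>)) / of_nat k" using that by (simp add: field_simps)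
    then have "\<rho> \<in> \<rat>" by (metis Rats_divide Rats_of_int Rats_of_nat)
    with irr show False by simp
  qed
  have dir: "\<exists>k. 0 < k \<and> k \<le> N \<and> nd k < 1 / real N" if N: "N > 0" for N
  proof -
    obtain h k where hk: "0 < k" "k \<le> int N" "\<bar>of_int k * \<rho> - of_int h\<bar> < 1 / N"
      using Dirichlet_approx[OF N, of \<rho>] by blast
    then have "nd (nat k) < 1 / real N" using nd_le[of "nat k" "- h"] by simp
    then show ?thesis using hk by (intro exI[of _ "nat k"]) auto
  qed
  obtain N :: nat where N: "N > 0" "1 / real N < min \<eta> 1"
    using reals_Archimedean[of "min \<eta> 1"] \<eta> by (metis inverse_eq_divide zero_less_Suc
        min_less_iff_conj zero_less_one)
  obtain k where k: "k \<in> {1..N}" and kmin: "\<And>j. j \<in> {1..N} \<Longrightarrow> nd k \<le> nd j"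
    using ex_is_arg_min_if_finite[of "{1..N}" nd] N by (auto simp: is_arg_min_linorder)
  define \<delta> where "\<delta> = nd k"
  have \<delta>: "0 < \<delta>" using nd_pos k by (simp add: \<delta>_def)
  have \<delta>N: "\<delta> < 1 / real N"
  proof -
    obtain j where "0 < j" "j \<le> N" "nd j < 1 / real N" using dir[OF N(1)] by blast
    then show ?thesis using kmin[of j] by (simp add: \<delta>_def)
  qed
  obtain a b where ab: "of_int a * \<rho> + of_int b = \<delta>" "\<bar>a\<bar> = int k"
  proof (cases "of_nat k * \<rho> - of_int (round (of_nat k * \<rho>)) \<ge> 0")
    case True
    then show ?thesis using that[of "int k" "- round (of_nat k * \<rho>)"] by (simp add: \<delta>_def nd_def)
  next
    case False
    then show ?thesis using that[of "- int k" "round (of_nat k * \<rho>)"] by (simp add: \<delta>_def nd_def)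
  qed
  define Pr where "Pr q \<longleftrightarrow> q > 0 \<and> nd q < \<delta>" for q :: nat
  obtain N' :: nat where N': "N' > 0" "1 / real N' < \<delta>"
    using reals_Archimedean[OF \<delta>] by (metis inverse_eq_divide zero_less_Suc)
  have ex: "\<exists>q. Pr q" using dir[OF N'(1)] N'(2) by (auto simp: Pr_def)
  define Q where "Q = (LEAST q. Pr q)"
  have Q: "Q > 0" "nd Q < \<delta>" using LeastI_ex[OF ex] by (simp_all add: Q_def Pr_def)
  have Qmin: "\<delta> \<le> nd q" if "0 < q" "q < Q" for q
    using not_less_Least[of q Pr] that by (simp add: Q_def Pr_def)
  have "k < Q"
  proof (rule ccontr)
    assume "\<not> k < Q"
    then have "Q \<in> {1..N}" using Q k by auto
    from kmin[OF this] Q show False by (simp add: \<delta>_def)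
  qed
  have sep: "\<delta> \<le> \<bar>of_int j * \<rho> + of_int m\<bar>" if "0 < \<bar>j\<bar>" "\<bar>j\<bar> < int Q" for j m
  proof (cases "j \<ge> 0")
    case True
    then obtain q where q: "j = int q" by (metis nonneg_int_cases)
    show ?thesis using Qmin[of q] nd_le[of q m] that by (simp add: q)
  next
    case False
    then obtain q where q: "j = - int q" by (metis int_cases4 of_nat_0_le_iff)
    show ?thesis using Qmin[of q] nd_le[of q "- m"] that by (simp add: q abs_minus_commute)
  qed
  have "\<exists>m. \<bar>of_nat Q * \<rho> + of_int m\<bar> < \<delta>"
    using Q(2) by (intro exI[of _ "- round (of_nat Q * \<rho>)"]) (simp add: nd_def)
  moreover have "\<delta> < 1" using \<delta>N N(2) by simp
  moreover have "a \<noteq> 0" "\<bar>a\<bar> < int Q" using ab(2) k \<open>k < Q\<close> by auto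
  ultimately have "denjoy_data \<rho> a b Q"
    unfolding denjoy_data_def ab(1) using \<delta> sep by blast
  then show ?thesis using that ab(1) \<delta>N N(2) by simp
qed

section \<open>Birkhoff sums, bounded distortion and the Denjoy-Koksma inequality\<close>

definition orbit_sum :: "(real \<Rightarrow> real) \<Rightarrow> nat \<Rightarrow> (real \<Rightarrow> real) \<Rightarrow> real \<Rightarrow> real" where
  "orbit_sum F n u x = (\<Sum>j<n. u ((F ^^ j) x))"

lemma orbit_sum_add: "orbit_sum F (m + n) u x = orbit_sum F m u x + orbit_sum F n u ((F ^^ m) x)"
proof (induction n)
  case (Suc n)
  have "(F ^^ (m + n)) x = (F ^^ n) ((F ^^ m) x)" by (metis add.commute comp_apply funpow_add)
  then show ?case using Suc by (simp add: orbit_sum_def)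
qed (simp add: orbit_sum_def)

lemma periodic_orbit_sum: "degree_one F \<Longrightarrow> periodic u \<Longrightarrow> periodic (orbit_sum F n u)"
  unfolding periodic_def orbit_sum_def using degree_one_funpow[of F]
  by (auto simp: degree_one_def intro!: sum.cong)

lemma var_le_orbit_sum:
  assumes "circle_lift F" "var_le u V" shows "var_le (orbit_sum F n u) (real n * V)"
proof -
  have "var_le (\<lambda>x. \<Sum>j<n. u ((F ^^ j) x)) (\<Sum>j<n. V)"
    using circle_lift_funpow[OF assms(1)] circle_lift_mono
    by (intro var_le_sum var_le_comp[OF assms(2)]) (auto simp: circle_lift_def)
  then show ?thesis by (simp add: orbit_sum_def[abs_def])
qed

locale denjoy = irrational_lift +
  fixes a b :: int and Q :: nat
  assumes data: "denjoy_data \<rho> a b Q"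
begin

definition "\<delta> = of_int a * \<rho> + of_int b"

lemma \<delta>: "0 < \<delta>" "\<delta> < 1" "a \<noteq> 0" "\<bar>a\<bar> < int Q"
  using data by (simp_all add: denjoy_data_def \<delta>_def)

lemma sep: "0 < \<bar>k\<bar> \<Longrightarrow> \<bar>k\<bar> < int Q \<Longrightarrow> \<delta> \<le> \<bar>of_int k * \<rho> + of_int m\<bar>"
  using data by (simp add: denjoy_data_def \<delta>_def)

text \<open>The return map. It commutes with \<open>F\<close> and with integer translations, and it
  moves points by \<open>\<delta>\<close> in the order of the rotation; the intervals
  \<open>[x, T x]\<close> are the Denjoy intervals.\<close>

definition T :: "real \<Rightarrow> real" where "T x = zpow F a x + of_int b"

lemma T_lift: "circle_lift T"
  unfolding T_def[abs_def] by (intro circle_lift_add_const zpow_lift)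

lemma T_mono: "x \<le> y \<Longrightarrow> T x \<le> T y"
  using circle_lift_mono[OF T_lift] by (auto simp: mono_def)

lemma T_gt: "x < T x"
  unfolding T_def by (rule zpow_positive) (use \<delta> in \<open>simp add: \<delta>_def\<close>)

lemma T_lt: "T x < x + 1"
  using orbit_less[of a b 0 1 x] \<delta> by (simp add: T_def \<delta>_def zpow_def)

lemma F_T: "(F ^^ k) (T x) = zpow F (int k + a) x + of_int b"
  using zpow_int[of "int k" "zpow F a x" b] by (simp add: T_def zpow_add[OF bijF])

text \<open>For the rotation both intervals have length \<open>\<delta>\<close> and, by the choice
  of \<open>Q\<close>, left endpoints at least \<open>\<delta>\<close> apart; the order of orbits
  transfers this to \<open>F\<close>. For \<open>i = j\<close> the endpoints differ by a nonzero
  integer, and \<open>\<delta> < 1\<close>.\<close>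

lemma intervals_nonoverlapping:
  assumes "i < Q" "j < Q" "i \<noteq> j \<or> m \<noteq> 0"
  shows "(F ^^ i) (T x) \<le> (F ^^ j) x + of_int m \<or> (F ^^ j) (T x) + of_int m \<le> (F ^^ i) x"
proof -
  have "\<delta> \<le> \<bar>of_int (int j - int i) * \<rho> + of_int m\<bar>"
  proof (cases "i = j")
    case True
    then have "\<bar>of_int m\<bar> \<ge> (1::real)" using assms by linarith
    then show ?thesis using True \<delta> by simp
  next
    case False
    then show ?thesis using assms by (intro sep) auto
  qed
  then consider "\<delta> \<le> of_int (int j - int i) * \<rho> + of_int m" | "\<delta> \<le> - (of_int (int j - int i) * \<rho> +
      of_int m)"
    by linarith
  then show ?thesis
  proof cases
    case 1
    then have "zpow F (int i + a) x + of_int b \<le> zpow F (int j) x + of_int m"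
      by (intro orbit_le) (simp add: \<delta>_def algebra_simps)
    then show ?thesis by (simp add: F_T)
  next
    case 2
    then have "zpow F (int j + a) x + of_int (b + m) \<le> zpow F (int i) x + of_int 0"
      by (intro orbit_le) (simp add: \<delta>_def algebra_simps)
    then show ?thesis by (simp add: F_T)
  qed
qed

text \<open>Denjoy's argument: the first \<open>Q\<close> images of \<open>[x, T x]\<close> do not
  overlap modulo 1, so the oscillations of \<open>u\<close> over them add up to at most
  \<open>V\<close>.\<close>

lemma distortion_sum:
  assumes u: "periodic u" "var_le u V" and n: "n \<le> Q"
    and st: "x \<le> s" "s \<le> T x" "x \<le> t" "t \<le> T x"
  shows "\<bar>orbit_sum F n u s - orbit_sum F n u t\<bar> \<le> V"
proof -
  obtain \<Psi> where \<Psi>: "var_majorant u V \<Psi>" using var_le_majorant[OF u(2,1)] .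
  have strict: "(F ^^ j) y < (F ^^ j) z" if "y < z" for j y z
    using circle_lift_funpow[OF lift, of j] that by (auto simp: circle_lift_def strict_mono_def)
  then have weak: "(F ^^ j) y \<le> (F ^^ j) z" if "y \<le> z" for j y z using that by (metis le_less)
  have "\<bar>orbit_sum F n u s - orbit_sum F n u t\<bar> \<le> (\<Sum>j<n. \<bar>u ((F ^^ j) s) - u ((F ^^ j) t)\<bar>)"
    unfolding orbit_sum_def sum_subtractf[symmetric] by (rule sum_abs)
  also have "\<dots> \<le> (\<Sum>j<n. \<Psi> ((F ^^ j) (T x)) - \<Psi> ((F ^^ j) x))"
  proof (intro sum_mono)
    fix j
    have *: "\<bar>u ((F ^^ j) s) - u ((F ^^ j) t)\<bar> \<le> \<Psi> ((F ^^ j) (T x)) - \<Psi> ((F ^^ j) x)"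
      if "s \<le> t" "x \<le> s" "t \<le> T x" for s t
    proof -
      have "\<bar>u ((F ^^ j) t) - u ((F ^^ j) s)\<bar> \<le> \<Psi> ((F ^^ j) t) - \<Psi> ((F ^^ j) s)"
        using \<Psi> weak[OF that(1)] by (simp add: var_majorant_def)
      moreover have "\<Psi> ((F ^^ j) t) \<le> \<Psi> ((F ^^ j) (T x))" "\<Psi> ((F ^^ j) x) \<le> \<Psi> ((F ^^ j) s)"
        using var_majorant_mono[OF \<Psi>] weak that by auto
      ultimately show ?thesis by linarith
    qed
    show "\<bar>u ((F ^^ j) s) - u ((F ^^ j) t)\<bar> \<le> \<Psi> ((F ^^ j) (T x)) - \<Psi> ((F ^^ j) x)"
      using *[of s t] *[of t s] st by (cases "s \<le> t") (auto simp: abs_minus_commute)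
  qed
  also have "\<dots> \<le> V"
    by (rule sum_nonoverlapping_mod_1[OF \<Psi>])
      (use var_le_nonneg[OF u(2)] strict[OF T_gt] intervals_nonoverlapping n in auto)
  finally show ?thesis .
qed

text \<open>Among the first \<open>Q\<close> orbit points and their integer translates, the last one
  before \<open>y\<close> is followed by another one within the rotation distance
  \<open>2 * \<delta>\<close>, and this one cannot lie before \<open>y\<close>.\<close>

lemma covering:
  obtains k m where "k < Q" "y \<le> (F ^^ k) x + of_int m" "(F ^^ k) x + of_int m < T (T y)"
proof -
  obtain m' where m': "\<bar>of_nat Q * \<rho> + of_int m'\<bar> < \<delta>" using data by (auto simp: denjoy_data_def \<delta>_def)
  \<comment> \<open>The largest integer translate strictly below \<open>y\<close>, hence the ceiling
    minus 1.\<close>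
  define l where "l k = \<lceil>y - (F ^^ k) x\<rceil> - 1" for k
  define z where "z k = (F ^^ k) x + of_int (l k)" for k
  have zmax: "(F ^^ k) x + of_int m \<le> z k" if "(F ^^ k) x + of_int m < y" for k m
  proof -
    have "of_int m < y - (F ^^ k) x" using that by linarith
    then have "m \<le> l k" unfolding l_def using less_ceiling_iff[of m "y - (F ^^ k) x"] by linarith
    then show ?thesis by (simp add: z_def)
  qed
  have zlt: "z k < y" for k unfolding z_def l_def by linarith
  have Q0: "Q > 0" using \<delta> by linarith
  obtain k where k: "k < Q" and kmax: "\<And>j. j < Q \<Longrightarrow> z j \<le> z k"
  proof -
    have "Max (z ` {..<Q}) \<in> z ` {..<Q}" using Q0 by (intro Max_in) auto
    then obtain k where "k < Q" "Max (z ` {..<Q}) = z k" by auto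
    moreover have "z j \<le> Max (z ` {..<Q})" if "j < Q" for j using that by (intro Max_ge) auto
    ultimately show ?thesis using that by auto
  qed
  \<comment> \<open>The time \<open>k + a\<close> is further by \<open>\<delta>\<close>. If it
    leaves the range below \<open>Q\<close>, it is corrected by \<open>Q\<close>, which changes the
    position by less than \<open>\<delta>\<close>.\<close>
  obtain j n where j: "j < Q" and lo: "of_nat k * \<rho> + of_int (l k) < of_nat j * \<rho> + of_int n"
    and hi: "of_nat j * \<rho> + of_int n < of_nat k * \<rho> + of_int (l k) + 2 * \<delta>"
  proof -
    consider "0 \<le> int k + a \<and> int k + a < int Q" | "int k + a < 0" | "int k + a \<ge> int Q" by linarith
    then show ?thesis
    proof cases
      case 1
      then obtain j where j: "int k + a = int j" by (metis nonneg_int_cases)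
      show ?thesis
      proof (rule that[of j "l k + b"])
        have "of_nat j = of_nat k + (of_int a :: real)" using j by (metis of_int_add of_int_of_nat_eq)
        then show "of_nat k * \<rho> + of_int (l k) < of_nat j * \<rho> + of_int (l k + b)"
          "of_nat j * \<rho> + of_int (l k + b) < of_nat k * \<rho> + of_int (l k) + 2 * \<delta>"
          using \<delta>(1) by (simp_all add: \<delta>_def algebra_simps)
      qed (use 1 j in simp)
    next
      case 2
      then have "0 \<le> int k + a + int Q" using \<delta> by linarith
      then obtain j where j: "int k + a + int Q = int j" by (metis nonneg_int_cases)
      show ?thesis
      proof (rule that[of j "l k + b + m'"])
        have "of_nat j = of_nat k + (of_int a :: real) + of_nat Q" using j by (metis of_int_add
            of_int_of_nat_eq)
        then show "of_nat k * \<rho> + of_int (l k) < of_nat j * \<rho> + of_int (l k + b + m')"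
          "of_nat j * \<rho> + of_int (l k + b + m') < of_nat k * \<rho> + of_int (l k) + 2 * \<delta>"
          using \<delta>(1) m' unfolding abs_less_iff by (simp_all add: \<delta>_def algebra_simps)
      qed (use 2 j in simp)
    next
      case 3
      then obtain j where j: "int k + a - int Q = int j" by (metis diff_ge_0_iff_ge nonneg_int_cases)
      show ?thesis
      proof (rule that[of j "l k + b - m'"])
        have "of_nat j = of_nat k + (of_int a :: real) - of_nat Q" using j by (metis of_int_add
            of_int_diff of_int_of_nat_eq)
        then have "of_nat j * \<rho> = of_nat k * \<rho> + of_int a * \<rho> - of_nat Q * \<rho>"
          by (simp only: distrib_right left_diff_distrib)
        moreover have "of_nat Q * \<rho> + of_int m' < \<delta>" "- (of_nat Q * \<rho>) - of_int m' < \<delta>"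
          using m' by (auto simp: abs_less_iff)
        ultimately show "of_nat k * \<rho> + of_int (l k) < of_nat j * \<rho> + of_int (l k + b - m')"
          "of_nat j * \<rho> + of_int (l k + b - m') < of_nat k * \<rho> + of_int (l k) + 2 * \<delta>"
          unfolding \<delta>_def of_int_add of_int_diff mult_2 by linarith+
      next
        show "j < Q" using \<delta> k j by linarith
      qed
    qed
  qed
  have "z k < (F ^^ j) x + of_int n" using orbit_less[of "int k" "l k" "int j" n x] lo by (simp add:
      z_def)
  then have "y \<le> (F ^^ j) x + of_int n" using zmax[of j n] kmax[OF j] by force
  moreover have "(F ^^ j) x + of_int n < T (T y)"
  proof -
    have "zpow F (int j) x + of_int n < zpow F (a + (a + int k)) x + of_int (l k + b + b)"
      using hi by (intro orbit_less) (simp add: \<delta>_def algebra_simps)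
    also have "\<dots> = T (T (z k))"
    proof -
      have "T (z k) = zpow F (a + int k) x + of_int (l k + b)"
        by (simp add: T_def z_def zpow_add[OF bijF] zpow_int)
      then have "T (T (z k)) = zpow F a (zpow F (a + int k) x + of_int (l k + b)) + of_int b"
        unfolding T_def[of "T (z k)"] by (rule arg_cong)
      then show ?thesis
        unfolding zpow_int zpow_add[OF bijF, of a "a + int k"] by simp
    qed
    also have "\<dots> \<le> T (T y)" using zlt[of k] by (intro T_mono) simp
    finally show ?thesis by simp
  qed
  ultimately show ?thesis using that j by blast
qed

definition q :: nat where "q = nat \<bar>a\<bar>"

lemma q: "0 < q" "q < Q" using \<delta> by (auto simp: q_def)

text \<open>Up to an integer, \<open>F^q x\<close> is the image or the preimage of \<open>x\<close>
  under \<open>T\<close>, according to the sign of \<open>a\<close>; either way it shares a Denjoy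
  interval with \<open>x\<close>.\<close>

lemma distortion_sum_shift:
  assumes u: "periodic u" "var_le u V" and n: "n \<le> Q"
  shows "\<bar>orbit_sum F n u ((F ^^ q) x) - orbit_sum F n u x\<bar> \<le> V"
proof -
  have per: "periodic (orbit_sum F n u)"
    using lift u by (intro periodic_orbit_sum) (auto simp: circle_lift_def)
  show ?thesis
  proof (cases "a \<ge> 0")
    case True
    then have "int q = a" by (simp add: q_def)
    then have "T x = (F ^^ q) x + of_int b" by (simp add: T_def flip: zpow_of_nat)
    then have "orbit_sum F n u ((F ^^ q) x) = orbit_sum F n u (T x)" by (simp add: periodic_int[OF per])
    then show ?thesis using distortion_sum[OF u n, of x "T x" x] T_gt[of x] by simp
  next
    case False
    then have a: "a = - int q" by (simp add: q_def)
    define y where "y = (F ^^ q) x + of_int (- b)"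
    have "T y = zpow F (a + int q) x"
      unfolding T_def y_def zpow_int zpow_add[OF bijF] by simp
    moreover have "a + int q = 0" using a by simp
    ultimately have Ty: "T y = x" by (simp only: zpow_def) simp
    have "orbit_sum F n u y = orbit_sum F n u ((F ^^ q) x)" unfolding y_def by (rule periodic_int[OF
        per])
    then show ?thesis using distortion_sum[OF u n, of y y "T y"] T_gt[of y] by (simp add: Ty)
  qed
qed

text \<open>Some point \<open>F^k y\<close> of the orbit of \<open>y\<close> lies, up to an integer,
  in two consecutive Denjoy intervals that begin at \<open>x\<close>, at a cost of
  \<open>2 * V\<close>. Moving from \<open>y\<close> to \<open>F^k y\<close> exchanges the two
  times, \<open>S_q (F^k y) - S_q y = S_k (F^q y) - S_k y\<close>, and costs another
  \<open>V\<close>.\<close>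

lemma denjoy_koksma:
  assumes u: "periodic u" "var_le u V"
  shows "\<bar>orbit_sum F q u x - orbit_sum F q u y\<bar> \<le> 3 * V"
proof -
  have per: "periodic (orbit_sum F q u)"
    using lift u by (intro periodic_orbit_sum) (auto simp: circle_lift_def)
  obtain k m where k: "k < Q" "x \<le> (F ^^ k) y + of_int m" "(F ^^ k) y + of_int m < T (T x)" using
      covering .
  define z where "z = (F ^^ k) y + of_int m"
  have z: "orbit_sum F q u z = orbit_sum F q u ((F ^^ k) y)" unfolding z_def by (rule
      periodic_int[OF per])
  have "orbit_sum F q u ((F ^^ k) y) - orbit_sum F q u y = orbit_sum F k u ((F ^^ q) y) - orbit_sum
      F k u y"
    using orbit_sum_add[of F k q u y] orbit_sum_add[of F q k u y] by (simp add: add.commute)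
  then have 1: "\<bar>orbit_sum F q u z - orbit_sum F q u y\<bar> \<le> V"
    using distortion_sum_shift[OF u, of k y] k z by simp
  have qQ: "q \<le> Q" using q by simp
  have "\<bar>orbit_sum F q u x - orbit_sum F q u z\<bar> \<le> 2 * V"
  proof (cases "z \<le> T x")
    case True
    then show ?thesis using distortion_sum[OF u qQ, of x x z] T_gt[of x] k var_le_nonneg[OF u(2)]
      by (simp add: z_def[symmetric])
  next
    case False
    then show ?thesis using distortion_sum[OF u qQ, of x x "T x"] distortion_sum[OF u qQ, of "T x"
        "T x" z]
       T_gt[of x] T_gt[of "T x"] k by (fold z_def) linarith
  qed
  with 1 show ?thesis by linarith
qed

end

section \<open>Variation of Birkhoff averages\<close>

definition C1_lift :: "(real \<Rightarrow> real) \<Rightarrow> (real \<Rightarrow> real) \<Rightarrow> bool" where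
  "C1_lift F D \<longleftrightarrow> degree_one F \<and> (\<forall>x. (F has_real_derivative D x) (at x) \<and> 0 < D x) \<and> continuous_on
      UNIV D"

lemma C1_liftD:
  assumes "C1_lift F D"
  shows "degree_one F" "(F has_real_derivative D x) (at x)" "0 < D x" "continuous_on UNIV D"
  using assms by (auto simp: C1_lift_def)

lemma C1_lift_circle_lift: assumes "C1_lift F D" shows "circle_lift F"
proof -
  note F = C1_liftD[OF assms]
  have "F x < F y" if "x < y" for x y
    by (rule DERIV_pos_imp_increasing[OF that]) (use F in blast)
  moreover have "continuous_on UNIV F" using F(2) by (meson DERIV_isCont
      continuous_at_imp_continuous_on)
  ultimately show ?thesis using F(1) by (simp add: circle_lift_def strict_mono_def)
qed

lemma C1_lift_periodic: assumes "C1_lift F D" shows "periodic D"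
  unfolding periodic_def
proof
  fix x
  note F = C1_liftD[OF assms]
  have "((\<lambda>x. F (x + 1)) has_real_derivative D (x + 1)) (at x)" using F(2)[of "x + 1"] by (simp add:
      DERIV_shift)
  moreover have "((\<lambda>x. F (x + 1)) has_real_derivative D x) (at x)"
    using F(1,2) unfolding degree_one_def by (auto intro!: derivative_eq_intros)
  ultimately show "D (x + 1) = D x" by (rule DERIV_unique)
qed

lemma C1_lift_comp:
  assumes "C1_lift F D" "C1_lift G E"
  shows "C1_lift (\<lambda>x. F (G x)) (\<lambda>x. D (G x) * E x)"
proof -
  note F = C1_liftD[OF assms(1)] and G = C1_liftD[OF assms(2)]
  have "continuous_on UNIV G" using C1_lift_circle_lift[OF assms(2)] by (simp add: circle_lift_def)
  then have "continuous_on UNIV (\<lambda>x. D (G x) * E x)"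
    by (intro continuous_intros G(4) continuous_on_compose2[OF F(4)]) auto
  then show ?thesis
    using degree_one_comp[OF F(1) G(1)] DERIV_chain2[OF F(2) G(2)] F(3) G(3) by (simp add: C1_lift_def)
qed

lemma C1_lift_id: "C1_lift (\<lambda>x. x) (\<lambda>x. 1)"
  by (simp add: C1_lift_def degree_one_def)

lemma C1_lift_inv:
  assumes "C1_lift F D" shows "C1_lift (inv F) (\<lambda>x. 1 / D (inv F x))"
proof -
  note F = C1_liftD[OF assms]
  have L: "circle_lift F" by (rule C1_lift_circle_lift[OF assms])
  have I: "circle_lift (inv F)" by (rule circle_lift_inv[OF L])
  have F': "F (inv F x) = x" for x using circle_lift_bij[OF L] by (simp add: bij_is_surj surj_f_inv_f)
  have c: "continuous_on UNIV (inv F)" using I by (simp add: circle_lift_def)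
  have "(inv F has_real_derivative inverse (D (inv F x))) (at x)" for x
  proof (rule DERIV_inverse_function[where f = F and a = "x - 1" and b = "x + 1"])
    show "isCont (inv F) x" using c by (simp add: continuous_on_eq_continuous_at)
  qed (use F(2) F(3)[of "inv F x"] F' in auto)
  moreover have "continuous_on UNIV (\<lambda>x. 1 / D (inv F x))"
    using F(3) by (intro continuous_intros continuous_on_compose2[OF F(4) c]) (auto simp:
        less_imp_neq[symmetric] order_less_imp_not_eq2)
  ultimately show ?thesis using I F(3) by (simp add: C1_lift_def circle_lift_def inverse_eq_divide)
qed

lemma C1_lift_funpow:
  assumes "C1_lift F D" shows "C1_lift (F ^^ n) (\<lambda>x. exp (orbit_sum F n (\<lambda>x. ln (D x)) x))"
proof (induction n)
  case 0
  then show ?case using C1_lift_id by (simp add: orbit_sum_def id_def)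
next
  case (Suc n)
  from C1_lift_comp[OF assms Suc] show ?case
    using C1_liftD(3)[OF assms] by (simp add: orbit_sum_def exp_add o_def mult.commute)
qed

lemma C1_lift_mvt:
  assumes "C1_lift F D" "s < t"
  obtains \<xi> where "s < \<xi>" "\<xi> < t" "F t - F s = D \<xi> * (t - s)"
  using MVT2[OF assms(2), of F D] C1_liftD(2)[OF assms(1)] by (metis mult.commute)

lemma C1_lift_increment_bounds:
  assumes "C1_lift F D" "s \<le> t" "\<And>x. s \<le> x \<Longrightarrow> x \<le> t \<Longrightarrow> c \<le> D x \<and> D x \<le> C"
  shows "c * (t - s) \<le> F t - F s" "F t - F s \<le> C * (t - s)"
proof -
  have "c * (t - s) \<le> F t - F s \<and> F t - F s \<le> C * (t - s)"
  proof (cases "s = t")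
    case False
    then have "s < t" using assms(2) by simp
    then obtain \<xi> where \<xi>: "s < \<xi>" "\<xi> < t" "F t - F s = D \<xi> * (t - s)" by (rule C1_lift_mvt[OF
        assms(1)])
    then show ?thesis using assms(3)[of \<xi>] \<open>s < t\<close> by (auto intro!: mult_right_mono)
  qed simp
  then show "c * (t - s) \<le> F t - F s" "F t - F s \<le> C * (t - s)" by auto
qed

lemma C1_lift_deriv_1:
  assumes "C1_lift F D" obtains \<xi> where "D \<xi> = 1"
proof -
  obtain \<xi> where "F 1 - F 0 = D \<xi> * (1 - 0)" using C1_lift_mvt[OF assms, of 0 1] by auto
  moreover have "F 1 = F 0 + 1" using C1_liftD(1)[OF assms, unfolded degree_one_def, rule_format, of
      0] by simp
  ultimately show ?thesis using that by simp
qed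

lemma periodic_continuous_bound:
  fixes u :: "real \<Rightarrow> real"
  assumes "periodic u" "continuous_on UNIV u" obtains B where "\<And>x. \<bar>u x\<bar> \<le> B"
proof -
  have "compact (u ` {0..1})" using assms(2) by (intro compact_continuous_image) (auto intro:
      continuous_on_subset)
  then obtain B where B: "\<forall>y\<in>u ` {0..1}. norm y \<le> B" using compact_imp_bounded bounded_iff by metis
  have "\<bar>u x\<bar> \<le> B" for x
  proof -
    obtain y where "0 \<le> y" "y < 0 + 1" "u y = u x" using periodic_reduce[OF assms(1), of 0 x] by metis
    then have "y \<in> {0..1}" "u y = u x" by simp_all
    then have "u y = u x" "u y \<in> u ` {0..1}" using imageI by metis+
    then show ?thesis using B by (metis real_norm_def)
  qed
  then show ?thesis using that by blast
qed

subsection \<open>Closure properties of absolute continuity\<close>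

lemma abs_continuousI:
  assumes "\<And>\<epsilon>. \<epsilon> > 0 \<Longrightarrow> \<exists>\<delta>>0. \<forall>(n::nat) s t.
        (\<forall>i<n. a \<le> s i \<and> s i \<le> t i \<and> t i \<le> b) \<longrightarrow>
        disjoint_family_on (\<lambda>i. {s i<..<t i}) {..<n} \<longrightarrow>
        (\<Sum>i<n. t i - s i) < \<delta> \<longrightarrow>
        (\<Sum>i<n. \<bar>u (t i) - u (s i)\<bar>) < \<epsilon>"
  shows "abs_continuous_on_interval a b u"
  using assms unfolding abs_continuous_on_interval_def by meson

lemma abs_continuousD:
  assumes "abs_continuous_on_interval a b u" "\<epsilon> > 0"
  obtains \<delta> where "\<delta> > 0" "\<And>(n::nat) s t.
        (\<And>i. i < n \<Longrightarrow> a \<le> s i \<and> s i \<le> t i \<and> t i \<le> b) \<Longrightarrow>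
        disjoint_family_on (\<lambda>i. {s i<..<t i}) {..<n} \<Longrightarrow>
        (\<Sum>i<n. t i - s i) < \<delta> \<Longrightarrow>
        (\<Sum>i<n. \<bar>u (t i) - u (s i)\<bar>) < \<epsilon>"
proof (rule abs_continuous_finite[OF assms, where 'i = nat])
  fix \<delta> assume d: "\<delta> > 0" and *: "\<And>(A :: nat set) s t. finite A \<Longrightarrow>
        (\<And>i. i \<in> A \<Longrightarrow> a \<le> s i \<and> s i \<le> t i \<and> t i \<le> b) \<Longrightarrow>
        disjoint_family_on (\<lambda>i. {s i<..<t i}) A \<Longrightarrow> (\<Sum>i\<in>A. t i - s i) < \<delta> \<Longrightarrow>
        (\<Sum>i\<in>A. \<bar>u (t i) - u (s i)\<bar>) < \<epsilon>"
  show thesis by (rule that[OF d], rule *) auto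
qed

lemma abs_continuous_add:
  assumes "abs_continuous_on_interval a b u" "abs_continuous_on_interval a b v"
  shows "abs_continuous_on_interval a b (\<lambda>x. u x + v x)"
proof (rule abs_continuousI)
  fix \<epsilon> :: real assume "\<epsilon> > 0"
  then have e: "\<epsilon> / 2 > 0" by simp
  obtain \<delta>1 where d1: "\<delta>1 > 0" and 1: "\<And>(n::nat) s t.
        (\<And>i. i < n \<Longrightarrow> a \<le> s i \<and> s i \<le> t i \<and> t i \<le> b) \<Longrightarrow>
        disjoint_family_on (\<lambda>i. {s i<..<t i}) {..<n} \<Longrightarrow>
        (\<Sum>i<n. t i - s i) < \<delta>1 \<Longrightarrow> (\<Sum>i<n. \<bar>u (t i) - u (s i)\<bar>) < \<epsilon> / 2"
    by (rule abs_continuousD[OF assms(1) e]) (use that in auto)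
  obtain \<delta>2 where d2: "\<delta>2 > 0" and 2: "\<And>(n::nat) s t.
        (\<And>i. i < n \<Longrightarrow> a \<le> s i \<and> s i \<le> t i \<and> t i \<le> b) \<Longrightarrow>
        disjoint_family_on (\<lambda>i. {s i<..<t i}) {..<n} \<Longrightarrow>
        (\<Sum>i<n. t i - s i) < \<delta>2 \<Longrightarrow> (\<Sum>i<n. \<bar>v (t i) - v (s i)\<bar>) < \<epsilon> / 2"
    by (rule abs_continuousD[OF assms(2) e]) (use that in auto)
  show "\<exists>\<delta>>0. \<forall>(n::nat) s t. (\<forall>i<n. a \<le> s i \<and> s i \<le> t i \<and> t i \<le> b) \<longrightarrow>
        disjoint_family_on (\<lambda>i. {s i<..<t i}) {..<n} \<longrightarrow> (\<Sum>i<n. t i - s i) < \<delta> \<longrightarrow>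
        (\<Sum>i<n. \<bar>(u (t i) + v (t i)) - (u (s i) + v (s i))\<bar>) < \<epsilon>"
  proof (intro exI[of _ "min \<delta>1 \<delta>2"] conjI allI impI)
    fix n :: nat and s t :: "nat \<Rightarrow> real"
    assume *: "\<forall>i<n. a \<le> s i \<and> s i \<le> t i \<and> t i \<le> b" "disjoint_family_on (\<lambda>i. {s i<..<t i}) {..<n}"
      "(\<Sum>i<n. t i - s i) < min \<delta>1 \<delta>2"
    have "(\<Sum>i<n. \<bar>(u (t i) + v (t i)) - (u (s i) + v (s i))\<bar>)
       \<le> (\<Sum>i<n. \<bar>u (t i) - u (s i)\<bar> + \<bar>v (t i) - v (s i)\<bar>)"
      by (intro sum_mono) linarith
    also have "\<dots> < \<epsilon>" unfolding sum.distrib using 1[of n s t] 2[of n s t] * by simp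
    finally show "(\<Sum>i<n. \<bar>(u (t i) + v (t i)) - (u (s i) + v (s i))\<bar>) < \<epsilon>" .
  qed (use d1 d2 in simp)
qed

lemma abs_continuous_lipschitz:
  assumes u: "abs_continuous_on_interval a b u" and K: "K > 0"
    and lip: "\<And>x y. a \<le> x \<Longrightarrow> x \<le> y \<Longrightarrow> y \<le> b \<Longrightarrow> \<bar>v y - v x\<bar> \<le> K * \<bar>u y - u x\<bar>"
  shows "abs_continuous_on_interval a b v"
proof (rule abs_continuousI)
  fix \<epsilon> :: real assume "\<epsilon> > 0"
  then have e: "\<epsilon> / K > 0" using K by simp
  obtain \<delta> where d: "\<delta> > 0" and 1: "\<And>(n::nat) s t.
        (\<And>i. i < n \<Longrightarrow> a \<le> s i \<and> s i \<le> t i \<and> t i \<le> b) \<Longrightarrow>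
        disjoint_family_on (\<lambda>i. {s i<..<t i}) {..<n} \<Longrightarrow>
        (\<Sum>i<n. t i - s i) < \<delta> \<Longrightarrow> (\<Sum>i<n. \<bar>u (t i) - u (s i)\<bar>) < \<epsilon> / K"
    by (rule abs_continuousD[OF u e]) (use that in auto)
  show "\<exists>\<delta>>0. \<forall>(n::nat) s t. (\<forall>i<n. a \<le> s i \<and> s i \<le> t i \<and> t i \<le> b) \<longrightarrow>
        disjoint_family_on (\<lambda>i. {s i<..<t i}) {..<n} \<longrightarrow> (\<Sum>i<n. t i - s i) < \<delta> \<longrightarrow>
        (\<Sum>i<n. \<bar>v (t i) - v (s i)\<bar>) < \<epsilon>"
  proof (intro exI[of _ \<delta>] conjI allI impI)
    fix n :: nat and s t :: "nat \<Rightarrow> real"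
    assume *: "\<forall>i<n. a \<le> s i \<and> s i \<le> t i \<and> t i \<le> b" "disjoint_family_on (\<lambda>i. {s i<..<t i}) {..<n}"
      "(\<Sum>i<n. t i - s i) < \<delta>"
    have "(\<Sum>i<n. \<bar>v (t i) - v (s i)\<bar>) \<le> (\<Sum>i<n. K * \<bar>u (t i) - u (s i)\<bar>)"
      by (intro sum_mono lip) (use *(1) in auto)
    also have "\<dots> = K * (\<Sum>i<n. \<bar>u (t i) - u (s i)\<bar>)" by (simp add: sum_distrib_left)
    also have "\<dots> < \<epsilon>" using 1[of n s t] * K by (simp add: field_simps)
    finally show "(\<Sum>i<n. \<bar>v (t i) - v (s i)\<bar>) < \<epsilon>" .
  qed (use d in simp)
qed

lemma abs_continuous_cmult:
  assumes "abs_continuous_on_interval a b u" shows "abs_continuous_on_interval a b (\<lambda>x. c * u x)"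
proof (rule abs_continuous_lipschitz[OF assms, of "\<bar>c\<bar> + 1"])
  fix x y
  have "\<bar>c * u y - c * u x\<bar> = \<bar>c\<bar> * \<bar>u y - u x\<bar>" by (simp add: abs_mult right_diff_distrib[symmetric])
  then show "\<bar>c * u y - c * u x\<bar> \<le> (\<bar>c\<bar> + 1) * \<bar>u y - u x\<bar>" by (simp add: distrib_right)
qed simp

lemma abs_continuous_sum:
  assumes "\<And>i. i < n \<Longrightarrow> abs_continuous_on_interval a b (u i)"
  shows "abs_continuous_on_interval a b (\<lambda>x. \<Sum>i<(n::nat). u i x)"
  using assms
proof (induction n)
  case 0
  show ?case by (rule abs_continuousI) (auto intro!: exI[of _ 1])
qed (auto intro!: abs_continuous_add)

text \<open>The image \<open>[F 0, F 0 + 1]\<close> of the unit interval contains an integer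
  \<open>c\<close>, whereas the hypothesis controls \<open>w\<close> on \<open>[0, 1]\<close>.
  Therefore \<open>F\<close> is split at \<open>c\<close> into two parts that take values in
  \<open>[0, 1]\<close> after an integer translation.\<close>

lemma abs_continuous_comp:
  assumes per: "periodic w" and w: "abs_continuous_on_interval 0 1 w" and F: "C1_lift F D"
  shows "abs_continuous_on_interval 0 1 (\<lambda>x. w (F x))"
proof (rule abs_continuousI)
  fix \<epsilon> :: real assume "\<epsilon> > 0"
  then have e: "\<epsilon> / 2 > 0" by simp
  obtain \<delta> where d: "\<delta> > 0" and 1: "\<And>(n::nat) s t.
        (\<And>i. i < n \<Longrightarrow> 0 \<le> s i \<and> s i \<le> t i \<and> t i \<le> 1) \<Longrightarrow>
        disjoint_family_on (\<lambda>i. {s i<..<t i}) {..<n} \<Longrightarrow>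
        (\<Sum>i<n. t i - s i) < \<delta> \<Longrightarrow> (\<Sum>i<n. \<bar>w (t i) - w (s i)\<bar>) < \<epsilon> / 2"
    by (rule abs_continuousD[OF w e]) (use that in auto)
  obtain B where B: "\<And>x. \<bar>D x\<bar> \<le> B"
    using periodic_continuous_bound[OF C1_lift_periodic[OF F] C1_liftD(4)[OF F]] by blast
  have "0 < D 0" using C1_liftD(3)[OF F] .
  then have B0: "B > 0" using B[of 0] by simp
  have lip: "F t - F s \<le> B * (t - s)" if "s \<le> t" for s t
    by (rule C1_lift_increment_bounds(2)[OF F that, of 0])
      (use B C1_liftD(3)[OF F] in \<open>auto simp: abs_le_iff intro: less_imp_le\<close>)
  have strict: "F x < F y \<longleftrightarrow> x < y" for x y
    using C1_lift_circle_lift[OF F] by (simp add: circle_lift_def strict_mono_less)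
  define k where "k = \<lceil>F 0\<rceil>"
  define c where "c = real_of_int k"
  have k: "F 0 \<le> c" "c < F 0 + 1" by (simp_all add: c_def k_def) linarith
  have F1: "F 1 = F 0 + 1" using C1_liftD(1)[OF F, unfolded degree_one_def, rule_format, of 0] by simp
  have wk: "w (x + c) = w x" "w (x - c) = w x" for x
    using periodic_int[OF per, of x k] periodic_int[OF per, of x "- k"] by (simp_all add: c_def)
  have w1: "w (x + 1) = w x" for x using per by (simp add: periodic_def)
  show "\<exists>\<delta>>0. \<forall>(n::nat) s t. (\<forall>i<n. 0 \<le> s i \<and> s i \<le> t i \<and> t i \<le> 1) \<longrightarrow>
        disjoint_family_on (\<lambda>i. {s i<..<t i}) {..<n} \<longrightarrow> (\<Sum>i<n. t i - s i) < \<delta> \<longrightarrow>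
        (\<Sum>i<n. \<bar>w (F (t i)) - w (F (s i))\<bar>) < \<epsilon>"
  proof (intro exI[of _ "\<delta> / B"] conjI allI impI)
    fix n :: nat and s t :: "nat \<Rightarrow> real"
    assume st: "\<forall>i<n. 0 \<le> s i \<and> s i \<le> t i \<and> t i \<le> 1" and dj: "disjoint_family_on (\<lambda>i. {s i<..<t i})
        {..<n}"
      and len: "(\<Sum>i<n. t i - s i) < \<delta> / B"
    have Fr: "F 0 \<le> F x" "F x \<le> F 0 + 1" if "0 \<le> x" "x \<le> 1" for x
      using that strict[of x 0] strict[of 1 x] F1 by (auto simp: not_less[symmetric])
    \<comment> \<open>\<open>l\<close> stays at 1 once \<open>F\<close> has passed \<open>c\<close>,
      and \<open>h\<close> stays at 0 before. As \<open>w\<close> takes the same value at 0, 1 and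
      \<open>c\<close>, increments of \<open>w\<close> along \<open>F\<close> are sums of those
      along \<open>l\<close> and \<open>h\<close>.\<close>
    define l h where "l x = min (F x) c - c + 1" and "h x = max (F x) c - c" for x
    have lw: "w (F x) - w (F y) = (w (l x) - w (l y)) + (w (h x) - w (h y))" for x y
    proof -
      have "w (l x) = w (min (F x) c)" "w (h x) = w (max (F x) c)" for x
        by (simp_all add: l_def h_def wk w1)
      then show ?thesis by (simp add: min_def max_def)
    qed
    have djF: "disjoint_family_on (\<lambda>i. {g (s i)<..<g (t i)}) {..<n}"
      if g: "\<And>x y. g x < g y \<Longrightarrow> F x < F y" and gF: "\<And>z x y. g x < z \<Longrightarrow> z < g y \<Longrightarrow> \<exists>v. z = g v" for g ::
          "real \<Rightarrow> real"
      unfolding disjoint_family_on_def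
    proof (intro ballI impI)
      fix i j assume ij: "i \<in> {..<n}" "j \<in> {..<n}" "i \<noteq> j"
      show "{g (s i)<..<g (t i)} \<inter> {g (s j)<..<g (t j)} = {}"
      proof (rule ccontr)
        assume "\<not> ?thesis"
        then obtain z where "z \<in> {g (s i)<..<g (t i)} \<inter> {g (s j)<..<g (t j)}" by blast
        then have z: "g (s i) < z" "z < g (t i)" "g (s j) < z" "z < g (t j)" by auto
        from gF[OF z(1,2)] obtain v where v: "z = g v" by blast
        then have "v \<in> {s i<..<t i} \<inter> {s j<..<t j}" using z g strict by auto
        then show False using disjoint_family_onD[OF dj ij] by blast
      qed
    qed
    have surj: "\<exists>v. F v = z" for z
      using circle_lift_bij[OF C1_lift_circle_lift[OF F]] by (metis bij_is_surj surjD)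
    have lenF: "(\<Sum>i<n. g (t i) - g (s i)) < \<delta>"
      if g: "\<And>x y. x \<le> y \<Longrightarrow> g y - g x \<le> F y - F x" for g :: "real \<Rightarrow> real"
    proof -
      have "(\<Sum>i<n. g (t i) - g (s i)) \<le> (\<Sum>i<n. B * (t i - s i))"
        using st by (intro sum_mono order_trans[OF g lip]) auto
      also have "\<dots> = B * (\<Sum>i<n. t i - s i)" by (simp add: sum_distrib_left)
      also have "\<dots> < \<delta>" using len B0 by (simp add: field_simps)
      finally show ?thesis .
    qed
    have Fm: "F x \<le> F y" if "x \<le> y" for x y using strict[of y x] that by (simp add: not_less[symmetric])
    have "(\<Sum>i<n. \<bar>w (l (t i)) - w (l (s i))\<bar>) < \<epsilon> / 2"
    proof (rule 1)
      fix i assume "i < n"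
      then show "0 \<le> l (s i) \<and> l (s i) \<le> l (t i) \<and> l (t i) \<le> 1"
        using st Fr(1)[of "s i"] Fm[of "s i" "t i"] k by (auto simp: l_def min_def)
    next
      show "disjoint_family_on (\<lambda>i. {l (s i)<..<l (t i)}) {..<n}"
      proof (rule djF)
        fix z x y assume "l x < z" "z < l y"
        then have "z + c - 1 < c" by (auto simp: l_def)
        moreover obtain v where "F v = z + c - 1" using surj by blast
        ultimately show "\<exists>v. z = l v" by (intro exI[of _ v]) (simp add: l_def)
      qed (auto simp: l_def)
      show "(\<Sum>i<n. l (t i) - l (s i)) < \<delta>" by (rule lenF) (use Fm in \<open>force simp: l_def min_def\<close>)
    qed
    moreover have "(\<Sum>i<n. \<bar>w (h (t i)) - w (h (s i))\<bar>) < \<epsilon> / 2"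
    proof (rule 1)
      fix i assume "i < n"
      then show "0 \<le> h (s i) \<and> h (s i) \<le> h (t i) \<and> h (t i) \<le> 1"
        using st Fr(2)[of "t i"] Fm[of "s i" "t i"] k by (auto simp: h_def max_def)
    next
      show "disjoint_family_on (\<lambda>i. {h (s i)<..<h (t i)}) {..<n}"
      proof (rule djF)
        fix z x y assume "h x < z" "z < h y"
        then have "c < z + c" by (auto simp: h_def)
        moreover obtain v where "F v = z + c" using surj by blast
        ultimately show "\<exists>v. z = h v" by (intro exI[of _ v]) (simp add: h_def)
      qed (auto simp: h_def)
      show "(\<Sum>i<n. h (t i) - h (s i)) < \<delta>" by (rule lenF) (use Fm in \<open>force simp: h_def max_def\<close>)
    qed
    moreover have "(\<Sum>i<n. \<bar>w (F (t i)) - w (F (s i))\<bar>)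
        \<le> (\<Sum>i<n. \<bar>w (l (t i)) - w (l (s i))\<bar> + \<bar>w (h (t i)) - w (h (s i))\<bar>)"
      unfolding lw by (intro sum_mono) linarith
    ultimately show "(\<Sum>i<n. \<bar>w (F (t i)) - w (F (s i))\<bar>) < \<epsilon>" by (simp add: sum.distrib)
  qed (use d B0 in simp)
qed

lemma abs_continuous_orbit_sum:
  assumes "periodic w" "abs_continuous_on_interval 0 1 w" "C1_lift F D"
  shows "abs_continuous_on_interval 0 1 (orbit_sum F n w)"
  unfolding orbit_sum_def[abs_def]
  using abs_continuous_comp[OF assms(1,2) C1_lift_funpow[OF assms(3)]] by (intro abs_continuous_sum)


subsection \<open>Bounded Birkhoff sums and transport of ramps\<close>

text \<open>Adding such a function changes averages over \<open>N\<close> steps by a variation of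
  order \<open>1 / N\<close>. This is the equivalence modulo which ramps are moved.\<close>

definition bounded_sums :: "(real \<Rightarrow> real) \<Rightarrow> (real \<Rightarrow> real) \<Rightarrow> bool" where
  "bounded_sums F u \<longleftrightarrow> (\<exists>K. \<forall>N. var_le (orbit_sum F N u) K)"

lemma bounded_sums_zero: "bounded_sums F (\<lambda>x. 0)"
  unfolding bounded_sums_def orbit_sum_def by (intro exI[of _ 0]) (simp add: var_le_const)

lemma bounded_sums_add:
  assumes "bounded_sums F u" "bounded_sums F v" shows "bounded_sums F (\<lambda>x. u x + v x)"
proof -
  obtain K L where "\<And>N. var_le (orbit_sum F N u) K" "\<And>N. var_le (orbit_sum F N v) L"
    using assms by (auto simp: bounded_sums_def)
  then have "var_le (\<lambda>x. orbit_sum F N u x + orbit_sum F N v x) (K + L)" for N by (intro var_le_add)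
  then show ?thesis by (auto simp: bounded_sums_def orbit_sum_def[abs_def] sum.distrib)
qed

lemma bounded_sums_cmult:
  assumes "bounded_sums F u" shows "bounded_sums F (\<lambda>x. c * u x)"
proof -
  obtain K where "\<And>N. var_le (orbit_sum F N u) K" using assms by (auto simp: bounded_sums_def)
  then have "var_le (\<lambda>x. c * orbit_sum F N u x) (\<bar>c\<bar> * K)" for N by (intro var_le_cmult)
  then show ?thesis by (auto simp: bounded_sums_def orbit_sum_def[abs_def] sum_distrib_left)
qed

lemma bounded_sums_sum:
  assumes "finite A" "\<And>i. i \<in> A \<Longrightarrow> bounded_sums F (u i)" shows "bounded_sums F (\<lambda>x. \<Sum>i\<in>A. u i x)"
  using assms by (induction A) (auto intro: bounded_sums_zero bounded_sums_add)

text \<open>Birkhoff sums of a coboundary telescope: only \<open>j\<close> terms survive at each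
  end, whatever \<open>N\<close> is.\<close>

lemma var_le_orbit_sum_coboundary:
  assumes F: "circle_lift F" and u: "var_le u C"
  shows "var_le (orbit_sum F N (\<lambda>x. u x - u ((F ^^ j) x))) (2 * real j * C)"
proof -
  have "orbit_sum F N (\<lambda>x. u ((F ^^ j) x)) x = orbit_sum F N u ((F ^^ j) x)" for x
    by (simp add: orbit_sum_def funpow_add[symmetric, THEN fun_cong, unfolded o_def] add.commute)
  moreover have "orbit_sum F N u x + orbit_sum F j u ((F ^^ N) x) = orbit_sum F j u x + orbit_sum F
      N u ((F ^^ j) x)" for x
    by (metis orbit_sum_add add.commute)
  ultimately have *: "orbit_sum F N (\<lambda>x. u x - u ((F ^^ j) x)) x = orbit_sum F j u x - orbit_sum F j
      u ((F ^^ N) x)" for x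
    by (simp add: orbit_sum_def sum_subtractf algebra_simps)
  have "var_le (\<lambda>x. orbit_sum F j u x - orbit_sum F j u ((F ^^ N) x)) (real j * C + real j * C)"
    using circle_lift_funpow[OF F, of N] circle_lift_mono
    by (intro var_le_diff var_le_comp[OF var_le_orbit_sum[OF F u]] var_le_orbit_sum[OF F u])
      (auto simp: circle_lift_def)
  then show ?thesis unfolding *[symmetric] by (rule var_le_mono) simp
qed

lemma bounded_sums_coboundary_nat:
  assumes F: "circle_lift F" and u: "var_le u C"
  shows "bounded_sums F (\<lambda>x. u x - u ((F ^^ j) x))"
  using var_le_orbit_sum_coboundary[OF assms] by (auto simp: bounded_sums_def)

lemma bounded_sums_coboundary:
  assumes F: "circle_lift F" and u: "var_le u C"
  shows "bounded_sums F (\<lambda>x. u x - u (zpow F j x))"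
proof (cases "j \<ge> 0")
  case True
  then obtain n where "j = int n" by (metis nonneg_int_cases)
  then show ?thesis using bounded_sums_coboundary_nat[OF F u] by simp
next
  case False
  then obtain n where n: "j = - int n" by (metis int_cases4 of_nat_0_le_iff)
  have "var_le (\<lambda>x. u (zpow F j x)) C"
    using circle_lift_zpow[OF F, of j] circle_lift_mono by (intro var_le_comp[OF u]) (auto simp:
        circle_lift_def)
  from bounded_sums_cmult[OF bounded_sums_coboundary_nat[OF F this, of n], of "-1"]
  have "bounded_sums F (\<lambda>x. u (zpow F j ((F ^^ n) x)) - u (zpow F j x))" by simp
  moreover have "zpow F j ((F ^^ n) x) = x" for x
  proof -
    have "zpow F (j + int n) x = zpow F j ((F ^^ n) x)" using zpow_add[OF circle_lift_bij[OF F]] by simp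
    then show ?thesis by (simp add: n zpow_def)
  qed
  ultimately show ?thesis by simp
qed

section \<open>Geometry of Denjoy intervals and transport of ramps\<close>

locale C1_irrational_lift = irrational_lift +
  fixes D :: "real \<Rightarrow> real" and V :: real
  assumes C1: "C1_lift F D" and var_log: "var_le (\<lambda>x. ln (D x)) V"
begin

lemma V_nonneg: "0 \<le> V" using var_le_nonneg[OF var_log] .

lemma periodic_log: "periodic (\<lambda>x. ln (D x))"
  using C1_lift_periodic[OF C1] by (simp add: periodic_def)

text \<open>By the mean value theorem both lengths are multiplied under \<open>F^k\<close> by
  derivatives taken in the same Denjoy interval, and \<open>distortion_sum\<close> bounds the
  difference of the logarithms of these derivatives by \<open>V\<close>.\<close>

lemma iterate_distortion:
  assumes d: "denjoy_data \<rho> a b Q" and k: "k \<le> Q"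
    and st: "x \<le> s" "s \<le> t" "t \<le> zpow F a x + of_int b"
  shows "((F ^^ k) t - (F ^^ k) s) / ((F ^^ k) (zpow F a x + of_int b) - (F ^^ k) x)
    \<le> exp V * ((t - s) / (zpow F a x + of_int b - x))"
proof (cases "s = t")
  case False
  then have lt: "s < t" using st by simp
  interpret denjoy F \<rho> a b Q using d by unfold_locales
  let ?E = "\<lambda>x. exp (orbit_sum F k (\<lambda>x. ln (D x)) x)"
  have Fk: "C1_lift (F ^^ k) ?E" by (rule C1_lift_funpow[OF C1])
  have fold_T: "zpow F a x + of_int b = T x" by (simp add: T_def)
  obtain \<xi> where \<xi>: "s < \<xi>" "\<xi> < t" "(F ^^ k) t - (F ^^ k) s = ?E \<xi> * (t - s)"
    by (rule C1_lift_mvt[OF Fk lt])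
  obtain \<xi>' where \<xi>': "x < \<xi>'" "\<xi>' < T x" "(F ^^ k) (T x) - (F ^^ k) x = ?E \<xi>' * (T x - x)"
    by (rule C1_lift_mvt[OF Fk T_gt])
  have "orbit_sum F k (\<lambda>x. ln (D x)) \<xi> - orbit_sum F k (\<lambda>x. ln (D x)) \<xi>' \<le> V"
    using distortion_sum[OF periodic_log var_log k, of x \<xi> \<xi>'] \<xi> \<xi>' st by (simp add: T_def abs_le_iff)
  then have "?E \<xi> / ?E \<xi>' \<le> exp V" by (simp add: exp_diff[symmetric])
  moreover have "((F ^^ k) t - (F ^^ k) s) / ((F ^^ k) (T x) - (F ^^ k) x) = ?E \<xi> / ?E \<xi>' * ((t - s)
      / (T x - x))"
    unfolding \<xi>(3) \<xi>'(3) by simp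
  moreover have "(t - s) / (T x - x) \<ge> 0" using lt T_gt[of x] by simp
  ultimately show ?thesis unfolding fold_T using mult_right_mono by metis
qed simp

text \<open>\<open>F^q\<close> has degree one, so its derivative is 1 somewhere, and by the
  Denjoy-Koksma inequality the logarithm of the derivative oscillates by at most
  \<open>3 * V\<close>. For negative \<open>a\<close> the estimate passes to the inverse.\<close>

lemma T_bilipschitz:
  assumes d: "denjoy_data \<rho> a b Q" and "s \<le> t"
  shows "exp (- 3 * V) * (t - s) \<le> zpow F a t - zpow F a s"
    and "zpow F a t - zpow F a s \<le> exp (3 * V) * (t - s)"
proof -
  interpret denjoy F \<rho> a b Q using d by unfold_locales
  let ?E = "\<lambda>x. exp (orbit_sum F q (\<lambda>x. ln (D x)) x)"
  have Fq: "C1_lift (F ^^ q) ?E" by (rule C1_lift_funpow[OF C1])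
  obtain \<xi> where "?E \<xi> = 1" using C1_lift_deriv_1[OF Fq] .
  then have "\<bar>orbit_sum F q (\<lambda>x. ln (D x)) x\<bar> \<le> 3 * V" for x
    using denjoy_koksma[OF periodic_log var_log, of x \<xi>] by simp
  then have "- (3 * V) \<le> orbit_sum F q (\<lambda>x. ln (D x)) x \<and> orbit_sum F q (\<lambda>x. ln (D x)) x \<le> 3 * V" for x
    unfolding abs_le_iff by (metis minus_le_iff)
  then have E: "exp (- 3 * V) \<le> ?E x \<and> ?E x \<le> exp (3 * V)" for x by simp
  have inc: "exp (- 3 * V) * (t - s) \<le> (F ^^ q) t - (F ^^ q) s" "(F ^^ q) t - (F ^^ q) s \<le> exp (3 *
      V) * (t - s)"
    if "s \<le> t" for s t
    using C1_lift_increment_bounds[OF Fq that, of "exp (- 3 * V)" "exp (3 * V)"] E by auto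
  have "exp (- 3 * V) * (t - s) \<le> zpow F a t - zpow F a s \<and> zpow F a t - zpow F a s \<le> exp (3 * V) *
      (t - s)"
  proof (cases "a \<ge> 0")
    case True
    then have "zpow F a = F ^^ q" by (simp add: q_def zpow_def)
    then show ?thesis using inc[OF \<open>s \<le> t\<close>] by simp
  next
    case False
    then have "int q + a = 0" by (simp add: q_def)
    then have id: "(F ^^ q) (zpow F a x) = x" for x
      using zpow_add[OF bijF, of "int q" a x] by (simp add: zpow_def)
    have "zpow F a s \<le> zpow F a t" by (rule zpow_mono[OF \<open>s \<le> t\<close>])
    from inc[OF this] have "exp (- 3 * V) * (zpow F a t - zpow F a s) \<le> t - s"
      "t - s \<le> exp (3 * V) * (zpow F a t - zpow F a s)" by (simp_all add: id)
    then show ?thesis by (simp add: exp_minus field_simps)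
  qed
  then show "exp (- 3 * V) * (t - s) \<le> zpow F a t - zpow F a s"
    "zpow F a t - zpow F a s \<le> exp (3 * V) * (t - s)" by auto
qed

text \<open>Two consecutive intervals of a finer generation fit in one interval of the coarser one, and
  their lengths are comparable, so that passing to a finer generation shrinks all lengths by a
  definite factor.\<close>

lemma small_intervals:
  assumes "\<epsilon> > 0"
  obtains \<eta> where "\<eta> > 0"
    "\<And>a b Q x. denjoy_data \<rho> a b Q \<Longrightarrow> of_int a * \<rho> + of_int b < \<eta> \<Longrightarrow> zpow F a x + of_int b - x < \<epsilon>"
proof -
  \<comment> \<open>Two consecutive intervals of lengths \<open>l\<close> and at least
    \<open>exp (- 3 * V) * l\<close> have a sum of at least \<open>l / r\<close>.\<close>
  define r where "r = 1 / (1 + exp (- 3 * V))"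
  have r: "0 < r" "r < 1" by (simp_all add: r_def add_pos_pos field_simps)
  have "\<exists>\<eta>>0. \<forall>a b Q x. denjoy_data \<rho> a b Q \<and> of_int a * \<rho> + of_int b < \<eta> \<longrightarrow> zpow F a x + of_int b -
      x \<le> r ^ i" for i
  proof (induction i)
    case 0
    have "zpow F a x + of_int b - x \<le> 1" if "denjoy_data \<rho> a b Q" for a b Q x
    proof -
      interpret denjoy F \<rho> a b Q using that by unfold_locales
      show ?thesis using T_lt[of x] by (simp add: T_def)
    qed
    then show ?case by (intro exI[of _ 1]) auto
  next
    case (Suc i)
    then obtain \<eta> where \<eta>: "\<eta> > 0" and IH: "\<And>a b Q x. denjoy_data \<rho> a b Q \<Longrightarrow> of_int a * \<rho> + of_int b
        < \<eta> \<Longrightarrow>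
       zpow F a x + of_int b - x \<le> r ^ i" by blast
    obtain a b Q where d: "denjoy_data \<rho> a b Q" and less: "of_int a * \<rho> + of_int b < \<eta>"
      using denjoy_data_exists[OF irr \<eta>] .
    define \<delta> where "\<delta> = of_int a * \<rho> + of_int b"
    have \<delta>: "\<delta> > 0" using d by (simp add: denjoy_data_def \<delta>_def)
    have "zpow F a' x + of_int b' - x \<le> r ^ Suc i"
      if d': "denjoy_data \<rho> a' b' Q'" and less': "of_int a' * \<rho> + of_int b' < \<delta> / 2" for a' b' Q' x
    proof -
      interpret d': denjoy F \<rho> a' b' Q' using d' by unfold_locales
      let ?T = d'.T
      have TT: "?T (?T x) = zpow F (a' + a') x + of_int (b' + b')"
        unfolding d'.T_def zpow_add[OF bijF, of a' a'] zpow_int by simp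
      have "?T (?T x) < zpow F a x + of_int b"
        unfolding TT using less' by (intro orbit_less) (simp add: \<delta>_def algebra_simps)
      then have 1: "?T (?T x) - x \<le> r ^ i" using IH[OF d less, of x] by linarith
      have "exp (- 3 * V) * (?T x - x) \<le> ?T (?T x) - ?T x"
        using T_bilipschitz(1)[OF d', of x "?T x"] d'.T_gt[of x] by (simp add: d'.T_def)
      with 1 have "(?T x - x) * (1 + exp (- 3 * V)) \<le> r ^ i" by (simp add: algebra_simps)
      then show ?thesis by (simp add: r_def d'.T_def pos_le_divide_eq add_pos_pos)
    qed
    then show ?case using \<delta> by (intro exI[of _ "\<delta> / 2"]) auto
  qed
  moreover obtain i where i: "r ^ i < \<epsilon>" using real_arch_pow_inv[OF assms r(2)] by blast
  ultimately obtain \<eta> where "\<eta> > 0" and *: "\<And>a b Q x. denjoy_data \<rho> a b Q \<Longrightarrow>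
      of_int a * \<rho> + of_int b < \<eta> \<Longrightarrow> zpow F a x + of_int b - x \<le> r ^ i" by blast
  show ?thesis
    by (rule that[OF \<open>\<eta> > 0\<close>]) (rule le_less_trans[OF * i])
qed

text \<open>Of the exponent, \<open>V\<close> is the distortion of \<open>F^k\<close>,
  \<open>6 * V\<close> the comparison of \<open>[z, T z]\<close> with \<open>[y, T y]\<close>, and
  another \<open>6 * V\<close> the change of length under up to two applications of
  \<open>T\<close>. One factor 1/3 comes from the comparison of lengths, the other from averaging
  over three intervals.\<close>

definition "c\<^sub>0 = exp (- 13 * V) / 9"

text \<open>The density of \<open>[x, T x]\<close> is transported to the three consecutive intervals
  \<open>[T\<^sup>-\<^sup>i z, T\<^sup>1\<^sup>-\<^sup>i z]\<close>, \<open>i = 0, 1, 2\<close>, which cover \<open>[y, T y]\<close>.\<close>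

lemma transport_interval:
  assumes d: "denjoy_data \<rho> a b Q"
  defines "T \<equiv> \<lambda>x. zpow F a x + of_int b"
  shows "\<exists>\<Lambda>. mono \<Lambda> \<and> degree_one \<Lambda> \<and> bounded_sums F (\<lambda>t. ramp x (T x) t - \<Lambda> t) \<and>
    mono (\<lambda>t. \<Lambda> t - c\<^sub>0 * ramp y (T y) t)"
proof -
  interpret dj: denjoy F \<rho> a b Q using d by unfold_locales
  have T: "dj.T = T" by (simp add: T_def dj.T_def[abs_def])
  have Tx: "zpow F a x + of_int b = T x" for x by (simp add: T_def)
  note T_gt = dj.T_gt[unfolded T] and T_lt = dj.T_lt[unfolded T] and T_mono = dj.T_mono[unfolded T]
  have T_bij: "bij T" using circle_lift_bij[OF dj.T_lift] by (simp add: T)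
  have T_strict: "T s < T t \<longleftrightarrow> s < t" for s t
    using dj.T_lift by (simp add: T circle_lift_def strict_mono_less)
  have T_le: "T s \<le> T t \<longleftrightarrow> s \<le> t" for s t using T_strict[of t s] by (auto simp: not_less[symmetric])
  have low: "exp (- 3 * V) * (t - s) \<le> T t - T s" and up: "T t - T s \<le> exp (3 * V) * (t - s)"
    if "s \<le> t" for s t using T_bilipschitz[OF d that] by (simp_all add: T_def)
  define \<Lambda>0 where "\<Lambda>0 = ramp x (T x)"
  have xT: "x < T x" "T x \<le> x + 1" using T_gt[of x] T_lt[of x] by auto
  have \<Lambda>0: "mono \<Lambda>0" "degree_one \<Lambda>0"
    unfolding \<Lambda>0_def using ramp_mono[OF xT] ramp_degree_one by auto
  have \<Lambda>0_var: "var_le \<Lambda>0 1" using \<Lambda>0 by (intro var_le_mono_fun) (auto simp: degree_one_def)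
  \<comment> \<open>Some image of \<open>x\<close> falls into \<open>[y, T (T y))\<close>. Hence
    \<open>[y, T y]\<close> lies between the second preimage of \<open>z\<close> under
    \<open>T\<close> and the point \<open>T z\<close>.\<close>
  obtain k m where k: "k < Q" "y \<le> (F ^^ k) x + of_int m" "(F ^^ k) x + of_int m < T (T y)"
    using dj.covering unfolding T .
  define z where "z = (F ^^ k) x + of_int m"
  have z: "y \<le> z" "z < T (T y)" using k by (simp_all add: z_def)
  have FkT: "(F ^^ k) (T x) = T z - of_int m"
    using zpow_add[OF bijF, of "int k" a x] zpow_add[OF bijF, of a "int k" x]
      zpow_int[of a "(F ^^ k) x" m] zpow_int[of "int k" "zpow F a x" b] 
    by (simp add: T_def z_def add.commute)
  define J where "J = T y - y"
  have J: "J > 0" using T_gt by (simp add: J_def)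
  define L where "L = T z - z"
  have L0: "L > 0" using T_gt by (simp add: L_def)
  \<comment> \<open>\<open>[z, T z]\<close> is contained in the union of three consecutive Denjoy
    intervals starting at \<open>y\<close>, of lengths at most \<open>J\<close>,
    \<open>exp (3 * V) * J\<close> and \<open>exp (6 * V) * J\<close>.\<close>
  have L: "L \<le> 3 * exp (6 * V) * J"
  proof -
    have "T z \<le> T (T (T y))" using z T_mono by simp
    moreover have 1: "T (T y) - T y \<le> exp (3 * V) * J" using up[of y "T y"] T_gt[of y] by (simp add:
        J_def)
    moreover have "T (T (T y)) - T (T y) \<le> exp (3 * V) * (exp (3 * V) * J)"
      using up[of "T y" "T (T y)"] T_gt[of "T y"] 1 by (simp add: mult_left_mono order_trans)
    moreover have "exp (3 * V) * (exp (3 * V) * J) = exp (6 * V) * J"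
      using exp_add[of "3 * V" "3 * V"] by simp
    moreover have "J \<le> exp (6 * V) * J" "exp (3 * V) * J \<le> exp (6 * V) * J" using J V_nonneg by simp_all
    moreover have "T y - y = J" "T z - z = L" "3 * exp (6 * V) * J = 3 * (exp (6 * V) * J)"
      by (simp_all add: J_def L_def)
    ultimately show ?thesis using z(1) by linarith
  qed
  \<comment> \<open>Chosen such that \<open>\<kappa> * exp (6 * V)\<close> does not exceed
    \<open>exp (- V) / L\<close>, a lower bound for the transported density on
    \<open>[z, T z]\<close>. The factor \<open>exp (6 * V)\<close> is reserved for the shifts by
    \<open>T\<close>.\<close>
  define \<kappa> where "\<kappa> = exp (- 13 * V) / (3 * J)"
  have \<kappa>0: "\<kappa> \<ge> 0" using J by (simp add: \<kappa>_def)
  \<comment> \<open>\<open>B\<close> undoes \<open>F^k\<close> and the translation by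
    \<open>m\<close>, so it carries \<open>[z, T z]\<close> back to \<open>[x, T x]\<close>.\<close>
  define B where "B t = zpow F (- int k) (t - of_int m)" for t
  have FB: "(F ^^ k) (B t) = t - of_int m" for t
    using zpow_add[OF bijF, of "int k" "- int k" "t - of_int m"] by (simp add: B_def zpow_def)
  have B_mono: "B s \<le> B t" if "s \<le> t" for s t unfolding B_def using that by (intro zpow_mono) simp
  have B_F: "B ((F ^^ k) t + of_int m) = t" for t
    using zpow_add[OF bijF, of "- int k" "int k" t] by (simp add: B_def zpow_def)
  have Bz: "B z = x" "B (T z) = T x" using B_F[of x] B_F[of "T x"] FkT by (simp_all add: z_def)
  have core: "\<kappa> * exp (6 * V) * (t - s) \<le> \<Lambda>0 (B t) - \<Lambda>0 (B s)" if st: "z \<le> s" "s \<le> t" "t \<le> T z" for s t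
  proof -
    have b: "x \<le> B s" "B s \<le> B t" "B t \<le> T x"
      using B_mono[OF st(1)] B_mono[OF st(2)] B_mono[OF st(3)] Bz by auto
    have "(t - s) / L \<le> exp V * ((B t - B s) / (T x - x))"
      using iterate_distortion[OF d less_imp_le[OF k(1)] b[unfolded T_def]] FkT
      by (simp add: FB L_def z_def Tx diff_diff_eq2 diff_diff_eq add.commute[of "of_int m" "(F ^^ k)
          x"])
    also have "(B t - B s) / (T x - x) = \<Lambda>0 (B t) - \<Lambda>0 (B s)"
      unfolding \<Lambda>0_def using b by (simp add: ramp_affine[OF xT] diff_divide_distrib)
    finally have "exp (- V) * ((t - s) / L) \<le> exp (- V) * (exp V * (\<Lambda>0 (B t) - \<Lambda>0 (B s)))"
      by (intro mult_left_mono) auto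
    then have 1: "exp (- V) * ((t - s) / L) \<le> \<Lambda>0 (B t) - \<Lambda>0 (B s)"
      by (simp only: mult.assoc[symmetric] exp_add[symmetric]) simp
    have "exp (- 13 * V) * exp (6 * V) * exp (6 * V) = exp (- V)"
      by (simp only: exp_add[symmetric]) simp
    then have "\<kappa> * exp (6 * V) = exp (- V) / (3 * exp (6 * V) * J)"
      unfolding \<kappa>_def using J by (simp add: field_simps)
    also have "\<dots> \<le> exp (- V) / L" using L L0 by (intro divide_left_mono) (auto intro: mult_pos_pos J)
    finally have "\<kappa> * exp (6 * V) * (t - s) \<le> exp (- V) / L * (t - s)"
      using st by (intro mult_right_mono) auto
    with 1 show ?thesis by simp
  qed
  \<comment> \<open>The mean of three copies of the transported distribution function; modulo 1
    their masses sit on \<open>[z, T z]\<close> and on its first and second preimages under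
    \<open>T\<close>.\<close>
  define \<Lambda> where "\<Lambda> t = (\<Lambda>0 (B t) + \<Lambda>0 (B (T t)) + \<Lambda>0 (B (T (T t)))) / 3" for t
  have B_deg: "degree_one B"
    unfolding degree_one_def B_def
  proof
    fix x
    show "zpow F (- int k) (x + 1 - of_int m) = zpow F (- int k) (x - of_int m) + 1"
      using zpow_int[of "- int k" "x - of_int m" 1] by (simp add: add_diff_eq diff_add_eq)
  qed
  have T_deg: "degree_one T" using dj.T_lift by (simp add: T circle_lift_def)
  have mB: "\<Lambda>0 (B s) \<le> \<Lambda>0 (B t)" if "s \<le> t" for s t using \<Lambda>0(1) B_mono[OF that] by (simp add: mono_def)
  have \<Lambda>_mono: "mono \<Lambda>"
    unfolding \<Lambda>_def mono_def by (auto intro!: divide_right_mono add_mono mB simp: T_le)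
  have \<Lambda>_deg: "degree_one \<Lambda>"
    using B_deg T_deg \<Lambda>0(2) by (simp add: degree_one_def \<Lambda>_def)
  have incr: "\<Lambda> t - \<Lambda> s = ((\<Lambda>0 (B t) - \<Lambda>0 (B s)) + (\<Lambda>0 (B (T t)) - \<Lambda>0 (B (T s))) + (\<Lambda>0 (B (T (T t)))
      - \<Lambda>0 (B (T (T s))))) / 3" for s t
    by (simp add: \<Lambda>_def diff_divide_distrib add_divide_distrib)
  \<comment> \<open>A lower bound for the slope between \<open>s\<close> and \<open>t\<close>, in a
    form that can be glued by transitivity. On each of the three intervals one summand of
    \<open>\<Lambda>\<close> supplies the slope, while the others are increasing.\<close>
  define S where "S s t \<longleftrightarrow> \<kappa> / 3 * (t - s) \<le> \<Lambda> t - \<Lambda> s" for s t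
  have S_trans: "S s t" if "S s v" "S v t" for s v t
  proof -
    have "\<kappa> / 3 * (v - s) + \<kappa> / 3 * (t - v) = \<kappa> / 3 * (t - s)" unfolding distrib_left[symmetric] by simp
    then show ?thesis using that unfolding S_def by linarith
  qed
  have e6: "1 \<le> exp (6 * V)" "exp (3 * V) \<le> exp (6 * V)" using V_nonneg by simp_all
  have wk: "\<kappa> * u \<le> \<kappa> * exp (6 * V) * v" if "u \<le> exp (6 * V) * v" for u v
    using mult_left_mono[OF that \<kappa>0] by (simp add: mult.assoc)
  have S0: "S s t" if st: "z \<le> s" "s \<le> t" "t \<le> T z" for s t
  proof -
    have "\<kappa> * (t - s) \<le> \<kappa> * exp (6 * V) * (t - s)"
      by (rule wk) (use mult_right_mono[OF e6(1), of "t - s"] st in simp)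
    then show ?thesis
      using core[OF st] mB[of "T s" "T t"] mB[of "T (T s)" "T (T t)"] st
      unfolding S_def incr by (simp add: T_le)
  qed
  have tT: "t - s \<le> exp (3 * V) * (T t - T s)" if "s \<le> t" for s t
    using low[OF that] by (simp add: exp_minus field_simps)
  have S1: "S s t" if st: "z \<le> T s" "s \<le> t" "T t \<le> T z" for s t
  proof -
    have "0 \<le> T t - T s" using st T_le by simp
    then have "t - s \<le> exp (6 * V) * (T t - T s)"
      using tT[OF st(2)] mult_right_mono[OF e6(2), of "T t - T s"] by simp
    then have "\<kappa> * (t - s) \<le> \<kappa> * exp (6 * V) * (T t - T s)" by (rule wk)
    then show ?thesis
      using core[of "T s" "T t"] mB[of "s" "t"] mB[of "T (T s)" "T (T t)"] st
      unfolding S_def incr by (simp add: T_le)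
  qed
  have S2: "S s t" if st: "z \<le> T (T s)" "s \<le> t" "T (T t) \<le> T z" for s t
  proof -
    have "exp (3 * V) * (T t - T s) \<le> exp (3 * V) * (exp (3 * V) * (T (T t) - T (T s)))"
      using tT[of "T s" "T t"] st by (intro mult_left_mono) (auto simp: T_le)
    moreover have "exp (3 * V) * (exp (3 * V) * (T (T t) - T (T s))) = exp (6 * V) * (T (T t) - T (T
        s))"
      by (simp add: mult_exp_exp flip: mult.assoc)
    ultimately have "t - s \<le> exp (6 * V) * (T (T t) - T (T s))" using tT[OF st(2)] by linarith
    then have "\<kappa> * (t - s) \<le> \<kappa> * exp (6 * V) * (T (T t) - T (T s))" by (rule wk)
    then show ?thesis
      using core[of "T (T s)" "T (T t)"] mB[of "s" "t"] mB[of "T s" "T t"] st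
      unfolding S_def incr by (simp add: T_le)
  qed
  \<comment> \<open>The points \<open>u\<close> and \<open>z\<close> cut \<open>[y, T y]\<close>
    into pieces to which \<open>S2\<close>, \<open>S1\<close> and \<open>S0\<close> apply.\<close>
  obtain u where u: "T u = z" using T_bij by (metis bij_is_surj surjD)
  have slope: "S s t" if st: "y \<le> s" "s \<le> t" "t \<le> T y" for s t
  proof -
    have tz: "t \<le> T z" using st(3) z(1) T_le[of y z] by linarith
    have zs: "z \<le> T (T s)" using z(2) st(1) by (meson T_le less_imp_le order_trans)
    have upper: "S s t" if "u \<le> s" "s \<le> t" "t \<le> T z" for s t
    proof -
      have zTs: "z \<le> T s" using that(1) T_le[of u s] u by simp
      consider "t \<le> z" | "z \<le> s" | "s \<le> z" "z \<le> t" by linarith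
      then show ?thesis
      proof cases
        case 1 then show ?thesis using S1[of s t] zTs that by (simp add: T_le)
      next
        case 2 then show ?thesis using S0 that by simp
      next
        case 3
        have "S s z" using S1[of s z] zTs 3 by simp
        moreover have "S z t" using S0[of z t] 3 that by simp
        ultimately show ?thesis by (rule S_trans)
      qed
    qed
    have TTu: "T (T t) \<le> T z" if "t \<le> u" for t using that u T_le by metis
    consider "t \<le> u" | "u \<le> s" | "s \<le> u" "u \<le> t" by linarith
    then show ?thesis
    proof cases
      case 1 then show ?thesis using S2[of s t] zs st TTu by simp
    next
      case 2 then show ?thesis using upper st tz by simp
    next
      case 3
      have "S s u" using S2[of s u] zs 3 TTu by simp
      moreover have "S u t" using upper[of u t] 3 tz by simp
      ultimately show ?thesis by (rule S_trans)
    qed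
  qed
  have "mono (\<lambda>t. \<Lambda> t - \<kappa> / 3 * (T y - y) * ramp y (T y) t)"
    using \<Lambda>_deg slope T_gt[of y] T_lt[of y]
    by (intro mono_minus_ramp[OF \<Lambda>_mono, of 1]) (auto simp: degree_one_def S_def)
  moreover have "\<kappa> / 3 * (T y - y) = c\<^sub>0" unfolding \<kappa>_def J_def[symmetric] c\<^sub>0_def using J by simp
  moreover have "bounded_sums F (\<lambda>t. ramp x (T x) t - \<Lambda> t)"
  proof -
    have B': "B t = zpow F (- int k) t + of_int (- m)" for t
      using zpow_int[of "- int k" t "- m"] by (simp add: B_def)
    \<comment> \<open>Every summand of \<open>\<Lambda>\<close> is \<open>\<Lambda>0\<close>
      composed with an integer iterate of \<open>F\<close>, up to an integer. It therefore differs
      from \<open>\<Lambda>0\<close> by a coboundary and a constant.\<close>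
    have bs: "bounded_sums F (\<lambda>t. \<Lambda>0 t - \<Lambda>0 (zpow F j t + of_int n))" for j n
    proof -
      have "bounded_sums F (\<lambda>t. (\<Lambda>0 t - \<Lambda>0 (zpow F j t)) + (- of_int n))"
      proof (rule bounded_sums_add[OF bounded_sums_coboundary[OF lift \<Lambda>0_var]])
        show "bounded_sums F (\<lambda>t. - of_int n)"
          unfolding bounded_sums_def orbit_sum_def by (intro exI[of _ 0]) (simp add: var_le_const)
      qed
      then show ?thesis by (simp add: degree_one_int[OF \<Lambda>0(2)] diff_diff_eq)
    qed
    have BT: "B (T t) = zpow F (- int k + a) t + of_int (b - m)" for t
      unfolding B' T_def zpow_int zpow_add[OF bijF] by simp
    have BTT: "B (T (T t)) = zpow F (- int k + (a + a)) t + of_int (b + b - m)" for t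
      unfolding BT unfolding T_def zpow_int zpow_add[OF bijF] by simp
    have "bounded_sums F (\<lambda>t. (1 / 3) * ((\<Lambda>0 t - \<Lambda>0 (zpow F (- int k) t + of_int (- m))) +
       (\<Lambda>0 t - \<Lambda>0 (zpow F (- int k + a) t + of_int (b - m))) +
       (\<Lambda>0 t - \<Lambda>0 (zpow F (- int k + (a + a)) t + of_int (b + b - m)))))"
      by (intro bounded_sums_cmult bounded_sums_add bs)
    moreover have eq: "(1 / 3) * ((\<Lambda>0 t - \<Lambda>0 (zpow F (- int k) t + of_int (- m))) +
       (\<Lambda>0 t - \<Lambda>0 (zpow F (- int k + a) t + of_int (b - m))) +
       (\<Lambda>0 t - \<Lambda>0 (zpow F (- int k + (a + a)) t + of_int (b + b - m)))) = ramp x (T x) t - \<Lambda> t" for t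
      unfolding BTT[symmetric] BT[symmetric] B'[symmetric] \<Lambda>_def by (simp add: \<Lambda>0_def field_simps)
    ultimately show ?thesis by (simp only: eq)
  qed
  ultimately show ?thesis using \<Lambda>_mono \<Lambda>_deg by auto
qed

end

section \<open>Contraction of the variation by averaging\<close>

definition average :: "(real \<Rightarrow> real) \<Rightarrow> nat \<Rightarrow> (real \<Rightarrow> real) \<Rightarrow> real \<Rightarrow> real" where
  "average F n u x = orbit_sum F n u x / real n"

lemma var_le_average:
  assumes "circle_lift F" "var_le u V" shows "var_le (average F n u) V"
proof (cases "n = 0")
  case True
  then show ?thesis using var_le_nonneg[OF assms(2)] by (simp add: average_def[abs_def] var_le_const)
next
  case False
  from var_le_cmult[OF var_le_orbit_sum[OF assms, of n], of "1 / real n"] False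
  show ?thesis by (simp add: average_def[abs_def])
qed

lemma periodic_average: "degree_one F \<Longrightarrow> periodic u \<Longrightarrow> periodic (average F n u)"
  using periodic_orbit_sum[of F u n] by (simp add: periodic_def average_def)

context C1_irrational_lift
begin

lemma c\<^sub>0: "0 < c\<^sub>0" "c\<^sub>0 < 1"
proof -
  have "exp (- 13 * V) \<le> 1" using V_nonneg by simp
  then show "0 < c\<^sub>0" "c\<^sub>0 < 1" unfolding c\<^sub>0_def by (simp, linarith)
qed

text \<open>Starting at \<open>s\<close>, Denjoy intervals are cut off one after the other and
  transported to the one at \<open>y\<close>. What remains is part of a single Denjoy interval and
  by \<open>small\<close> at most half of the arc, so at least half of the mass contributes the
  share \<open>c\<^sub>0\<close>.\<close>

lemma transport_ramp:
  assumes d: "denjoy_data \<rho> a b Q" and st: "s < t" "t \<le> s + 1"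
    and small: "\<And>x. zpow F a x + of_int b - x \<le> (t - s) / 2"
  shows "\<exists>\<Lambda>. mono \<Lambda> \<and> degree_one \<Lambda> \<and> bounded_sums F (\<lambda>x. ramp s t x - \<Lambda> x) \<and>
    mono (\<lambda>x. \<Lambda> x - c\<^sub>0 / 2 * ramp y (zpow F a y + of_int b) x)"
proof -
  interpret dj: denjoy F \<rho> a b Q using d by unfold_locales
  define T where "T = dj.T"
  have Tx: "zpow F a x + of_int b = T x" for x by (simp add: T_def dj.T_def)
  note T_gt = dj.T_gt[folded T_def] and T_lt = dj.T_lt[folded T_def]
  define J where "J = ramp y (T y)"
  have J: "mono J" "\<And>x. J (x + 1) = J x + 1"
    unfolding J_def using ramp_mono[of y "T y"] T_gt[of y] T_lt[of y] ramp_degree_one[of y "T y"]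
    by (auto simp: degree_one_def)
  define l where "l = t - s"
  have l: "l > 0" using st by (simp add: l_def)
  \<comment> \<open>After \<open>n\<close> intervals the mass \<open>((T ^^ n) s - s) / l\<close>
    has been replaced by \<open>\<Lambda>\<close>, while the uniform mass on the rest of the arc is
    still in place.\<close>
  have step: "\<exists>\<Lambda>. mono \<Lambda> \<and> (\<forall>x. \<Lambda> (x + 1) = \<Lambda> x + ((T ^^ n) s - s) / l) \<and>
      bounded_sums F (\<lambda>x. ramp s t x - (t - (T ^^ n) s) / l * ramp ((T ^^ n) s) t x - \<Lambda> x) \<and>
      mono (\<lambda>x. \<Lambda> x - c\<^sub>0 * (((T ^^ n) s - s) / l) * J x) \<and> s \<le> (T ^^ n) s"
    if "(T ^^ n) s < t" for n
    using that
  proof (induction n)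
    case 0
    have "(t - s) / l = 1" using l by (simp add: l_def)
    then show ?case using bounded_sums_zero by (intro exI[of _ "\<lambda>x. 0"]) (simp add: mono_def)
  next
    case (Suc n)
    define v where "v = (T ^^ n) s"
    have vT: "v < T v" "T v < t" "T v \<le> v + 1" using T_gt[of v] T_lt[of v] Suc.prems by (simp_all
        add: v_def)
    then have "v < t" by simp
    with Suc.IH obtain \<Lambda> where \<Lambda>: "mono \<Lambda>" "\<And>x. \<Lambda> (x + 1) = \<Lambda> x + (v - s) / l"
      "bounded_sums F (\<lambda>x. ramp s t x - (t - v) / l * ramp v t x - \<Lambda> x)"
      "mono (\<lambda>x. \<Lambda> x - c\<^sub>0 * ((v - s) / l) * J x)" "s \<le> v"
      unfolding v_def by auto
    obtain M where M: "mono M" "degree_one M" "bounded_sums F (\<lambda>x. ramp v (T v) x - M x)"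
      "mono (\<lambda>x. M x - c\<^sub>0 * J x)"
      using transport_interval[OF d, of v y] unfolding Tx J_def by auto
    define w where "w = (T v - v) / l"
    have w: "w \<ge> 0" using vT l by (simp add: w_def)
    have vl: "(T v - s) / l = (v - s) / l + w" unfolding w_def by (simp add:
        add_divide_distrib[symmetric])
    define \<Lambda>' where "\<Lambda>' x = \<Lambda> x + w * M x" for x
    have "t \<le> v + 1" using st \<Lambda>(5) by simp
    from ramp_split[OF vT(1,2) this] have split: "(t - v) / l * ramp v t x = w * ramp v (T v) x + (t
        - T v) / l * ramp (T v) t x" for x
      using vT by (simp add: w_def distrib_left)
    have "mono \<Lambda>'" unfolding \<Lambda>'_def mono_def using \<Lambda>(1) M(1) w by (auto simp: mono_def intro!:
        add_mono mult_left_mono)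
    moreover have "\<Lambda>' (x + 1) = \<Lambda>' x + (T v - s) / l" for x
      using M(2) \<Lambda>(2) by (simp add: \<Lambda>'_def degree_one_def vl distrib_left)
    moreover have "bounded_sums F (\<lambda>x. ramp s t x - (t - T v) / l * ramp (T v) t x - \<Lambda>' x)"
    proof -
      have "bounded_sums F (\<lambda>x. (ramp s t x - (t - v) / l * ramp v t x - \<Lambda> x) + w * (ramp v (T v) x
          - M x))"
        by (intro bounded_sums_add bounded_sums_cmult \<Lambda>(3) M(3))
      moreover have eq: "(ramp s t x - (t - v) / l * ramp v t x - \<Lambda> x) + w * (ramp v (T v) x - M x)
          = ramp s t x - (t - T v) / l * ramp (T v) t x - \<Lambda>' x" for x
        unfolding split \<Lambda>'_def by (simp add: algebra_simps)
      ultimately show ?thesis by (simp only: eq)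
    qed
    moreover have "mono (\<lambda>x. \<Lambda>' x - c\<^sub>0 * ((T v - s) / l) * J x)"
    proof -
      have "mono (\<lambda>x. (\<Lambda> x - c\<^sub>0 * ((v - s) / l) * J x) + w * (M x - c\<^sub>0 * J x))"
        using \<Lambda>(4) M(4) w unfolding mono_def by (intro allI impI add_mono mult_left_mono) auto
      moreover have eq: "(\<Lambda> x - c\<^sub>0 * ((v - s) / l) * J x) + w * (M x - c\<^sub>0 * J x) = \<Lambda>' x - c\<^sub>0 *
          ((T v - s) / l) * J x" for x
        unfolding vl \<Lambda>'_def by (simp add: algebra_simps)
      ultimately show ?thesis by (simp only: eq)
    qed
    moreover have "s \<le> T v" using \<Lambda>(5) vT by simp
    ultimately show ?case unfolding funpow.simps comp_def v_def[symmetric] by blast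
  qed
  have "\<exists>n. \<not> (T ^^ n) s < t"
  proof (rule ccontr)
    assume "\<not> ?thesis"
    then have bd: "(T ^^ n) s < t" for n by blast
    have "incseq (\<lambda>n. (T ^^ n) s)" using T_gt by (intro incseq_SucI) (simp add: less_imp_le)
    then obtain L where L: "(\<lambda>n. (T ^^ n) s) \<longlonglongrightarrow> L"
      using incseq_convergent[of "\<lambda>n. (T ^^ n) s" t] bd by (metis less_imp_le)
    have "isCont T L" using dj.T_lift by (simp add: T_def circle_lift_def
        continuous_on_eq_continuous_at)
    from isCont_tendsto_compose[OF this L] have "(\<lambda>n. (T ^^ Suc n) s) \<longlonglongrightarrow> T L" by simp
    moreover have "(\<lambda>n. (T ^^ Suc n) s) \<longlonglongrightarrow> L" by (rule LIMSEQ_Suc[OF L])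
    ultimately have "T L = L" by (rule LIMSEQ_unique)
    then show False using T_gt[of L] by simp
  qed
  then obtain n where n: "\<not> (T ^^ n) s < t" and least: "\<And>m. m < n \<Longrightarrow> (T ^^ m) s < t"
    using exists_least_iff[of "\<lambda>n. \<not> (T ^^ n) s < t"] by auto
  have "n \<noteq> 0" using n st by (intro notI) simp
  then obtain m where m: "n = Suc m" using not0_implies_Suc by blast
  define v where "v = (T ^^ m) s"
  have v: "v < t" "t \<le> T v" using least[of m] n by (simp_all add: v_def m)
  obtain \<Lambda> where \<Lambda>: "mono \<Lambda>" "\<And>x. \<Lambda> (x + 1) = \<Lambda> x + (v - s) / l"
      "bounded_sums F (\<lambda>x. ramp s t x - (t - v) / l * ramp v t x - \<Lambda> x)"
      "mono (\<lambda>x. \<Lambda> x - c\<^sub>0 * ((v - s) / l) * J x)" "s \<le> v"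
    using step[of m] v(1) unfolding v_def by auto
  define w where "w = (t - v) / l"
  have w: "w \<ge> 0" using v l by (simp add: w_def)
  have vw: "(v - s) / l + w = 1" using l by (simp add: w_def l_def add_divide_distrib[symmetric])
  have "w \<le> 1 / 2" using small[of v] v l unfolding Tx by (simp add: w_def l_def field_simps)
  then have half: "(v - s) / l \<ge> 1 / 2" using vw by linarith
  have tv: "t \<le> v + 1" using v T_lt[of v] by simp
  have R: "mono (ramp v t)" "\<And>x. ramp v t (x + 1) = ramp v t x + 1"
    using ramp_mono[OF v(1) tv] ramp_degree_one by (auto simp: degree_one_def)
  define \<Lambda>' where "\<Lambda>' x = \<Lambda> x + w * ramp v t x" for x
  have "mono \<Lambda>'" unfolding \<Lambda>'_def mono_def using \<Lambda>(1) R(1) w by (auto simp: mono_def intro!: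
      add_mono mult_left_mono)
  moreover have "degree_one \<Lambda>'"
    unfolding degree_one_def \<Lambda>'_def using \<Lambda>(2) R(2) vw by (simp add: distrib_left)
  moreover have "bounded_sums F (\<lambda>x. ramp s t x - \<Lambda>' x)"
    using \<Lambda>(3) by (simp add: \<Lambda>'_def w_def algebra_simps)
  moreover have "mono (\<lambda>x. \<Lambda>' x - c\<^sub>0 / 2 * J x)"
  proof -
    have "0 \<le> c\<^sub>0 * ((v - s) / l - 1 / 2)" using half c\<^sub>0 by simp
    then have "mono (\<lambda>x. (\<Lambda> x - c\<^sub>0 * ((v - s) / l) * J x) + (w * ramp v t x + c\<^sub>0 * ((v - s) / l -
        1 / 2) * J x))"
      using \<Lambda>(4) R(1) J(1) w unfolding mono_def by (intro allI impI add_mono mult_left_mono) auto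
    moreover have eq: "(\<Lambda> x - c\<^sub>0 * ((v - s) / l) * J x) + (w * ramp v t x + c\<^sub>0 * ((v - s) / l - 1
        / 2) * J x)
        = \<Lambda>' x - c\<^sub>0 / 2 * J x" for x
      unfolding \<Lambda>'_def by (simp add: algebra_simps)
    ultimately show ?thesis by (simp only: eq)
  qed
  ultimately show ?thesis unfolding J_def Tx by blast
qed

text \<open>The averages of \<open>w\<close> and \<open>u\<close> differ by a function of bounded
  variation divided by \<open>n\<close>.\<close>

lemma average_decomposition:
  assumes "bounded_sums F (\<lambda>x. w x - u x)" "var_le u C" "\<epsilon> > 0"
  shows "\<exists>N. \<forall>n\<ge>N. var_le (average F n w) (C + \<epsilon>)"
proof -
  obtain K where K: "\<And>n. var_le (orbit_sum F n (\<lambda>x. w x - u x)) K"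
    using assms(1) by (auto simp: bounded_sums_def)
  obtain N :: nat where N: "K / \<epsilon> < real N" using reals_Archimedean2 by blast
  have "var_le (average F n w) (C + \<epsilon>)" if n: "n \<ge> Suc N" for n
  proof -
    have n0: "real n > 0" using n by simp
    have "K / \<epsilon> < real n" using N n by simp
    then have Kn: "K / real n \<le> \<epsilon>" using n0 assms(3) by (simp add: field_simps)
    have "var_le (\<lambda>x. average F n u x + 1 / real n * orbit_sum F n (\<lambda>x. w x - u x) x) (C + \<bar>1 / real
        n\<bar> * K)"
      by (intro var_le_add var_le_average lift assms(2) var_le_cmult K)
    then have "var_le (\<lambda>x. average F n u x + 1 / real n * orbit_sum F n (\<lambda>x. w x - u x) x) (C + \<epsilon>)"
      by (rule var_le_mono) (use Kn in simp)
    moreover have "average F n u x + 1 / real n * orbit_sum F n (\<lambda>x. w x - u x) x = average F n w x"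
        for x
      by (simp add: average_def orbit_sum_def sum_subtractf diff_divide_distrib)
    ultimately show ?thesis by simp
  qed
  then show ?thesis by blast
qed

text \<open>Once the ramps of the approximation have been transported, all of them contain the
  common part \<open>c\<^sub>0 / 2 * J\<close>. Its total weight is 0, so it can be removed, and
  every ramp is left with mass \<open>1 - c\<^sub>0 / 2\<close>.\<close>

lemma average_contraction:
  assumes per: "periodic w" and ac: "abs_continuous_on_interval 0 1 w" and var: "var_le w C" and \<epsilon>:
      "\<epsilon> > 0"
  shows "\<exists>N. \<forall>n\<ge>N. var_le (average F n w) ((1 - c\<^sub>0 / 2) * C + \<epsilon>)"
proof -
  have e3: "\<epsilon> / 3 > 0" using \<epsilon> by simp
  obtain A :: "nat set" and s t \<Delta> where A: "finite A" "\<forall>i\<in>A. s i < t i \<and> t i \<le> s i + 1"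
    and \<Delta>: "(\<Sum>i\<in>A. \<Delta> i) = 0" "(\<Sum>i\<in>A. \<bar>\<Delta> i\<bar>) \<le> C"
    and app: "var_le (\<lambda>x. w x - (\<Sum>i\<in>A. \<Delta> i * ramp (s i) (t i) x)) (\<epsilon> / 3)"
    using abs_continuous_ramp_approximable[OF per ac var e3] unfolding ramp_approximable_def by blast
  \<comment> \<open>Half of the shortest arc, as \<open>transport_ramp\<close> demands; the element
    1 covers an empty \<open>A\<close>.\<close>
  define e where "e = Min (insert 1 ((\<lambda>i. (t i - s i) / 2) ` A))"
  have "e \<in> insert 1 ((\<lambda>i. (t i - s i) / 2) ` A)" unfolding e_def by (intro Min_in) (use A in auto)
  then have e1: "e > 0" using A(2) by auto
  have e2: "e \<le> (t i - s i) / 2" if "i \<in> A" for i unfolding e_def using A(1) that by (intro Min_le) auto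
  note e = e1 e2
  obtain \<eta> where \<eta>: "\<eta> > 0" and small: "\<And>a b Q x. denjoy_data \<rho> a b Q \<Longrightarrow> of_int a * \<rho> + of_int b < \<eta> \<Longrightarrow>
      zpow F a x + of_int b - x < e"
    using small_intervals[OF e(1)] by blast
  obtain a b Q where d: "denjoy_data \<rho> a b Q" and less: "of_int a * \<rho> + of_int b < \<eta>"
    using denjoy_data_exists[OF irr \<eta>] .
  define J where "J = ramp 0 (zpow F a 0 + of_int b)"
  have "\<forall>i\<in>A. \<exists>\<Lambda>. mono \<Lambda> \<and> degree_one \<Lambda> \<and> bounded_sums F (\<lambda>x. ramp (s i) (t i) x - \<Lambda> x) \<and>
    mono (\<lambda>x. \<Lambda> x - c\<^sub>0 / 2 * J x)"
  proof
    fix i assume i: "i \<in> A"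
    show "\<exists>\<Lambda>. mono \<Lambda> \<and> degree_one \<Lambda> \<and> bounded_sums F (\<lambda>x. ramp (s i) (t i) x - \<Lambda> x) \<and>
      mono (\<lambda>x. \<Lambda> x - c\<^sub>0 / 2 * J x)"
      unfolding J_def
      by (rule transport_ramp[OF d]) (use A(2)[rule_format, OF i] less_imp_le[OF less_le_trans[OF
          small[OF d less] e(2)[OF i]]] in auto)
  qed
  from bchoice[OF this] obtain \<Lambda> where "\<forall>i\<in>A. mono (\<Lambda> i) \<and> degree_one (\<Lambda> i) \<and>
    bounded_sums F (\<lambda>x. ramp (s i) (t i) x - \<Lambda> i x) \<and> mono (\<lambda>x. \<Lambda> i x - c\<^sub>0 / 2 * J x)" by blast
  then have \<Lambda>: "degree_one (\<Lambda> i)" "bounded_sums F (\<lambda>x. ramp (s i) (t i) x - \<Lambda> i x)"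
    "mono (\<lambda>x. \<Lambda> i x - c\<^sub>0 / 2 * J x)" if "i \<in> A" for i using that by blast+
  define u where "u x = (\<Sum>i\<in>A. \<Delta> i * (\<Lambda> i x - c\<^sub>0 / 2 * J x))" for x
  have u_eq: "u x = (\<Sum>i\<in>A. \<Delta> i * \<Lambda> i x)" for x
  proof -
    have "u x = (\<Sum>i\<in>A. \<Delta> i * \<Lambda> i x) - (\<Sum>i\<in>A. \<Delta> i) * (c\<^sub>0 / 2 * J x)"
      unfolding u_def sum_distrib_right by (simp add: sum_subtractf right_diff_distrib)
    then show ?thesis by (simp add: \<Delta>)
  qed
  have "var_le u (\<Sum>i\<in>A. \<bar>\<Delta> i\<bar> * (1 - c\<^sub>0 / 2))"
    unfolding u_def
  proof (intro var_le_sum var_le_cmult var_le_mono_fun)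
    fix i x assume i: "i \<in> A"
    show "mono (\<lambda>x. \<Lambda> i x - c\<^sub>0 / 2 * J x)" by (rule \<Lambda>(3)[OF i])
    show "\<Lambda> i (x + 1) - c\<^sub>0 / 2 * J (x + 1) = \<Lambda> i x - c\<^sub>0 / 2 * J x + (1 - c\<^sub>0 / 2)"
      using \<Lambda>(1)[OF i] ramp_degree_one by (simp add: degree_one_def J_def distrib_left)
  qed
  moreover have "(\<Sum>i\<in>A. \<bar>\<Delta> i\<bar> * (1 - c\<^sub>0 / 2)) \<le> (1 - c\<^sub>0 / 2) * C"
    unfolding sum_distrib_right[symmetric] using \<Delta>(2) c\<^sub>0 by (simp add: mult.commute mult_left_mono)
  ultimately have u: "var_le u ((1 - c\<^sub>0 / 2) * C)" by (rule var_le_mono)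
  define w' where "w' x = (\<Sum>i\<in>A. \<Delta> i * ramp (s i) (t i) x)" for x
  have "bounded_sums F (\<lambda>x. \<Sum>i\<in>A. \<Delta> i * (ramp (s i) (t i) x - \<Lambda> i x))"
    by (intro bounded_sums_sum bounded_sums_cmult \<Lambda> A)
  then have "bounded_sums F (\<lambda>x. w' x - u x)"
    by (simp add: w'_def u_eq sum_subtractf right_diff_distrib)
  from average_decomposition[OF this u e3] obtain N where
    N: "\<And>n. n \<ge> N \<Longrightarrow> var_le (average F n w') ((1 - c\<^sub>0 / 2) * C + \<epsilon> / 3)" by blast
  have "var_le (average F n w) ((1 - c\<^sub>0 / 2) * C + \<epsilon>)" if "n \<ge> N" for n
  proof -
    have "var_le (\<lambda>x. average F n w' x + average F n (\<lambda>x. w x - w' x) x) ((1 - c\<^sub>0 / 2) * C + \<epsilon> / 3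
        + \<epsilon> / 3)"
      using app by (intro var_le_add N that var_le_average lift) (simp add: w'_def)
    moreover have eq: "average F n w' x + average F n (\<lambda>x. w x - w' x) x = average F n w x" for x
      by (simp add: average_def orbit_sum_def sum_subtractf diff_divide_distrib)
    ultimately have "var_le (average F n w) ((1 - c\<^sub>0 / 2) * C + \<epsilon> / 3 + \<epsilon> / 3)" by simp
    then show ?thesis by (rule var_le_mono) (use \<epsilon> in simp)
  qed
  then show ?thesis by blast
qed

text \<open>The difference is a mean of the coboundaries \<open>w - w \<circ> F^j\<close>.\<close>

lemma bounded_sums_average:
  assumes "var_le w C" "n > 0"
  shows "bounded_sums F (\<lambda>x. w x - average F n w x)"
proof -
  have "bounded_sums F (\<lambda>x. 1 / real n * (\<Sum>j<n. w x - w ((F ^^ j) x)))"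
    by (intro bounded_sums_cmult bounded_sums_sum bounded_sums_coboundary_nat[OF lift assms(1)]) simp
  moreover have "1 / real n * (\<Sum>j<n. w x - w ((F ^^ j) x)) = w x - average F n w x" for x
    using assms(2) by (simp add: sum_subtractf average_def orbit_sum_def diff_divide_distrib)
  ultimately show ?thesis by simp
qed

text \<open>Let \<open>\<tau>\<close> be the infimum of the variation bounds of averages. If it were
  positive, an almost optimal average could be contracted; as \<open>w\<close> differs from iterated
  averages by bounded sums, some average of \<open>w\<close> would have a bound below
  \<open>\<tau>\<close>. The smallness of one average then passes to all long ones.\<close>

theorem average_variation_tendsto_0:
  assumes per: "periodic w" and ac: "abs_continuous_on_interval 0 1 w" and var: "var_le w C" and \<epsilon>:
      "\<epsilon> > 0"
  shows "\<exists>N. \<forall>n\<ge>N. var_le (average F n w) \<epsilon>"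
proof -
  define S where "S = {B. \<exists>n>0. var_le (average F n w) B}"
  have CS: "C \<in> S" unfolding S_def using var_le_average[OF lift var] by (auto intro: exI[of _ 1])
  have S0: "B \<ge> 0" if "B \<in> S" for B using that var_le_nonneg by (auto simp: S_def)
  then have bdd: "bdd_below S" by (auto simp: bdd_below_def)
  define \<tau> where "\<tau> = Inf S"
  have \<tau>0: "\<tau> \<ge> 0" unfolding \<tau>_def using CS S0 by (intro cInf_greatest) auto
  have "\<tau> = 0"
  proof (rule ccontr)
    assume "\<tau> \<noteq> 0"
    with \<tau>0 have \<tau>: "\<tau> > 0" by simp
    define c where "c = c\<^sub>0 / 2"
    have c: "0 < c" "c < 1" using c\<^sub>0 by (simp_all add: c_def)
    \<comment> \<open>With \<open>B\<close> below \<open>\<tau> + c * \<tau> / 2\<close> and two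
      errors \<open>c * \<tau> / 8\<close>, the contracted bound stays below
      \<open>\<tau> - c * \<tau> / 4\<close>.\<close>
    have "\<tau> < \<tau> + c * \<tau> / 2" using \<tau> c by simp
    then obtain B where B: "B \<in> S" "B < \<tau> + c * \<tau> / 2"
      unfolding \<tau>_def using cInf_lessD[of S] CS by blast
    from B(1) obtain n where n: "n > 0" "var_le (average F n w) B" by (auto simp: S_def)
    let ?u = "average F n w"
    have deg: "degree_one F" using lift by (simp add: circle_lift_def)
    have u: "periodic ?u" by (rule periodic_average[OF deg per])
    have uac: "abs_continuous_on_interval 0 1 ?u"
      using abs_continuous_cmult[OF abs_continuous_orbit_sum[OF per ac C1], of "1 / real n" n]
      by (simp add: average_def[abs_def])
    have e: "c * \<tau> / 8 > 0" using c \<tau> by simp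
    obtain N where N: "\<And>m. m \<ge> N \<Longrightarrow> var_le (average F m ?u) ((1 - c) * B + c * \<tau> / 8)"
      using average_contraction[OF u uac n(2) e] unfolding c_def by blast
    define m where "m = Suc N"
    have m: "m > 0" "var_le (average F m ?u) ((1 - c) * B + c * \<tau> / 8)" using N by (simp_all add: m_def)
    have "bounded_sums F (\<lambda>x. (w x - ?u x) + (?u x - average F m ?u x))"
      by (intro bounded_sums_add bounded_sums_average[OF var n(1)] bounded_sums_average[OF n(2) m(1)])
    then have "bounded_sums F (\<lambda>x. w x - average F m ?u x)" by simp
    from average_decomposition[OF this m(2) e] obtain N' where
      N': "\<And>k. k \<ge> N' \<Longrightarrow> var_le (average F k w) ((1 - c) * B + c * \<tau> / 8 + c * \<tau> / 8)" by blast
    have "(1 - c) * B + c * \<tau> / 8 + c * \<tau> / 8 \<in> S"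
      unfolding S_def using N'[of "Suc N'"] by auto
    then have "\<tau> \<le> (1 - c) * B + c * \<tau> / 8 + c * \<tau> / 8" unfolding \<tau>_def by (rule cInf_lower[OF _ bdd])
    also have "(1 - c) * B \<le> (1 - c) * (\<tau> + c * \<tau> / 2)" using B(2) c by (intro mult_left_mono) auto
    also have "(1 - c) * (\<tau> + c * \<tau> / 2) = \<tau> - c * \<tau> / 2 - c * c * \<tau> / 2" by (simp add: field_simps)
    finally have "\<tau> \<le> \<tau> - c * \<tau> / 4 - c * c * \<tau> / 2" by linarith
    moreover have "c * \<tau> > 0" "c * c * \<tau> > 0" using c \<tau> by simp_all
    ultimately show False by linarith
  qed
  then have "Inf S < \<epsilon> / 2" using \<epsilon> by (simp add: \<tau>_def)
  then obtain B where "B \<in> S" "B < \<epsilon> / 2" using cInf_lessD[of S] CS by blast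
  then obtain n where n: "n > 0" "var_le (average F n w) (\<epsilon> / 2)"
    unfolding S_def using var_le_mono less_imp_le by blast
  have "\<exists>N. \<forall>k\<ge>N. var_le (average F k w) (\<epsilon> / 2 + \<epsilon> / 2)"
    by (rule average_decomposition[OF bounded_sums_average[OF var n(1)] n(2)]) (use \<epsilon> in simp)
  then show ?thesis by simp
qed

end

section \<open>A fixed point theorem for operators on maps of the unit interval\<close>

text \<open>Kuhn's combinatorial lemma on a grid finer than the modulus of continuity: in a cell
  where both labels occur for every coordinate, \<open>T\<close> moves no coordinate much. Vectors
  are functions, so that the dimension \<open>n\<close> is an ordinary variable.\<close>

lemma approximate_fixpoint_cube:
  fixes T :: "(nat \<Rightarrow> real) \<Rightarrow> nat \<Rightarrow> real" and n :: nat
  defines "cube \<equiv> {x. \<forall>i<n. 0 \<le> x i \<and> x i \<le> 1}"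
  assumes self: "\<And>x. x \<in> cube \<Longrightarrow> T x \<in> cube"
    and cont: "\<And>\<epsilon>. \<epsilon> > 0 \<Longrightarrow> \<exists>\<delta>>0. \<forall>x\<in>cube. \<forall>y\<in>cube. (\<forall>i<n. \<bar>x i - y i\<bar> \<le> \<delta>) \<longrightarrow> (\<forall>i<n. \<bar>T x i - T y i\<bar>
        \<le> \<epsilon>)"
    and \<epsilon>: "\<epsilon> > 0"
  shows "\<exists>x\<in>cube. \<forall>i<n. \<bar>T x i - x i\<bar> \<le> \<epsilon>"
proof -
  have e2: "\<epsilon> / 2 > 0" using \<epsilon> by simp
  obtain \<delta> where \<delta>: "\<delta> > 0" and unif: "\<And>x y i. x \<in> cube \<Longrightarrow> y \<in> cube \<Longrightarrow> (\<And>i. i < n \<Longrightarrow> \<bar>x i - y i\<bar> \<le> \<delta>) \<Longrightarrow>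
      i < n \<Longrightarrow> \<bar>T x i - T y i\<bar> \<le> \<epsilon> / 2"
    using cont[OF e2] by blast
  obtain p :: nat where p: "p > 0" "1 / real p < min \<delta> (\<epsilon> / 2)"
    using reals_Archimedean[of "min \<delta> (\<epsilon> / 2)"] \<delta> \<epsilon> by (metis inverse_eq_divide zero_less_Suc
        min_less_iff_conj half_gt_zero)
  define sc where "sc q i = real (q i) / real p" for q :: "nat \<Rightarrow> nat" and i :: nat
  \<comment> \<open>Label 0 says that \<open>T\<close> does not decrease the coordinate. On the face
    \<open>q i = p\<close>, where \<open>T\<close> cannot increase it, label 1 is forced as
    \<open>kuhn_lemma\<close> demands.\<close>
  define label where "label q i = (if sc q i \<le> T (sc q) i \<and> q i \<noteq> p then 0 else (1::nat))" for q i
  have sc: "sc q \<in> cube" if "\<forall>i<n. q i \<le> p" for q using that p(1) by (auto simp: cube_def sc_def)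
  obtain q where q: "\<forall>i<n. q i < p"
    and lab: "\<forall>i<n. \<exists>r s. (\<forall>j<n. q j \<le> r j \<and> r j \<le> q j + 1) \<and> (\<forall>j<n. q j \<le> s j \<and> s j \<le> q j + 1) \<and>
        label r i \<noteq> label s i"
  proof (rule kuhn_lemma[OF p(1), of n label])
    show "\<forall>x. (\<forall>i<n. x i \<le> p) \<longrightarrow> (\<forall>i<n. label x i = 0 \<or> label x i = 1)" by (simp add: label_def)
    show "\<forall>x. (\<forall>i<n. x i \<le> p) \<longrightarrow> (\<forall>i<n. x i = 0 \<longrightarrow> label x i = 0)"
      using self[OF sc] p(1) by (auto simp: label_def cube_def sc_def)
    show "\<forall>x. (\<forall>i<n. x i \<le> p) \<longrightarrow> (\<forall>i<n. x i = p \<longrightarrow> label x i = 1)" by (simp add: label_def)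
  qed
  have near: "\<bar>T (sc q) i - T (sc r) i\<bar> \<le> \<epsilon> / 2" "\<bar>sc q i - sc r i\<bar> \<le> 1 / real p" "sc q i \<le> sc r i"
      "\<forall>i<n. r i \<le> p"
    if r: "\<forall>j<n. q j \<le> r j \<and> r j \<le> q j + 1" and i: "i < n" for r i
  proof -
    show rp: "\<forall>i<n. r i \<le> p" using r q by fastforce
    have *: "\<bar>sc q j - sc r j\<bar> \<le> 1 / real p \<and> sc q j \<le> sc r j" if "j < n" for j
    proof -
      have "q j \<le> r j" "r j \<le> q j + 1" using r that by auto
      then have "real (q j) \<le> real (r j)" "real (r j) \<le> real (q j) + 1" by linarith+
      then show ?thesis using p(1) by (auto simp: sc_def abs_le_iff diff_divide_distrib[symmetric]
          divide_right_mono)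
    qed
    from *[OF i] show "\<bar>sc q i - sc r i\<bar> \<le> 1 / real p" "sc q i \<le> sc r i" by blast+
    show "\<bar>T (sc q) i - T (sc r) i\<bar> \<le> \<epsilon> / 2"
    proof (rule unif[OF sc sc])
      fix j assume "j < n"
      then show "\<bar>sc q j - sc r j\<bar> \<le> \<delta>" using *[of j] p(2) by linarith
    qed (use q rp i less_imp_le in auto)
  qed
  have "\<bar>T (sc q) i - sc q i\<bar> \<le> \<epsilon>" if i: "i < n" for i
  proof -
    from lab i obtain r s where "\<forall>j<n. q j \<le> r j \<and> r j \<le> q j + 1" "\<forall>j<n. q j \<le> s j \<and> s j \<le> q j + 1"
        "label r i \<noteq> label s i"
      by blast
    then obtain r s where r: "\<forall>j<n. q j \<le> r j \<and> r j \<le> q j + 1" and s: "\<forall>j<n. q j \<le> s j \<and> s j \<le> q j + 1"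
      and l: "label r i = 0" "label s i = 1"
      unfolding label_def by (metis zero_neq_one)
    have "sc r i \<le> T (sc r) i" using l(1) by (auto simp: label_def split: if_splits)
    moreover have "T (sc s) i \<le> sc s i"
    proof (cases "s i = p")
      case True
      then have "sc s i = 1" using p(1) by (simp add: sc_def)
      then show ?thesis using self[OF sc[OF near(4)[OF s i]]] i by (simp add: cube_def)
    next
      case False
      then show ?thesis using l(2) by (auto simp: label_def split: if_splits)
    qed
    ultimately show ?thesis using near(1-3)[OF r i] near(1-3)[OF s i] p(2) by linarith
  qed
  then show ?thesis using sc q less_imp_le by blast
qed

text \<open>The tent function of node \<open>i\<close> in the grid of mesh \<open>1 / m\<close>. On
  the unit interval these functions form a partition of unity (\<open>sum_hat\<close>).\<close>

definition hat :: "nat \<Rightarrow> nat \<Rightarrow> real \<Rightarrow> real" where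
  "hat m i t = max 0 (1 - \<bar>real m * t - real i\<bar>)"

lemma hat_nonneg: "0 \<le> hat m i t" by (simp add: hat_def)

text \<open>The second claim concerns the gap after node \<open>n\<close>, where the next tent is
  still missing; it supplies the induction step of the first.\<close>

lemma sum_hat_aux:
  fixes s :: real
  shows "0 \<le> s \<Longrightarrow> s \<le> real n \<Longrightarrow> (\<Sum>i\<le>n. max 0 (1 - \<bar>s - real i\<bar>)) = 1"
    and "real n \<le> s \<Longrightarrow> s \<le> real n + 1 \<Longrightarrow> (\<Sum>i\<le>n. max 0 (1 - \<bar>s - real i\<bar>)) = 1 - (s - real n)"
proof -
  have 2: "(\<Sum>i\<le>n. max 0 (1 - \<bar>s - real i\<bar>)) = 1 - (s - real n)" if "real n \<le> s" "s \<le> real n + 1" for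
      n and s :: real
  proof -
    have "(\<Sum>i<n. max 0 (1 - \<bar>s - real i\<bar>)) = 0"
    proof (intro sum.neutral ballI)
      fix i assume "i \<in> {..<n}"
      then have "real i + 1 \<le> s" using that by simp
      then show "max 0 (1 - \<bar>s - real i\<bar>) = 0" by simp
    qed
    then show ?thesis using that by (simp add: lessThan_Suc_atMost[symmetric])
  qed
  then show "real n \<le> s \<Longrightarrow> s \<le> real n + 1 \<Longrightarrow> (\<Sum>i\<le>n. max 0 (1 - \<bar>s - real i\<bar>)) = 1 - (s - real n)" .
  show "0 \<le> s \<Longrightarrow> s \<le> real n \<Longrightarrow> (\<Sum>i\<le>n. max 0 (1 - \<bar>s - real i\<bar>)) = 1"
  proof (induction n)
    case (Suc n)
    then show ?case
    proof (cases "s \<le> real n")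
      case False
      then have "(\<Sum>i\<le>n. max 0 (1 - \<bar>s - real i\<bar>)) = 1 - (s - real n)" using Suc.prems by (intro 2) auto
      then show ?thesis using Suc.prems False by simp
    qed simp
  qed simp
qed

lemma sum_hat: "0 \<le> t \<Longrightarrow> t \<le> 1 \<Longrightarrow> (\<Sum>i\<le>m. hat m i t) = 1"
  unfolding hat_def by (rule sum_hat_aux(1)) (auto intro: mult_left_le)

text \<open>The sum is a weighted mean of the \<open>a i\<close> with positive weights only at nodes
  near \<open>t\<close>.\<close>

lemma sum_hat_deviation:
  fixes a :: "nat \<Rightarrow> real"
  assumes t: "0 \<le> t" "t \<le> 1" and m: "m > 0"
    and a: "\<And>i. i \<le> m \<Longrightarrow> \<bar>t - real i / real m\<bar> \<le> 1 / real m \<Longrightarrow> \<bar>a i - c\<bar> \<le> \<epsilon>"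
  shows "\<bar>(\<Sum>i\<le>m. a i * hat m i t) - c\<bar> \<le> \<epsilon>"
proof -
  have "(\<Sum>i\<le>m. a i * hat m i t) - c = (\<Sum>i\<le>m. (a i - c) * hat m i t)"
    using sum_hat[OF t, of m] by (simp add: left_diff_distrib sum_subtractf flip: sum_distrib_left)
  also have "\<bar>\<dots>\<bar> \<le> (\<Sum>i\<le>m. \<epsilon> * hat m i t)"
  proof (rule order_trans[OF sum_abs], intro sum_mono)
    fix i assume i: "i \<in> {..m}"
    show "\<bar>(a i - c) * hat m i t\<bar> \<le> \<epsilon> * hat m i t"
    proof (cases "hat m i t = 0")
      case False
      then have "\<bar>real m * t - real i\<bar> \<le> 1" by (auto simp: hat_def max_def split: if_splits)
      moreover have "real m * t - real i = real m * (t - real i / real m)" using m by (simp add: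
          field_simps)
      ultimately have "\<bar>t - real i / real m\<bar> \<le> 1 / real m" using m by (simp add: abs_mult field_simps)
      then have "\<bar>a i - c\<bar> \<le> \<epsilon>" using a i by simp
      then show ?thesis using hat_nonneg[of m i t] by (simp add: abs_mult mult_right_mono)
    qed simp
  qed
  also have "\<dots> = \<epsilon>" using sum_hat[OF t, of m] by (simp flip: sum_distrib_left)
  finally show ?thesis .
qed

lemma hat_node: "m > 0 \<Longrightarrow> hat m i (real j / real m) = (if i = j then 1 else 0)"
proof -
  assume "m > 0"
  then have "hat m i (real j / real m) = max 0 (1 - \<bar>real j - real i\<bar>)" by (simp add: hat_def)
  moreover have "\<bar>real j - real i\<bar> \<ge> 1" if "i \<noteq> j" using that by linarith
  ultimately show ?thesis by (auto simp: max_def)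
qed

definition unit_maps :: "(real \<Rightarrow> real) set" where
  "unit_maps = {h. continuous_on {0..1} h \<and> h 0 = 0 \<and> h 1 = 1 \<and> (\<forall>t\<in>{0..1}. 0 \<le> h t \<and> h t \<le> 1)}"

text \<open>Piecewise linear interpolation at the nodes turns \<open>T\<close> into a map of a cube.
  Between nodes the error is controlled by the Lipschitz constant, which all images
  \<open>T h\<close> share.\<close>

lemma approximate_fixpoint_unit_maps:
  fixes T :: "(real \<Rightarrow> real) \<Rightarrow> real \<Rightarrow> real"
  assumes self: "\<And>h. h \<in> unit_maps \<Longrightarrow> T h \<in> unit_maps"
    and lip: "\<And>h s t. h \<in> unit_maps \<Longrightarrow> s \<in> {0..1} \<Longrightarrow> t \<in> {0..1} \<Longrightarrow> \<bar>T h s - T h t\<bar> \<le> L * \<bar>s - t\<bar>"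
    and cont: "\<And>\<epsilon>. \<epsilon> > 0 \<Longrightarrow> \<exists>\<delta>>0. \<forall>h\<in>unit_maps. \<forall>k\<in>unit_maps.
        (\<forall>t\<in>{0..1}. \<bar>h t - k t\<bar> \<le> \<delta>) \<longrightarrow> (\<forall>t\<in>{0..1}. \<bar>T h t - T k t\<bar> \<le> \<epsilon>)"
    and \<epsilon>: "\<epsilon> > 0"
  shows "\<exists>h\<in>unit_maps. \<forall>t\<in>{0..1}. \<bar>T h t - h t\<bar> \<le> \<epsilon>"
proof -
  obtain m0 :: nat where m0: "2 * \<bar>L\<bar> / \<epsilon> < real m0" using reals_Archimedean2 by blast
  define m where "m = Suc m0"
  have m: "m > 0" "\<bar>L\<bar> / real m \<le> \<epsilon> / 2"
  proof -
    have "2 * \<bar>L\<bar> / \<epsilon> < real m" using m0 by (simp add: m_def)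
    then show "m > 0" "\<bar>L\<bar> / real m \<le> \<epsilon> / 2" using \<epsilon> by (auto simp: m_def field_simps)
  qed
  \<comment> \<open>The values at the two end nodes are overridden, so that every point of the cube
    yields a member of \<open>unit_maps\<close>.\<close>
  define X where "X x i = (if i = 0 then 0 else if i \<ge> m then 1 else x i)" for x :: "nat \<Rightarrow> real" and i
  define h where "h x t = (\<Sum>i\<le>m. X x i * hat m i t)" for x t
  define cube where "cube = {x. \<forall>i<m. 0 \<le> x i \<and> x i \<le> (1::real)}"
  have X: "0 \<le> X x i" "X x i \<le> 1" if "x \<in> cube" for x i using that by (auto simp: X_def cube_def)
  have node: "h x (real j / real m) = X x j" if "j \<le> m" for x j
    unfolding h_def hat_node[OF m(1)] using that by (simp add: if_distrib cong: if_cong)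
  have h: "h x \<in> unit_maps" if x: "x \<in> cube" for x
  proof -
    have "continuous_on {0..1} (h x)" unfolding h_def hat_def by (intro continuous_intros)
    moreover have "h x 0 = 0" using node[of 0 x] by (simp add: X_def)
    moreover have "h x 1 = 1" using node[of m x] m by (simp add: X_def)
    moreover have "0 \<le> h x t \<and> h x t \<le> 1" if "t \<in> {0..1}" for t
    proof
      show "0 \<le> h x t" unfolding h_def using X[OF x] hat_nonneg by (intro sum_nonneg
          mult_nonneg_nonneg) auto
      have "h x t \<le> (\<Sum>i\<le>m. 1 * hat m i t)" unfolding h_def using X[OF x] hat_nonneg by (intro
          sum_mono mult_right_mono) auto
      also have "\<dots> = 1" using sum_hat that by simp
      finally show "h x t \<le> 1" .
    qed
    ultimately show ?thesis by (simp add: unit_maps_def)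
  qed
  define T' where "T' x i = T (h x) (real i / real m)" for x i
  have nodes01: "real i / real m \<in> {0..1}" if "i \<le> m" for i using that m by simp
  have "\<exists>x\<in>cube. \<forall>i<m. \<bar>T' x i - x i\<bar> \<le> \<epsilon> / 2"
    unfolding cube_def
  proof (rule approximate_fixpoint_cube, fold cube_def)
    fix x assume "x \<in> cube"
    then show "T' x \<in> cube" using self[OF h] nodes01 by (auto simp: cube_def T'_def unit_maps_def)
  next
    fix \<epsilon> :: real assume "\<epsilon> > 0"
    from cont[OF this] obtain \<delta> where \<delta>: "\<delta> > 0" and unif: "\<forall>h\<in>unit_maps. \<forall>k\<in>unit_maps.
        (\<forall>t\<in>{0..1}. \<bar>h t - k t\<bar> \<le> \<delta>) \<longrightarrow> (\<forall>t\<in>{0..1}. \<bar>T h t - T k t\<bar> \<le> \<epsilon>)" by blast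
    show "\<exists>\<delta>>0. \<forall>x\<in>cube. \<forall>y\<in>cube. (\<forall>i<m. \<bar>x i - y i\<bar> \<le> \<delta>) \<longrightarrow> (\<forall>i<m. \<bar>T' x i - T' y i\<bar> \<le> \<epsilon>)"
    proof (intro exI[of _ \<delta>] conjI ballI impI allI \<delta>)
      fix x y i assume xy: "x \<in> cube" "y \<in> cube" "\<forall>i<m. \<bar>x i - y i\<bar> \<le> \<delta>" and i: "i < m"
      have "\<bar>h x t - h y t\<bar> \<le> \<delta>" if "t \<in> {0..1}" for t
      proof -
        have "\<bar>(\<Sum>i\<le>m. (X x i - X y i) * hat m i t) - 0\<bar> \<le> \<delta>"
          using that m xy(3) \<delta> by (intro sum_hat_deviation) (auto simp: X_def)
        then show ?thesis by (simp add: h_def left_diff_distrib sum_subtractf)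
      qed
      then show "\<bar>T' x i - T' y i\<bar> \<le> \<epsilon>"
        unfolding T'_def using unif h[OF xy(1)] h[OF xy(2)] nodes01[of i] i by auto
    qed
  qed (use \<epsilon> in simp)
  then obtain x where x: "x \<in> cube" "\<And>i. i < m \<Longrightarrow> \<bar>T' x i - x i\<bar> \<le> \<epsilon> / 2" by blast
  have Th: "T (h x) \<in> unit_maps" by (rule self[OF h[OF x(1)]])
  have close: "\<bar>X x i - T (h x) (real i / real m)\<bar> \<le> \<epsilon> / 2" if i: "i \<le> m" for i
  proof -
    consider "i = 0" | "i = m" | "0 < i" "i < m" using i by linarith
    then show ?thesis
    proof cases
      case 1
      then show ?thesis using Th \<epsilon> by (simp add: X_def unit_maps_def)
    next
      case 2
      then show ?thesis using Th \<epsilon> m by (simp add: X_def unit_maps_def)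
    next
      case 3
      then show ?thesis using x(2)[of i] by (simp add: X_def T'_def abs_minus_commute)
    qed
  qed
  have "\<bar>T (h x) t - h x t\<bar> \<le> \<epsilon>" if t: "t \<in> {0..1}" for t
  proof -
    have "\<bar>(\<Sum>i\<le>m. X x i * hat m i t) - T (h x) t\<bar> \<le> \<epsilon>"
    proof (rule sum_hat_deviation[OF _ _ m(1)])
      fix i assume i: "i \<le> m" "\<bar>t - real i / real m\<bar> \<le> 1 / real m"
      have "\<bar>T (h x) (real i / real m) - T (h x) t\<bar> \<le> L * \<bar>real i / real m - t\<bar>"
        by (rule lip[OF h[OF x(1)] nodes01[OF i(1)] t])
      also have "\<dots> \<le> \<bar>L\<bar> * (1 / real m)" using i(2) by (intro mult_mono) (auto simp: abs_minus_commute)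
      also have "\<dots> \<le> \<epsilon> / 2" using m by simp
      finally show "\<bar>X x i - T (h x) t\<bar> \<le> \<epsilon>" using close[OF i(1)] by linarith
    qed (use t in auto)
    then show ?thesis by (simp add: h_def abs_minus_commute)
  qed
  then show ?thesis using h[OF x(1)] by blast
qed

text \<open>The images of approximate fixed points share a Lipschitz constant. By Arzela-Ascoli a
  subsequence converges uniformly, the approximate fixed points follow it, and continuity of
  \<open>T\<close> makes the limit a fixed point.\<close>

theorem fixpoint_unit_maps:
  fixes T :: "(real \<Rightarrow> real) \<Rightarrow> real \<Rightarrow> real"
  assumes self: "\<And>h. h \<in> unit_maps \<Longrightarrow> T h \<in> unit_maps"
    and lip: "\<And>h s t. h \<in> unit_maps \<Longrightarrow> s \<in> {0..1} \<Longrightarrow> t \<in> {0..1} \<Longrightarrow> \<bar>T h s - T h t\<bar> \<le> L * \<bar>s - t\<bar>"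
    and cont: "\<And>\<epsilon>. \<epsilon> > 0 \<Longrightarrow> \<exists>\<delta>>0. \<forall>h\<in>unit_maps. \<forall>k\<in>unit_maps.
        (\<forall>t\<in>{0..1}. \<bar>h t - k t\<bar> \<le> \<delta>) \<longrightarrow> (\<forall>t\<in>{0..1}. \<bar>T h t - T k t\<bar> \<le> \<epsilon>)"
  obtains h where "h \<in> unit_maps" "\<And>t. t \<in> {0..1} \<Longrightarrow> T h t = h t"
proof -
  have "\<exists>h\<in>unit_maps. \<forall>t\<in>{0..1}. \<bar>T h t - h t\<bar> \<le> 1 / real (Suc n)" for n
    by (rule approximate_fixpoint_unit_maps[OF self lip cont]) auto
  then obtain h where h: "\<And>n. h n \<in> unit_maps" "\<And>n t. t \<in> {0..1} \<Longrightarrow> \<bar>T (h n) t - h n t\<bar> \<le> 1 / real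
      (Suc n)"
    by metis
  have Th: "T (h n) \<in> unit_maps" for n by (rule self[OF h(1)])
  obtain g k where g: "continuous_on {0..1} g" and k: "strict_mono (k :: nat \<Rightarrow> nat)"
    and lim: "\<And>e. 0 < e \<Longrightarrow> \<exists>N. \<forall>n x. n \<ge> N \<and> x \<in> {0..1} \<longrightarrow> norm (T (h (k n)) x - g x) < e"
  proof (rule Arzela_Ascoli[of "{0..1}" "\<lambda>n. T (h n)" 1])
    show "norm (T (h n) x) \<le> 1" if "x \<in> {0..1}" for n x using Th[of n] that by (auto simp:
        unit_maps_def)
    fix x e :: real assume x: "x \<in> {0..1}" and e: "0 < e"
    show "\<exists>d>0. \<forall>n y. y \<in> {0..1} \<and> norm (x - y) < d \<longrightarrow> norm (T (h n) x - T (h n) y) < e"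
    proof (intro exI[of _ "e / (\<bar>L\<bar> + 1)"] conjI allI impI)
      fix n y assume y: "y \<in> {0..1} \<and> norm (x - y) < e / (\<bar>L\<bar> + 1)"
      have "\<bar>T (h n) x - T (h n) y\<bar> \<le> L * \<bar>x - y\<bar>" using lip[OF h(1) x, of y] y by blast
      also have "\<dots> \<le> (\<bar>L\<bar> + 1) * \<bar>x - y\<bar>" by (intro mult_right_mono) auto
      also have "\<dots> < e" using y by (simp add: pos_less_divide_eq mult.commute add_nonneg_pos)
      finally show "norm (T (h n) x - T (h n) y) < e" by simp
    qed (use e in \<open>simp add: add_nonneg_pos\<close>)
  qed auto
  have inv0: "(\<lambda>n. 1 / real (Suc n)) \<longlonglongrightarrow> 0" by (rule LIMSEQ_Suc[OF lim_1_over_n])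
  have small: "\<exists>N. \<forall>n\<ge>N. 1 / real (Suc n) < e" if "e > 0" for e
    using order_tendstoD(2)[OF inv0 that] by (simp add: eventually_sequentially)
  have ptw: "(\<lambda>n. T (h (k n)) t) \<longlonglongrightarrow> g t" if "t \<in> {0..1}" for t
    unfolding LIMSEQ_def dist_norm using lim that by meson
  have gm: "g \<in> unit_maps"
  proof -
    have "g 0 = 0" using ptw[of 0] Th by (simp add: unit_maps_def LIMSEQ_const_iff)
    moreover have "g 1 = 1" using ptw[of 1] Th by (simp add: unit_maps_def LIMSEQ_const_iff)
    moreover have "0 \<le> g t" "g t \<le> 1" if "t \<in> {0..1}" for t
      using LIMSEQ_le_const[OF ptw[OF that], of 0] LIMSEQ_le_const2[OF ptw[OF that], of 1] Th that
          by (auto simp: unit_maps_def)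
    ultimately show ?thesis using g by (simp add: unit_maps_def)
  qed
  have "T g t = g t" if t: "t \<in> {0..1}" for t
  proof -
    have "\<bar>T g t - g t\<bar> \<le> 0 + e" if e: "e > 0" for e
    proof -
      have e2: "e / 2 > 0" using e by simp
      obtain \<delta> where \<delta>: "\<delta> > 0" and unif: "\<forall>h\<in>unit_maps. \<forall>k\<in>unit_maps.
        (\<forall>t\<in>{0..1}. \<bar>h t - k t\<bar> \<le> \<delta>) \<longrightarrow> (\<forall>t\<in>{0..1}. \<bar>T h t - T k t\<bar> \<le> e / 2)" using cont[OF e2] by blast
      define e' where "e' = min (e / 2) (\<delta> / 2)"
      have "e' > 0" "\<delta> / 2 > 0" using e \<delta> by (simp_all add: e'_def)
      obtain N where N: "\<And>n x. n \<ge> N \<Longrightarrow> x \<in> {0..1} \<Longrightarrow> norm (T (h (k n)) x - g x) < e'"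
        using lim[OF \<open>e' > 0\<close>] by blast
      obtain M where M: "\<And>n. n \<ge> M \<Longrightarrow> 1 / real (Suc n) < \<delta> / 2" using small[OF \<open>\<delta> / 2 > 0\<close>] by blast
      define n where "n = max N M"
      have kn: "k n \<ge> M" using seq_suble[OF k, of n] by (simp add: n_def)
      have "\<bar>g x - h (k n) x\<bar> \<le> \<delta>" if x: "x \<in> {0..1}" for x
      proof -
        have "\<bar>T (h (k n)) x - g x\<bar> < \<delta> / 2" using N[of n x] x by (simp add: n_def e'_def)
        moreover have "\<bar>T (h (k n)) x - h (k n) x\<bar> \<le> \<delta> / 2" using h(2)[OF x, of "k n"] M[OF kn] by
            linarith
        ultimately show ?thesis by linarith
      qed
      then have "\<bar>T g t - T (h (k n)) t\<bar> \<le> e / 2" using unif gm h(1) t by blast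
      moreover have "\<bar>T (h (k n)) t - g t\<bar> < e / 2" using N[of n t] t by (simp add: n_def e'_def)
      ultimately show ?thesis by linarith
    qed
    then have "\<bar>T g t - g t\<bar> \<le> 0" by (rule field_le_epsilon)
    then show ?thesis by simp
  qed
  then show thesis using that gm by blast
qed

section \<open>Approximate conjugacies with prescribed derivative\<close>

lemma antiderivative_exists:
  fixes p :: "real \<Rightarrow> real"
  assumes "continuous_on UNIV p"
  shows "\<exists>P. \<forall>x. (P has_real_derivative p x) (at x)"
  using einterval_antiderivative[of "-\<infinity>" "\<infinity>" p] assms
  by (simp add: continuous_on_eq_continuous_at has_real_derivative_iff_has_vector_derivative)

lemma increments_le:
  fixes P R :: "real \<Rightarrow> real"
  assumes "\<And>x. (P has_real_derivative p x) (at x)" "\<And>x. (R has_real_derivative r x) (at x)"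
    and "s \<le> t" "\<And>x. s \<le> x \<Longrightarrow> x \<le> t \<Longrightarrow> p x \<le> c * r x"
  shows "P t - P s \<le> c * (R t - R s)"
proof -
  have "(\<lambda>x. c * R x - P x) s \<le> (\<lambda>x. c * R x - P x) t"
  proof (rule DERIV_nonneg_imp_nondecreasing[OF \<open>s \<le> t\<close>])
    fix x assume "s \<le> x" "x \<le> t"
    then show "\<exists>y. ((\<lambda>x. c * R x - P x) has_real_derivative y) (at x) \<and> 0 \<le> y"
      using assms by (intro exI[of _ "c * r x - p x"]) (auto intro!: derivative_eq_intros)
  qed
  then show ?thesis by (simp add: algebra_simps)
qed

definition extend :: "(real \<Rightarrow> real) \<Rightarrow> real \<Rightarrow> real" where
  "extend h t = of_int \<lfloor>t\<rfloor> + h (frac t)"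

lemma degree_one_extend: "degree_one (extend h)"
  by (simp add: degree_one_def extend_def frac_def)

lemma continuous_extend:
  assumes h: "h \<in> unit_maps" shows "continuous_on UNIV (extend h)"
proof -
  have h01: "h 0 = 0" "h 1 = 1" and hc: "continuous_on {0..1} h" using h by (auto simp: unit_maps_def)
  have piece: "continuous_on {of_int k..of_int k + 1} (extend h)" for k :: int
  proof -
    have "continuous_on {of_int k..of_int k + 1} (\<lambda>t. of_int k + h (t - of_int k))"
      by (intro continuous_intros continuous_on_compose2[OF hc]) auto
    moreover have "extend h t = of_int k + h (t - of_int k)" if "t \<in> {of_int k..of_int k + 1}" for t
    proof (cases "t = of_int k + 1")
      case True
      then have "\<lfloor>t\<rfloor> = k + 1" by simp
      then show ?thesis using True h01 by (simp add: extend_def frac_def)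
    next
      case False
      with that have "\<lfloor>t\<rfloor> = k" by (intro floor_unique) auto
      then show ?thesis by (simp add: extend_def frac_def)
    qed
    ultimately show ?thesis using continuous_on_eq[where g = "extend h"] by metis
  qed
  have "isCont (extend h) x" for x
  proof -
    define k where "k = \<lfloor>x\<rfloor>"
    have "continuous_on ({of_int (k - 1)..of_int (k - 1) + 1} \<union> {of_int k..of_int k + 1}) (extend h)"
      by (intro continuous_on_closed_Un piece) auto
    then have "continuous_on {of_int k - 1<..<of_int k + 1} (extend h)"
      by (rule continuous_on_subset) auto
    moreover have "x \<in> {of_int k - 1<..<of_int k + 1}" unfolding k_def by (simp, linarith)
    ultimately show ?thesis using continuous_on_eq_continuous_at[OF open_greaterThanLessThan] by blast
  qed
  then show ?thesis by (simp add: continuous_at_imp_continuous_on)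
qed

lemma degree_one_eqI:
  assumes "degree_one G" "degree_one H" "\<And>t. 0 \<le> t \<Longrightarrow> t \<le> 1 \<Longrightarrow> G t = H t" shows "G = H"
proof
  fix x
  have "periodic (\<lambda>x. G x - H x)" by (rule periodic_diff_degree_one[OF assms(1,2)])
  then obtain y where "0 \<le> y" "y < 0 + 1" "G y - H y = G x - H x"     using periodic_reduce[of "\<lambda>x.
      G x - H x" 0 x] by metis
  then show "G x = H x" using assms(3)[of y] by simp
qed

text \<open>The cohomological equation \<open>v \<circ> F - v = u\<close> is solved by \<open>solve F n u\<close> up to the average of
  \<open>u\<close> over an orbit segment of length \<open>n\<close>.\<close>

definition solve :: "(real \<Rightarrow> real) \<Rightarrow> nat \<Rightarrow> (real \<Rightarrow> real) \<Rightarrow> real \<Rightarrow> real" where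
  "solve F n u x = - (\<Sum>i<n. orbit_sum F i u x) / real n"

text \<open>Since \<open>S_i u (F x) - S_i u x = u (F^i x) - u x\<close>, the mean over
  \<open>i < n\<close> is the average of \<open>u\<close> minus \<open>u\<close>, and the sign in
  \<open>solve\<close> reverses it.\<close>

lemma solve_cohomological:
  assumes "n > 0" shows "solve F n u (F x) - solve F n u x = u x - average F n u x"
proof -
  have "orbit_sum F i u (F x) - orbit_sum F i u x = u ((F ^^ i) x) - u x" for i
    using orbit_sum_add[of F 1 i u x] orbit_sum_add[of F i 1 u x] by (simp add: orbit_sum_def)
  then have "(\<Sum>i<n. orbit_sum F i u (F x)) - (\<Sum>i<n. orbit_sum F i u x) = orbit_sum F n u x - real n
      * u x"
    by (simp add: sum_subtractf[symmetric]) (simp add: sum_subtractf orbit_sum_def)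
  then show ?thesis using assms by (simp add: solve_def average_def field_simps)
qed

lemma orbit_sum_diff_le:
  assumes "\<And>x. \<bar>u x - v x\<bar> \<le> B" shows "\<bar>orbit_sum F n u x - orbit_sum F n v x\<bar> \<le> real n * B"
proof -
  have "\<bar>orbit_sum F n u x - orbit_sum F n v x\<bar> \<le> (\<Sum>j<n. \<bar>u ((F ^^ j) x) - v ((F ^^ j) x)\<bar>)"
    unfolding orbit_sum_def sum_subtractf[symmetric] by (rule sum_abs)
  also have "\<dots> \<le> (\<Sum>j<n. B)" by (intro sum_mono assms)
  finally show ?thesis by simp
qed

lemma solve_diff_le:
  assumes "\<And>x. \<bar>u x - v x\<bar> \<le> B" "B \<ge> 0" shows "\<bar>solve F n u x - solve F n v x\<bar> \<le> real n * B"
proof (cases "n = 0")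
  case False
  have "\<bar>(\<Sum>i<n. orbit_sum F i u x) - (\<Sum>i<n. orbit_sum F i v x)\<bar> \<le> (\<Sum>i<n. real n * B)"
    unfolding sum_subtractf[symmetric]
  proof (rule order_trans[OF sum_abs], intro sum_mono)
    fix i assume "i \<in> {..<n}"
    then have "real i * B \<le> real n * B" using assms(2) by (intro mult_right_mono) auto
    then show "\<bar>orbit_sum F i u x - orbit_sum F i v x\<bar> \<le> real n * B"
      using orbit_sum_diff_le[of u v B F i x, OF assms(1)] by linarith
  qed
  moreover have "solve F n u x - solve F n v x = - ((\<Sum>i<n. orbit_sum F i u x) - (\<Sum>i<n. orbit_sum F i
      v x)) / real n"
    by (simp add: solve_def diff_divide_distrib)
  ultimately show ?thesis using False by (simp add: abs_divide pos_divide_le_eq mult.commute)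
qed (simp add: solve_def)

lemma solve_abs_le:
  assumes "\<And>x. \<bar>u x\<bar> \<le> B" shows "\<bar>solve F n u x\<bar> \<le> real n * B"
proof -
  have "B \<ge> 0" using assms[of 0] by linarith
  then have "\<bar>solve F n u x - solve F n (\<lambda>x. 0) x\<bar> \<le> real n * B" using assms by (intro
      solve_diff_le) auto
  then show ?thesis by (simp add: solve_def orbit_sum_def)
qed

lemma continuous_orbit_sum:
  assumes "circle_lift F" "continuous_on UNIV u" shows "continuous_on UNIV (orbit_sum F n u)"
  unfolding orbit_sum_def
  using circle_lift_funpow[OF assms(1)]
  by (intro continuous_intros continuous_on_compose2[OF assms(2)]) (auto simp: circle_lift_def)

lemma continuous_solve:
  assumes "circle_lift F" "continuous_on UNIV u" shows "continuous_on UNIV (solve F n u)"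
  unfolding solve_def divide_inverse by (intro continuous_intros continuous_orbit_sum assms)

lemma periodic_solve: "degree_one F \<Longrightarrow> periodic u \<Longrightarrow> periodic (solve F n u)"
  using periodic_orbit_sum[of F u] by (simp add: periodic_def solve_def)

lemma var_le_solve:
  assumes "circle_lift F" "var_le u C" shows "\<exists>B. var_le (solve F n u) B"
proof -
  have "var_le (\<lambda>x. (- 1 / real n) * (\<Sum>i<n. orbit_sum F i u x)) (\<bar>- 1 / real n\<bar> * (\<Sum>i<n. real i * C))"
    by (intro var_le_cmult var_le_sum var_le_orbit_sum assms)
  then show ?thesis by (auto simp: solve_def[abs_def])
qed

text \<open>The prescribed derivative depends on \<open>H\<close> only through its values, so
  \<open>H\<close> arises as a fixed point of \<open>T\<close>, where \<open>T h\<close> is the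
  normalised integral of \<open>exp (v h)\<close>. The bound \<open>K\<close> for \<open>v h\<close>
  is the same for all \<open>h\<close>, which gives all images the Lipschitz constant
  \<open>exp (2 * K)\<close>.\<close>

theorem prescribed_log_derivative:
  assumes F: "circle_lift F" and w: "periodic w" "continuous_on UNIV w"
    and \<phi>: "periodic \<phi>" "continuous_on UNIV \<phi>"
  obtains H c where "c > 0" "C1_lift H (\<lambda>x. exp (solve F n (\<lambda>y. w (H y) - \<phi> y) x) / c)"
proof -
  have degF: "degree_one F" using F by (simp add: circle_lift_def)
  obtain W where W: "\<And>x. \<bar>w x\<bar> \<le> W" using periodic_continuous_bound[OF w] by blast
  obtain B\<phi> where B\<phi>: "\<And>x. \<bar>\<phi> x\<bar> \<le> B\<phi>" using periodic_continuous_bound[OF \<phi>] by blast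
  define K where "K = real n * (W + B\<phi>)"
  define v where "v h = solve F n (\<lambda>y. w (extend h y) - \<phi> y)" for h
  have vK: "\<bar>v h x\<bar> \<le> K" for h x
    unfolding v_def K_def by (rule solve_abs_le) (rule order_trans[OF abs_triangle_ineq4 add_mono[OF
        W B\<phi>]])
  have vcont: "continuous_on UNIV (v h)" if "h \<in> unit_maps" for h
    unfolding v_def
    by (intro continuous_solve F continuous_intros \<phi> continuous_on_compose2[OF w(2)
        continuous_extend[OF that]]) auto
  have vper: "periodic (v h)" for h
    unfolding v_def using periodic_comp[OF w(1) degree_one_extend] \<phi>(1)
    by (intro periodic_solve degF) (simp add: periodic_def)
  define P where "P h = (SOME P. \<forall>x. (P has_real_derivative exp (v h x)) (at x))" for h
  have P: "(P h has_real_derivative exp (v h x)) (at x)" if "h \<in> unit_maps" for h x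
  proof -
    have "\<exists>P. \<forall>x. (P has_real_derivative exp (v h x)) (at x)"
      by (intro antiderivative_exists continuous_on_exp vcont that)
    from someI_ex[OF this] show ?thesis unfolding P_def by blast
  qed
  have eK: "exp (- K) \<le> exp (v h x)" "exp (v h x) \<le> exp K" for h x using vK[of h x] by (auto simp:
      abs_le_iff)
  have id: "((\<lambda>x::real. x) has_real_derivative 1) (at x)" for x by (rule DERIV_ident)
  have Plow: "exp (- K) * (t - s) \<le> P h t - P h s" and Pup: "P h t - P h s \<le> exp K * (t - s)"
    if h: "h \<in> unit_maps" and "s \<le> t" for h s t
  proof -
    show "P h t - P h s \<le> exp K * (t - s)" using increments_le[OF P[OF h] id \<open>s \<le> t\<close>] eK by simp
    have "t - s \<le> exp K * (P h t - P h s)"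
    proof (rule increments_le[OF id P[OF h] \<open>s \<le> t\<close>])
      fix x
      have "exp K * exp (- K) \<le> exp K * exp (v h x)" by (intro mult_left_mono eK) simp
      then show "1 \<le> exp K * exp (v h x)" by (simp add: exp_minus)
    qed
    then show "exp (- K) * (t - s) \<le> P h t - P h s" by (simp add: exp_minus field_simps)
  qed
  define c where "c h = P h 1 - P h 0" for h
  have c: "exp (- K) \<le> c h" if "h \<in> unit_maps" for h using Plow[OF that, of 0 1] by (simp add: c_def)
  then have c0: "0 < c h" if "h \<in> unit_maps" for h using that by (meson exp_gt_zero less_le_trans)
  define T where "T h t = (P h t - P h 0) / c h" for h t
  have T_mono: "T h s \<le> T h t" if h: "h \<in> unit_maps" and "s \<le> t" for h s t
  proof -
    have "0 \<le> exp (- K) * (t - s)" using that by simp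
    then have "P h s \<le> P h t" using Plow[OF that] by linarith
    then show ?thesis unfolding T_def using c0[OF h] by (intro divide_right_mono) auto
  qed
  have T_deriv: "(T h has_real_derivative exp (v h x) / c h) (at x)" if h: "h \<in> unit_maps" for h x
    unfolding T_def[abs_def] using c0[OF h] by (auto intro!: derivative_eq_intros P[OF h])
  have T01: "T h 0 = 0" "T h 1 = 1" if "h \<in> unit_maps" for h
    using c0[OF that] by (simp_all add: T_def c_def)
  have self: "T h \<in> unit_maps" if h: "h \<in> unit_maps" for h
  proof -
    have "continuous_on {0..1} (T h)" using T_deriv[OF h] by (meson DERIV_isCont
        continuous_at_imp_continuous_on)
    then show ?thesis using T01[OF h] T_mono[OF h, of 0] T_mono[OF h, of _ 1] by (auto simp:
        unit_maps_def)
  qed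
  have lip: "\<bar>T h s - T h t\<bar> \<le> exp (2 * K) * \<bar>s - t\<bar>" if h: "h \<in> unit_maps" for h s t
  proof -
    have *: "T h t - T h s \<le> exp (2 * K) * (t - s)" if "s \<le> t" for s t
    proof -
      have "T h t - T h s = (P h t - P h s) / c h" by (simp add: T_def diff_divide_distrib)
      also have "\<dots> \<le> (exp K * (t - s)) / exp (- K)"
        using Pup[OF h that] c[OF h] that by (intro frac_le) auto
      also have "\<dots> = exp (2 * K) * (t - s)" using exp_add[of K K] by (simp add: exp_minus
          divide_inverse)
      finally show ?thesis .
    qed
    show ?thesis using *[of s t] *[of t s] T_mono[OF h, of s t] T_mono[OF h, of t s] by (cases "s \<le>
        t") auto
  qed
  have cont: "\<exists>\<delta>>0. \<forall>h\<in>unit_maps. \<forall>k\<in>unit_maps.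
        (\<forall>t\<in>{0..1}. \<bar>h t - k t\<bar> \<le> \<delta>) \<longrightarrow> (\<forall>t\<in>{0..1}. \<bar>T h t - T k t\<bar> \<le> \<epsilon>)" if \<epsilon>: "\<epsilon> > 0" for \<epsilon>
  proof -
    \<comment> \<open>Numerator and denominator of \<open>T h\<close> each change by a factor of at
      most \<open>exp \<eta>\<close>, together by at most \<open>1 + \<epsilon>\<close>.\<close>
    define \<eta> where "\<eta> = ln (1 + \<epsilon>) / 2"
    have \<eta>: "\<eta> > 0" "exp (2 * \<eta>) = 1 + \<epsilon>" using \<epsilon> by (simp_all add: \<eta>_def)
    define \<epsilon>1 where "\<epsilon>1 = \<eta> / (real n + 1)"
    have \<epsilon>1: "\<epsilon>1 > 0" "real n * \<epsilon>1 \<le> \<eta>" using \<eta> by (simp_all add: \<epsilon>1_def field_simps)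
    have "uniformly_continuous_on {0..1} w"
      using w(2) by (intro compact_uniformly_continuous) (auto intro: continuous_on_subset)
    then obtain \<delta> where \<delta>: "\<delta> > 0" and uc: "\<And>x y. x \<in> {0..1} \<Longrightarrow> y \<in> {0..1} \<Longrightarrow> dist y x < \<delta> \<Longrightarrow> dist (w
        y) (w x) < \<epsilon>1"
      unfolding uniformly_continuous_on_def using \<epsilon>1(1) by blast
    show ?thesis
    proof (intro exI[of _ "\<delta> / 2"] conjI ballI impI)
      fix h k t
      assume hk: "h \<in> unit_maps" "k \<in> unit_maps" "\<forall>t\<in>{0..1}. \<bar>h t - k t\<bar> \<le> \<delta> / 2" and t: "t \<in>
          {0..1::real}"
      have wext: "w (extend h x) = w (h (frac x))" for h x
        using periodic_int[OF w(1), of "h (frac x)" "\<lfloor>x\<rfloor>"] by (simp add: extend_def add.commute)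
      have near: "\<bar>(w (extend h x) - \<phi> x) - (w (extend k x) - \<phi> x)\<bar> \<le> \<epsilon>1" for x
      proof -
        have f: "frac x \<in> {0..1}" using frac_lt_1[of x] by (simp add: less_imp_le)
        then have "\<bar>h (frac x) - k (frac x)\<bar> \<le> \<delta> / 2" using hk(3) by blast
        moreover have "h (frac x) \<in> {0..1}" "k (frac x) \<in> {0..1}"
          using f hk(1,2) by (simp_all add: unit_maps_def)
        moreover have "\<delta> / 2 < \<delta>" using \<delta> by simp
        ultimately have "h (frac x) \<in> {0..1}" "k (frac x) \<in> {0..1}" "dist (h (frac x)) (k (frac x)) < \<delta>"
          unfolding dist_real_def by linarith+
        then have "dist (w (h (frac x))) (w (k (frac x))) < \<epsilon>1" by (intro uc)
        then show ?thesis unfolding wext by (simp add: dist_real_def)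
      qed
      have vv: "\<bar>v h x - v k x\<bar> \<le> \<eta>" for x
      proof -
        have "\<bar>v h x - v k x\<bar> \<le> real n * \<epsilon>1"
          unfolding v_def using near \<epsilon>1 by (intro solve_diff_le) auto
        then show ?thesis using \<epsilon>1(2) by linarith
      qed
      have *: "T h t - T k t \<le> \<epsilon>" if hk: "h \<in> unit_maps" "k \<in> unit_maps" and vv: "\<And>x. \<bar>v h x - v k
          x\<bar> \<le> \<eta>" for h k
      proof -
        have e: "exp (v h x) \<le> exp \<eta> * exp (v k x)" "exp (v k x) \<le> exp \<eta> * exp (v h x)" for x
          unfolding exp_add[symmetric] using vv[of x] by (simp_all add: abs_le_iff)
        have 1: "P h t - P h 0 \<le> exp \<eta> * (P k t - P k 0)"
          by (rule increments_le[OF P[OF hk(1)] P[OF hk(2)]]) (use t e in auto)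
        have 2: "c k \<le> exp \<eta> * c h"
          unfolding c_def by (rule increments_le[OF P[OF hk(2)] P[OF hk(1)]]) (use e in auto)
        have Tk: "0 \<le> T k t" "T k t \<le> 1" using self[OF hk(2)] t by (auto simp: unit_maps_def)
        have "P h t - P h 0 \<le> exp \<eta> * (T k t * c k)" using 1 c0[OF hk(2)] by (simp add: T_def)
        also have "\<dots> \<le> exp \<eta> * (T k t * (exp \<eta> * c h))" using 2 Tk by (intro mult_left_mono) auto
        also have "\<dots> = exp (2 * \<eta>) * T k t * c h" using exp_add[of \<eta> \<eta>] by (simp add: algebra_simps)
        finally have "T h t \<le> (1 + \<epsilon>) * T k t"
          unfolding T_def[of h] using c0[OF hk(1)] by (simp add: pos_divide_le_eq \<eta>(2))
        also have "\<dots> = T k t + \<epsilon> * T k t" by (simp add: algebra_simps)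
        also have "\<dots> \<le> T k t + \<epsilon>" using Tk \<epsilon> by simp
        finally show ?thesis by simp
      qed
      show "\<bar>T h t - T k t\<bar> \<le> \<epsilon>"
        using *[OF hk(1,2) vv] *[OF hk(2,1)] vv by (simp add: abs_le_iff abs_minus_commute)
    qed (use \<delta> in simp)
  qed
  obtain h where h: "h \<in> unit_maps" and fp: "\<And>t. t \<in> {0..1} \<Longrightarrow> T h t = h t"
    by (rule fixpoint_unit_maps[of T "exp (2 * K)"]) (use self lip cont in auto)
  have T_deg: "degree_one (T h)"
  proof -
    have "((\<lambda>x. T h (x + 1) - T h x) has_real_derivative 0) (at x)" for x
    proof -
      have "((\<lambda>x. T h (x + 1)) has_real_derivative exp (v h (x + 1)) / c h) (at x)"
        using T_deriv[OF h, of "x + 1"] by (simp add: DERIV_shift)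
      moreover have "v h (x + 1) = v h x" using vper by (simp add: periodic_def)
      ultimately show ?thesis using T_deriv[OF h, of x] by (auto intro!: derivative_eq_intros)
    qed
    then have "T h (x + 1) - T h x = T h (0 + 1) - T h 0" for x
      using DERIV_isconst_all[of "\<lambda>x. T h (x + 1) - T h x" x 0] by blast
    then show ?thesis using T01[OF h] by (simp add: degree_one_def algebra_simps)
  qed
  have "T h = extend h"
  proof (rule degree_one_eqI[OF T_deg degree_one_extend])
    fix t :: real assume t: "0 \<le> t" "t \<le> 1"
    show "T h t = extend h t"
    proof (cases "t = 1")
      case True
      then show ?thesis using T01[OF h] h by (simp add: extend_def unit_maps_def)
    next
      case False
      then have "\<lfloor>t\<rfloor> = 0" using t by (intro floor_unique) auto
      then show ?thesis using fp[of t] t by (simp add: extend_def frac_def)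
    qed
  qed
  then have v: "v h = solve F n (\<lambda>y. w (T h y) - \<phi> y)" by (simp add: v_def)
  have "C1_lift (T h) (\<lambda>x. exp (v h x) / c h)"
    unfolding C1_lift_def using T_deg T_deriv[OF h] c0[OF h]
    by (auto intro!: continuous_intros vcont[OF h])
  then show thesis using that[OF c0[OF h]] unfolding v by blast
qed

lemma funpow_conj:
  assumes "bij H" shows "((\<lambda>y. H (F (inv H y))) ^^ j) y = H ((F ^^ j) (inv H y))"
  using assms by (induction j) (auto simp: bij_is_inj bij_is_surj surj_f_inv_f)

text \<open>By the chain rule \<open>ln (DM (H x)) = ln (E (F x)) - ln (E x) + ln (D x)\<close>, and
  up to averages \<open>ln (E x)\<close> solves the cohomological equation with right side
  \<open>w (H x) - ln (D x)\<close>.\<close>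

theorem approximate_conjugacy:
  assumes F: "C1_lift F D" and w: "periodic w" "continuous_on UNIV w" and n: "n > 0"
  obtains H E DM where "C1_lift H E" "C1_lift (\<lambda>y. H (F (inv H y))) DM"
    "\<And>y. ln (DM y) = w y - average (\<lambda>y. H (F (inv H y))) n w y + average F n (\<lambda>x. ln (D x)) (inv H y)"
    "\<And>C V. var_le w C \<Longrightarrow> var_le (\<lambda>x. ln (D x)) V \<Longrightarrow> \<exists>B. var_le (\<lambda>x. ln (E x)) B"
proof -
  note FD = C1_liftD[OF F]
  have FL: "circle_lift F" by (rule C1_lift_circle_lift[OF F])
  have \<phi>: "periodic (\<lambda>x. ln (D x))" "continuous_on UNIV (\<lambda>x. ln (D x))"
    using C1_lift_periodic[OF F] FD(3,4) by (auto simp: periodic_def order_less_imp_not_eq2 intro!: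
        continuous_intros)
  obtain H c where c: "c > 0" and H: "C1_lift H (\<lambda>x. exp (solve F n (\<lambda>y. w (H y) - ln (D y)) x) / c)"
    by (rule prescribed_log_derivative[OF FL w \<phi>])
  define u where "u = (\<lambda>y. w (H y) - ln (D y))"
  define E where "E x = exp (solve F n u x) / c" for x
  have HE: "C1_lift H E" using H by (simp add: E_def[abs_def] u_def)
  have HL: "circle_lift H" by (rule C1_lift_circle_lift[OF HE])
  have bH: "bij H" by (rule circle_lift_bij[OF HL])
  have lnE: "ln (E x) = solve F n u x - ln c" for x using c by (simp add: E_def ln_div)
  define DM where "DM y = E (F (inv H y)) * (D (inv H y) * (1 / E (inv H y)))" for y
  have M: "C1_lift (\<lambda>y. H (F (inv H y))) DM"
    unfolding DM_def by (rule C1_lift_comp[OF HE C1_lift_comp[OF F C1_lift_inv[OF HE]]])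
  have lnM: "ln (DM y) = w y - average (\<lambda>y. H (F (inv H y))) n w y + average F n (\<lambda>x. ln (D x)) (inv
      H y)" for y
  proof -
    define x where "x = inv H y"
    have y: "H x = y" using bH by (simp add: x_def bij_is_surj surj_f_inv_f)
    have pos: "E z > 0" "D z > 0" for z using C1_liftD(3)[OF HE] FD(3) by auto
    then have nz: "E z \<noteq> 0" "D z \<noteq> 0" for z by (simp_all add: order_less_imp_not_eq2)
    have "ln (DM y) = ln (E (F x)) + ln (D x) - ln (E x)"
      unfolding DM_def x_def[symmetric] using pos nz by (simp add: ln_mult ln_div)
    also have "\<dots> = u x - average F n u x + ln (D x)"
      unfolding lnE using solve_cohomological[OF n, of F u x] by simp
    also have "average F n u x = average F n (\<lambda>x. w (H x)) x - average F n (\<lambda>x. ln (D x)) x"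
      by (simp add: average_def orbit_sum_def u_def sum_subtractf diff_divide_distrib)
    \<comment> \<open>Averaging \<open>w\<close> composed with \<open>H\<close> along
      \<open>F\<close> is averaging \<open>w\<close> along the conjugate map.\<close>
    also have "average F n (\<lambda>x. w (H x)) x = average (\<lambda>y. H (F (inv H y))) n w y"
      by (simp add: average_def orbit_sum_def funpow_conj[OF bH] x_def)
    finally show ?thesis by (simp add: u_def y x_def[symmetric])
  qed
  have varE: "\<exists>B. var_le (\<lambda>x. ln (E x)) B" if "var_le w C" "var_le (\<lambda>x. ln (D x)) V" for C V
  proof -
    have "var_le u (C + V)"
      unfolding u_def using HL circle_lift_mono[OF HL]
      by (intro var_le_diff[OF var_le_comp[OF that(1)] that(2)]) (auto simp: circle_lift_def)
    then obtain B where "var_le (solve F n u) B" using var_le_solve[OF FL] by blast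
    then have "var_le (\<lambda>x. solve F n u x + (- ln c)) B" by (rule var_le_add_const)
    then show ?thesis by (auto simp: lnE)
  qed
  show thesis by (rule that[OF HE M lnM varE])
qed

section \<open>Convergence of the conjugates\<close>

text \<open>A finer generation returns more closely, so the separation property of the coarser one
  forces its return time to be at least \<open>Q\<close>, beyond the old return time.\<close>

lemma denjoy_data_large:
  assumes "\<rho> \<notin> \<rat>" shows "\<exists>a b Q. denjoy_data \<rho> a b Q \<and> int N \<le> \<bar>a\<bar>"
proof (induction N)
  case 0
  obtain a b Q where "denjoy_data \<rho> a b Q" using denjoy_data_exists[OF assms zero_less_one] by blast
  then show ?case by auto
next
  case (Suc N)
  then obtain a b Q where d: "denjoy_data \<rho> a b Q" "int N \<le> \<bar>a\<bar>" by blast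
  then have pos: "0 < of_int a * \<rho> + of_int b" by (simp add: denjoy_data_def)
  obtain a' b' Q' where d': "denjoy_data \<rho> a' b' Q'" and less: "of_int a' * \<rho> + of_int b' < of_int a
      * \<rho> + of_int b"
    using denjoy_data_exists[OF assms pos] .
  have pos': "0 < of_int a' * \<rho> + of_int b'" "a' \<noteq> 0" using d' by (auto simp: denjoy_data_def)
  have "int Q \<le> \<bar>a'\<bar>"
  proof (rule ccontr)
    assume "\<not> int Q \<le> \<bar>a'\<bar>"
    then have "of_int a * \<rho> + of_int b \<le> \<bar>of_int a' * \<rho> + of_int b'\<bar>"
      using d(1) pos'(2) by (auto simp: denjoy_data_def)
    then show False using less pos' by simp
  qed
  moreover have "\<bar>a\<bar> < int Q" using d(1) by (simp add: denjoy_data_def)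
  ultimately show ?case using d' d(2) by (intro exI[of _ a'] exI[of _ b'] exI[of _ Q']) auto
qed

text \<open>Orbit segments are cut into blocks whose length is a return time \<open>p\<close>, each
  with oscillation at most \<open>3 * C\<close>. As \<open>p\<close> is determined by
  \<open>\<rho>\<close>, the threshold \<open>N\<close> is chosen before \<open>M\<close> and
  \<open>u\<close>, which makes the estimate uniform over all conjugates.\<close>

lemma average_oscillation:
  assumes irr: "\<rho> \<notin> \<rat>" and \<epsilon>: "\<epsilon> > 0"
  obtains N where "\<And>n M u x y. n \<ge> N \<Longrightarrow> circle_lift M \<Longrightarrow> translation_number M \<rho> \<Longrightarrow> periodic u \<Longrightarrow>
     var_le u C \<Longrightarrow> \<bar>average M n u x - average M n u y\<bar> \<le> \<epsilon>"
proof -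
  \<comment> \<open>The absolute value is taken because \<open>C \<ge> 0\<close> becomes available
    only with a function \<open>u\<close> such that \<open>var_le u C\<close>.\<close>
  obtain K :: nat where K: "6 * \<bar>C\<bar> / \<epsilon> < real K" using reals_Archimedean2 by blast
  obtain a b Q where d: "denjoy_data \<rho> a b Q" and a: "int K \<le> \<bar>a\<bar>" using denjoy_data_large[OF irr]
      by blast
  define p where "p = nat \<bar>a\<bar>"
  have p0: "p > 0" using d by (simp add: p_def denjoy_data_def)
  have "real K \<le> real p" using a by (simp add: p_def)
  then have "6 * \<bar>C\<bar> / \<epsilon> < real p" using K by simp
  then have p: "3 * \<bar>C\<bar> / real p \<le> \<epsilon> / 2" using p0 \<epsilon> by (simp add: field_simps)
  obtain N :: nat where N: "2 * real p * \<bar>C\<bar> / \<epsilon> < real N" using reals_Archimedean2 by blast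
  show thesis
  proof (rule that[of "Suc N"])
    fix n M u x y
    assume n: "n \<ge> Suc N" and M: "circle_lift M" "translation_number M \<rho>" and u: "periodic u"
        "var_le u C"
    have C: "C \<ge> 0" by (rule var_le_nonneg[OF u(2)])
    interpret denjoy M \<rho> a b Q using M irr d by unfold_locales
    have block: "\<bar>orbit_sum M (k * p) u x - orbit_sum M (k * p) u y\<bar> \<le> real k * (3 * C)" for k x y
    proof (induction k arbitrary: x y)
      case 0
      then show ?case by (simp add: orbit_sum_def)
    next
      case (Suc k)
      have "\<bar>orbit_sum M p u x - orbit_sum M p u y\<bar> \<le> 3 * C"
        using denjoy_koksma[OF u, of x y] unfolding p_def q_def .
      moreover have "\<bar>orbit_sum M (k * p) u ((M ^^ p) x) - orbit_sum M (k * p) u ((M ^^ p) y)\<bar> \<le>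
          real k * (3 * C)"
        by (rule Suc.IH)
      moreover have "orbit_sum M (Suc k * p) u z = orbit_sum M p u z + orbit_sum M (k * p) u ((M ^^
          p) z)" for z
        using orbit_sum_add[of M p "k * p" u z] by simp
      ultimately show ?case by (simp add: distrib_right)
    qed
    define k r where "k = n div p" and "r = n mod p"
    have kr: "n = k * p + r" "r < p" using p0 by (simp_all add: k_def r_def)
    have rem: "\<bar>orbit_sum M r u x - orbit_sum M r u y\<bar> \<le> real r * C" for x y
    proof -
      have "\<bar>orbit_sum M r u x - orbit_sum M r u y\<bar> \<le> (\<Sum>j<r. \<bar>u ((M ^^ j) x) - u ((M ^^ j) y)\<bar>)"
        unfolding orbit_sum_def sum_subtractf[symmetric] by (rule sum_abs)
      also have "\<dots> \<le> (\<Sum>j<r. C)" by (intro sum_mono var_le_osc u)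
      finally show ?thesis by simp
    qed
    have n0: "real n > 0" using n by simp
    have "\<bar>orbit_sum M n u x - orbit_sum M n u y\<bar> \<le> real k * (3 * C) + real r * C"
      using block[of k x y] rem[of "(M ^^ (k * p)) x" "(M ^^ (k * p)) y"]
      unfolding kr(1) orbit_sum_add by linarith
    also have "\<dots> \<le> real n * (3 * C / real p) + real p * C"
    proof (intro add_mono mult_right_mono C)
      have "real k * real p \<le> real n" using kr(1) by (metis le_add1 of_nat_le_iff of_nat_mult)
      then have "real k * real p * (3 * C / real p) \<le> real n * (3 * C / real p)"
        using C by (intro mult_right_mono) auto
      then show "real k * (3 * C) \<le> real n * (3 * C / real p)" using p0 by simp
    qed (use kr in simp)
    finally have "\<bar>average M n u x - average M n u y\<bar> \<le> (real n * (3 * C / real p) + real p * C) /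
        real n"
      using n0 by (simp add: average_def diff_divide_distrib[symmetric] abs_divide divide_right_mono)
    also have "\<dots> = 3 * C / real p + real p * C / real n" using n0 by (simp add: add_divide_distrib)
    also have "real p * C / real n \<le> \<epsilon> / 2"
    proof -
      have "2 * real p * \<bar>C\<bar> / \<epsilon> < real n" using N n by simp
      then show ?thesis using n0 \<epsilon> C by (simp add: field_simps)
    qed
    finally show "\<bar>average M n u x - average M n u y\<bar> \<le> \<epsilon>" using p C by simp
  qed
qed

section \<open>Rigidity of an irrational translation number\<close>

lemma translation_number_lower:
  assumes M: "mono M" "translation_number M \<rho>" and q: "\<And>x. x + c \<le> (M ^^ q) x"
  shows "c \<le> real q * \<rho>"
proof (rule ccontr)
  assume "\<not> c \<le> real q * \<rho>"
  then have "c - real q * \<rho> > 0" by simp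
  from reals_Archimedean3[OF this] obtain n :: nat where n: "1 < real n * (c - real q * \<rho>)" by metis
  have "real n * c \<le> (M ^^ (q * n)) 0" for n
  proof (induction n)
    case (Suc n)
    have "(M ^^ (q * Suc n)) 0 = (M ^^ q) ((M ^^ (q * n)) 0)" by (simp add: funpow_add)
    then show ?case using q[of "(M ^^ (q * n)) 0"] Suc by (simp add: distrib_right)
  qed simp
  moreover have "\<bar>(M ^^ (q * n)) 0 - 0 - real (q * n) * \<rho>\<bar> \<le> 1" using M(2) unfolding
      translation_number_def by blast
  ultimately show False using n by (simp add: algebra_simps abs_le_iff) (smt (verit, best))
qed

lemma translation_number_upper:
  assumes M: "mono M" "translation_number M \<rho>" and q: "\<And>x. (M ^^ q) x \<le> x + c"
  shows "real q * \<rho> \<le> c"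
proof (rule ccontr)
  assume "\<not> real q * \<rho> \<le> c"
  then have "real q * \<rho> - c > 0" by simp
  from reals_Archimedean3[OF this] obtain n :: nat where n: "1 < real n * (real q * \<rho> - c)" by metis
  have "(M ^^ (q * n)) 0 \<le> real n * c" for n
  proof (induction n)
    case (Suc n)
    have "(M ^^ (q * Suc n)) 0 = (M ^^ q) ((M ^^ (q * n)) 0)" by (simp add: funpow_add)
    then show ?case using q[of "(M ^^ (q * n)) 0"] Suc by (simp add: distrib_right)
  qed simp
  moreover have "\<bar>(M ^^ (q * n)) 0 - 0 - real (q * n) * \<rho>\<bar> \<le> 1" using M(2) unfolding
      translation_number_def by blast
  ultimately show False using n by (simp add: algebra_simps abs_le_iff) (smt (verit, best))
qed

text \<open>Monotonicity of \<open>G\<close> preserves order but not gaps, so only the gain of the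
  last step is kept.\<close>

lemma funpow_shift_le:
  fixes G M :: "real \<Rightarrow> real" and \<eta> :: real
  assumes "mono G" "\<eta> \<ge> 0" "\<And>x. G x + \<eta> \<le> M x" "q > 0"
  shows "(G ^^ q) x + \<eta> \<le> (M ^^ q) x"
proof -
  have *: "(G ^^ q) x \<le> (M ^^ q) x" for q
  proof (induction q)
    case (Suc q)
    have "G ((G ^^ q) x) \<le> G ((M ^^ q) x)" using assms(1) Suc by (simp add: mono_def)
    then show ?case using assms(2) assms(3)[of "(M ^^ q) x"] by simp
  qed simp
  obtain p where p: "q = Suc p" using assms(4) gr0_implies_Suc by blast
  have "G ((G ^^ p) x) \<le> G ((M ^^ p) x)" using assms(1) * by (simp add: mono_def)
  then show ?thesis using assms(3)[of "(M ^^ p) x"] by (simp add: p)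
qed

lemma funpow_shift_ge:
  fixes G M :: "real \<Rightarrow> real" and \<eta> :: real
  assumes "mono G" "\<eta> \<ge> 0" "\<And>x. M x \<le> G x - \<eta>" "q > 0"
  shows "(M ^^ q) x \<le> (G ^^ q) x - \<eta>"
proof -
  have *: "(M ^^ q) x \<le> (G ^^ q) x" for q
  proof (induction q)
    case (Suc q)
    have "G ((M ^^ q) x) \<le> G ((G ^^ q) x)" using assms(1) Suc by (simp add: mono_def)
    then show ?case using assms(2) assms(3)[of "(M ^^ q) x"] by simp
  qed simp
  obtain p where p: "q = Suc p" using assms(4) gr0_implies_Suc by blast
  have "G ((M ^^ p) x) \<le> G ((G ^^ p) x)" using assms(1) * by (simp add: mono_def)
  then show ?thesis using assms(3)[of "(M ^^ p) x"] by (simp add: p)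
qed

context C1_irrational_lift
begin

text \<open>Returns from both sides are wanted at positive times, but the closest return
  \<open>a\<close> has a sign of its own. The other side is reached by about
  \<open>1 / \<delta>\<close> steps of size \<open>\<delta>\<close> and one integer: for
  \<open>k = \<lfloor>1 / \<delta>\<rfloor>\<close> the displacement \<open>k * \<delta> - 1\<close>
  is at least \<open>- \<delta>\<close>, and irrationality makes it negative.\<close>

lemma close_returns:
  assumes \<eta>: "\<eta> > 0"
  shows "\<exists>q>0. \<exists>p::int. real q * \<rho> + of_int p < 0 \<and> (\<forall>x. x - \<eta> < (F ^^ q) x + of_int p)"
    and "\<exists>q>0. \<exists>p::int. 0 < real q * \<rho> + of_int p \<and> (\<forall>x. (F ^^ q) x + of_int p < x + \<eta>)"
proof -
  obtain \<eta>' where \<eta>': "\<eta>' > 0" and small: "\<And>a b Q x. denjoy_data \<rho> a b Q \<Longrightarrow> of_int a * \<rho> + of_int b <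
      \<eta>' \<Longrightarrow>
      zpow F a x + of_int b - x < \<eta>"
    using small_intervals[OF \<eta>] by blast
  obtain a b Q where d: "denjoy_data \<rho> a b Q" and less: "of_int a * \<rho> + of_int b < \<eta>'"
    using denjoy_data_exists[OF irr \<eta>'] .
  define \<delta> where "\<delta> = of_int a * \<rho> + of_int b"
  have \<delta>: "0 < \<delta>" "\<delta> < 1" "a \<noteq> 0" using d by (auto simp: denjoy_data_def \<delta>_def)
  have T: "zpow F a x + of_int b < x + \<eta>" for x using small[OF d less, of x] by simp
  have up: "zpow F j x + of_int m < x + \<eta>" if "of_int j * \<rho> + of_int m \<le> \<delta>" for j m x
    using orbit_le[of j m a b x] that T[of x] by (simp add: \<delta>_def)
  have down: "x - \<eta> < zpow F j x + of_int m" if "- \<delta> \<le> of_int j * \<rho> + of_int m" for j m x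
  proof -
    have "x + of_int 0 \<le> zpow F (a + j) x + of_int (b + m)"
      using orbit_le[of 0 0 "a + j" "b + m" x] that by (simp add: \<delta>_def algebra_simps zpow_def)
    also have "\<dots> = zpow F a (zpow F j x + of_int m) + of_int b"
      unfolding zpow_int zpow_add[OF bijF] by simp
    also have "\<dots> < zpow F j x + of_int m + \<eta>" by (rule T)
    finally show ?thesis by simp
  qed
  define k where "k = \<lfloor>1 / \<delta>\<rfloor>"
  have k1: "k \<ge> 1" unfolding k_def using \<delta> by (simp add: le_floor_iff)
  have "of_int k \<le> 1 / \<delta>" "1 / \<delta> < of_int k + 1" unfolding k_def by linarith+
  then have kd: "of_int k * \<delta> \<le> 1" "1 < (of_int k + 1) * \<delta>" using \<delta> by (simp_all add: field_simps)
  have kd_eq: "of_int (k * a) * \<rho> + of_int (k * b - 1) = of_int k * \<delta> - 1" by (simp add: \<delta>_def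
      algebra_simps)
  have ka: "k * a \<noteq> 0" using k1 \<delta> by simp
  then have ne: "of_int k * \<delta> - 1 \<noteq> 0" using lin_eq_0_iff[of "k * a" "k * b - 1"] kd_eq by metis
  define S where "S = of_int (k * a) * \<rho> + of_int (k * b - 1)"
  have S: "- \<delta> \<le> S" "S < 0" unfolding S_def kd_eq using kd ne by (simp_all add: algebra_simps)
  have "\<exists>q>0. \<exists>p. real q * \<rho> + of_int p < 0 \<and> - \<delta> \<le> real q * \<rho> + of_int p"
  proof (cases "a > 0")
    case True
    then have "k * a > 0" using k1 by simp
    then show ?thesis using S unfolding S_def by (intro exI[of _ "nat (k * a)"] conjI exI[of _ "k *
        b - 1"]) auto
  next
    case False
    then show ?thesis using \<delta> unfolding \<delta>_def by (intro exI[of _ "nat (- a)"] conjI exI[of _ "- b"])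
        auto
  qed
  then obtain q and p :: int where qp: "q > 0" "real q * \<rho> + of_int p < 0" "- \<delta> \<le> real q * \<rho> +
      of_int p" by blast
  have "x - \<eta> < (F ^^ q) x + of_int p" for x using down[of "int q" p x] qp(3) by simp
  then show "\<exists>q>0. \<exists>p::int. real q * \<rho> + of_int p < 0 \<and> (\<forall>x. x - \<eta> < (F ^^ q) x + of_int p)" using
      qp by blast
  have "\<exists>q>0. \<exists>p. 0 < real q * \<rho> + of_int p \<and> real q * \<rho> + of_int p \<le> \<delta>"
  proof (cases "a > 0")
    case True
    then show ?thesis using \<delta> unfolding \<delta>_def by (intro exI[of _ "nat a"] conjI exI[of _ b]) auto
  next
    case False
    then have "- (k * a) > 0" using k1 \<delta> by (simp add: mult_pos_neg)
    then have "real (nat (- (k * a))) = - of_int (k * a)" by simp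
    then have e: "real (nat (- (k * a))) * \<rho> + of_int (1 - k * b) = - S" by (simp add: S_def)
    show ?thesis using S e \<open>- (k * a) > 0\<close> by (intro exI[of _ "nat (- (k * a))"] conjI exI[of _ "1 -
        k * b"]) auto
  qed
  then obtain q and p :: int where qp: "q > 0" "0 < real q * \<rho> + of_int p" "real q * \<rho> + of_int p \<le>
      \<delta>" by blast
  have "(F ^^ q) x + of_int p < x + \<eta>" for x using up[of "int q" p x] qp(3) by simp
  then show "\<exists>q>0. \<exists>p::int. 0 < real q * \<rho> + of_int p \<and> (\<forall>x. (F ^^ q) x + of_int p < x + \<eta>)" using
      qp by blast
qed

text \<open>If the difference exceeds \<open>\<epsilon>\<close> somewhere, it keeps its sign and is
  at least \<open>\<epsilon> / 2\<close> in absolute value everywhere. At a close return of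
  \<open>F\<close> from the opposite side the gain of one step carries \<open>M^q\<close> past an
  integer translation, which puts \<open>q * \<rho>\<close> on the wrong side of that
  integer.\<close>

lemma translation_number_rigid:
  assumes \<epsilon>: "\<epsilon> > 0" and M: "mono M" "translation_number M \<rho>"
    and osc: "\<And>x y. \<bar>(M x - F x) - (M y - F y)\<bar> \<le> \<epsilon> / 2"
  shows "\<bar>M x - F x\<bar> \<le> \<epsilon>"
proof (rule ccontr)
  assume "\<not> \<bar>M x - F x\<bar> \<le> \<epsilon>"
  then consider "M x - F x > \<epsilon>" | "M x - F x < - \<epsilon>" by linarith
  then show False
  proof cases
    case 1
    have ge: "F y + \<epsilon> / 2 \<le> M y" for y using osc[of x y] 1 by linarith
    obtain q and p :: int where q: "q > 0" "real q * \<rho> + of_int p < 0" "\<And>x. x - \<epsilon> / 2 < (F ^^ q) x +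
        of_int p"
      using close_returns(1)[of "\<epsilon> / 2"] \<epsilon> by auto
    have "y + (- of_int p) \<le> (M ^^ q) y" for y
      using funpow_shift_le[OF circle_lift_mono[OF lift] _ ge q(1), of y] q(3)[of y] \<epsilon> by simp
    from translation_number_lower[OF M this] q(2) show False by simp
  next
    case 2
    have le: "M y \<le> F y - \<epsilon> / 2" for y using osc[of x y] 2 by linarith
    obtain q and p :: int where q: "q > 0" "0 < real q * \<rho> + of_int p" "\<And>x. (F ^^ q) x + of_int p <
        x + \<epsilon> / 2"
      using close_returns(2)[of "\<epsilon> / 2"] \<epsilon> by auto
    have "(M ^^ q) y \<le> y + (- of_int p)" for y
      using funpow_shift_ge[OF circle_lift_mono[OF lift] _ le q(1), of y] q(3)[of y] \<epsilon> by simp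
    from translation_number_upper[OF M this] q(2) show False by simp
  qed
qed

end

section \<open>Continuity of composition and of averages with respect to variation\<close>

definition C1_close :: "real \<Rightarrow> (real \<Rightarrow> real) \<Rightarrow> (real \<Rightarrow> real) \<Rightarrow> (real \<Rightarrow> real) \<Rightarrow> (real \<Rightarrow> real) \<Rightarrow> bool"
    where
  "C1_close \<delta> M DM G DG \<longleftrightarrow> (\<forall>x. \<bar>M x - G x\<bar> \<le> \<delta> \<and> \<bar>DM x - DG x\<bar> \<le> \<delta>)"

lemma C1_close_mono: "C1_close \<delta> M DM G DG \<Longrightarrow> \<delta> \<le> \<delta>' \<Longrightarrow> C1_close \<delta>' M DM G DG"
  unfolding C1_close_def by (meson order_trans)

lemma C1_lift_lower_bound:
  assumes "C1_lift G DG" obtains \<beta> where "\<beta> > 0" "\<And>x. \<beta> \<le> DG x"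
proof -
  note G = C1_liftD[OF assms]
  have "continuous_on UNIV (\<lambda>x. 1 / DG x)" using G by (auto intro!: continuous_intros simp:
      order_less_imp_not_eq2)
  moreover have "periodic (\<lambda>x. 1 / DG x)" using C1_lift_periodic[OF assms] by (simp add: periodic_def)
  ultimately obtain B where B: "\<And>x. \<bar>1 / DG x\<bar> \<le> B" using periodic_continuous_bound by blast
  have "0 < \<bar>1 / DG 0\<bar>" using G(3)[of 0] by simp
  then have B0: "B > 0" using B[of 0] by linarith
  have "1 / B \<le> DG x" for x using B[of x] G(3)[of x] B0 by (simp add: field_simps)
  then show ?thesis using that[of "1 / B"] B0 by simp
qed

text \<open>For \<open>\<theta> = M \<circ> inv G\<close>, which is close to the identity, the ramp
  and its composition with \<open>\<theta>\<close> share almost all their mass on a slightly shorter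
  arc. Composing the estimate with \<open>G\<close> gives the claim.\<close>

lemma var_le_ramp_C1_close:
  assumes G: "C1_lift G DG" and M: "C1_lift M DM" and ab: "a < b" "b \<le> a + 1"
    and \<beta>: "\<beta> > 0" "\<And>x. \<beta> \<le> DG x" and close: "C1_close \<delta> M DM G DG" and small: "2 * \<delta> < b - a"
  shows "var_le (\<lambda>x. ramp a b (M x) - ramp a b (G x)) (\<delta> * (2 / \<beta> + 4 / (b - a)))"
proof -
  have GL: "circle_lift G" by (rule C1_lift_circle_lift[OF G])
  have bG: "bij G" by (rule circle_lift_bij[OF GL])
  have GG: "G (inv G x) = x" "inv G (G x) = x" for x using bG by (simp_all add: bij_is_inj
      bij_is_surj surj_f_inv_f)
  have \<delta>0: "\<delta> \<ge> 0" using close unfolding C1_close_def by (meson abs_ge_zero order_trans)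
  define \<theta> where "\<theta> x = M (inv G x)" for x
  define D\<theta> where "D\<theta> x = DM (inv G x) * (1 / DG (inv G x))" for x
  have \<theta>: "C1_lift \<theta> D\<theta>" unfolding \<theta>_def D\<theta>_def by (rule C1_lift_comp[OF M C1_lift_inv[OF G]])
  have near: "\<bar>\<theta> x - x\<bar> \<le> \<delta>" for x using close GG(1)[of x] unfolding C1_close_def \<theta>_def by metis
  have slope: "1 - \<delta> / \<beta> \<le> D\<theta> x" for x
  proof -
    define y where "y = inv G x"
    have DG: "DG y \<ge> \<beta>" "DG y > 0" using \<beta>(2)[of y] \<beta>(1) by auto
    have "\<bar>DM y - DG y\<bar> \<le> \<delta>" using close by (simp add: C1_close_def)
    then have "DM y \<ge> DG y - \<delta>" by linarith
    then have "DM y / DG y \<ge> (DG y - \<delta>) / DG y" using DG by (intro divide_right_mono) auto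
    also have "(DG y - \<delta>) / DG y = 1 - \<delta> / DG y" using DG by (simp add: diff_divide_distrib)
    finally have "DM y / DG y \<ge> 1 - \<delta> / DG y" .
    moreover have "\<delta> / DG y \<le> \<delta> / \<beta>" using DG \<beta> \<delta>0 by (intro divide_left_mono) auto
    ultimately show ?thesis by (simp add: D\<theta>_def y_def[symmetric])
  qed
  \<comment> \<open>Shrinking by \<open>\<delta>\<close> keeps the image of the arc under
    \<open>\<theta>\<close> inside \<open>[a, b]\<close>, where the ramp is affine;
    \<open>1 - \<delta> / \<beta>\<close> is a lower bound for the derivative of
    \<open>\<theta>\<close>.\<close>
  define a' b' \<kappa> where "a' = a + \<delta>" and "b' = b - \<delta>" and "\<kappa> = (1 - \<delta> / \<beta>) / (b - a)"
  have a'b': "a' < b'" "b' \<le> a' + 1" using small ab \<delta>0 by (simp_all add: a'_def b'_def)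
  have R: "mono (ramp a b)" "\<And>x. ramp a b (x + 1) = ramp a b x + 1"
    using ramp_mono[OF ab] ramp_degree_one by (auto simp: degree_one_def)
  have R\<theta>: "mono (\<lambda>x. ramp a b (\<theta> x))" "\<And>x. ramp a b (\<theta> (x + 1)) = ramp a b (\<theta> x) + 1"
    using R C1_liftD(1)[OF \<theta>] circle_lift_mono[OF C1_lift_circle_lift[OF \<theta>]] by (auto simp: mono_def
        degree_one_def)
  have 1: "mono (\<lambda>x. ramp a b x - \<kappa> * (b' - a') * ramp a' b' x)"
  proof (rule mono_minus_ramp[OF R a'b'])
    fix s t assume st: "a' \<le> s" "s \<le> t" "t \<le> b'"
    have "\<kappa> * (t - s) \<le> 1 / (b - a) * (t - s)"
      unfolding \<kappa>_def using \<delta>0 \<beta> ab st by (intro mult_right_mono divide_right_mono) auto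
    also have "\<dots> = ramp a b t - ramp a b s"
      using ramp_affine[OF ab, of s] ramp_affine[OF ab, of t] st \<delta>0 by (simp add: a'_def b'_def
          diff_divide_distrib)
    finally show "\<kappa> * (t - s) \<le> ramp a b t - ramp a b s" .
  qed
  have 2: "mono (\<lambda>x. ramp a b (\<theta> x) - \<kappa> * (b' - a') * ramp a' b' x)"
  proof (rule mono_minus_ramp[OF R\<theta> a'b'])
    fix s t assume st: "a' \<le> s" "s \<le> t" "t \<le> b'"
    have in_ab: "a \<le> \<theta> s" "\<theta> s \<le> b" "a \<le> \<theta> t" "\<theta> t \<le> b"
      using near[of s] near[of t] st by (auto simp: a'_def b'_def abs_le_iff)
    have "(1 - \<delta> / \<beta>) * (t - s) \<le> \<theta> t - \<theta> s"
    proof (cases "s = t")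
      case False
      then have "s < t" using st by simp
      then obtain \<xi> where "\<theta> t - \<theta> s = D\<theta> \<xi> * (t - s)" by (rule C1_lift_mvt[OF \<theta>])
      then show ?thesis using slope[of \<xi>] st by (simp add: mult_right_mono)
    qed simp
    then have "(1 - \<delta> / \<beta>) * (t - s) / (b - a) \<le> (\<theta> t - \<theta> s) / (b - a)"
      using ab by (intro divide_right_mono) auto
    also have "\<dots> = ramp a b (\<theta> t) - ramp a b (\<theta> s)"
      using in_ab by (simp add: ramp_affine[OF ab] diff_divide_distrib)
    finally show "\<kappa> * (t - s) \<le> ramp a b (\<theta> t) - ramp a b (\<theta> s)" by (simp add: \<kappa>_def)
  qed
  have "var_le (\<lambda>x. ramp a b (\<theta> x) - ramp a b x) (2 * (1 - \<kappa> * (b' - a')))"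
  proof (rule var_le_common_part[OF R\<theta>(2) R(2) _ 2 1])
    show "\<kappa> * (b' - a') * ramp a' b' (x + 1) = \<kappa> * (b' - a') * ramp a' b' x + \<kappa> * (b' - a')" for x
      using ramp_degree_one[of a' b'] by (simp add: degree_one_def distrib_left)
  qed
  moreover have "2 * (1 - \<kappa> * (b' - a')) \<le> \<delta> * (2 / \<beta> + 4 / (b - a))"
  proof -
    \<comment> \<open>The common mass is \<open>(1 - x) * (1 - y)\<close>, so at most
      \<open>x + y\<close> is missing from either measure.\<close>
    define x y where "x = \<delta> / \<beta>" and "y = 2 * \<delta> / (b - a)"
    have xy: "x \<ge> 0" "y \<ge> 0" using \<delta>0 \<beta> ab by (simp_all add: x_def y_def)
    have "(b' - a') / (b - a) = 1 - y" using ab by (simp add: a'_def b'_def y_def field_simps)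
    then have "\<kappa> * (b' - a') = (1 - x) * (1 - y)" unfolding \<kappa>_def x_def by (metis
        times_divide_eq_left times_divide_eq_right)
    also have "\<dots> = 1 - x - y + x * y" by (simp add: algebra_simps)
    finally have "2 * (1 - \<kappa> * (b' - a')) \<le> 2 * x + 2 * y" using mult_nonneg_nonneg[OF xy] by simp
    also have "\<dots> = \<delta> * (2 / \<beta> + 4 / (b - a))" by (simp add: x_def y_def distrib_left mult.commute)
    finally show ?thesis .
  qed
  ultimately have "var_le (\<lambda>x. ramp a b (\<theta> x) - ramp a b x) (\<delta> * (2 / \<beta> + 4 / (b - a)))" by (rule
      var_le_mono)
  from var_le_comp[OF this circle_lift_mono[OF GL]] GL
  show ?thesis by (simp add: \<theta>_def GG circle_lift_def)
qed

text \<open>Finitely many ramps are handled by the preceding estimate, and the remainder of the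
  approximation keeps its small variation under composition with any lift. For functions merely of
  bounded variation this continuity fails, as a jump shows.\<close>

lemma var_le_comp_C1_close:
  assumes u: "periodic u" "abs_continuous_on_interval 0 1 u" "var_le u C" and G: "C1_lift G DG" and
      \<epsilon>: "\<epsilon> > 0"
  obtains \<delta> where "\<delta> > 0" "\<And>M DM. C1_lift M DM \<Longrightarrow> C1_close \<delta> M DM G DG \<Longrightarrow> var_le (\<lambda>x. u (M x) - u (G
      x)) \<epsilon>"
proof -
  have e4: "\<epsilon> / 4 > 0" using \<epsilon> by simp
  obtain A :: "nat set" and s t \<Delta> where A: "finite A" "\<forall>i\<in>A. s i < t i \<and> t i \<le> s i + 1"
    and app: "var_le (\<lambda>x. u x - (\<Sum>i\<in>A. \<Delta> i * ramp (s i) (t i) x)) (\<epsilon> / 4)"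
    using abs_continuous_ramp_approximable[OF u e4] unfolding ramp_approximable_def by blast
  obtain \<beta> where \<beta>: "\<beta> > 0" "\<And>x. \<beta> \<le> DG x" using C1_lift_lower_bound[OF G] by blast
  \<comment> \<open>A third of the shortest arc, so that \<open>2 * \<delta>\<close> stays below
    every length, as \<open>var_le_ramp_C1_close\<close> demands.\<close>
  define e where "e = Min (insert 1 ((\<lambda>i. (t i - s i) / 3) ` A))"
  have "e \<in> insert 1 ((\<lambda>i. (t i - s i) / 3) ` A)" unfolding e_def by (intro Min_in) (use A in auto)
  then have e1: "e > 0" using A(2) by auto
  have e2: "e \<le> (t i - s i) / 3" if "i \<in> A" for i unfolding e_def using A(1) that by (intro Min_le) auto
  define K where "K = (\<Sum>i\<in>A. \<bar>\<Delta> i\<bar> * (2 / \<beta> + 4 / (t i - s i)))"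
  have K: "K \<ge> 0" unfolding K_def using A(2) \<beta> by (intro sum_nonneg mult_nonneg_nonneg
      add_nonneg_nonneg divide_nonneg_nonneg) (auto simp: less_imp_le)
  define \<delta> where "\<delta> = min e (\<epsilon> / (2 * (K + 1)))"
  have \<delta>: "\<delta> > 0" using e1 \<epsilon> K by (simp add: \<delta>_def)
  have "\<delta> * K \<le> \<epsilon> / (2 * (K + 1)) * K" using K by (intro mult_right_mono) (auto simp: \<delta>_def)
  also have "\<dots> \<le> \<epsilon> / 2" using K \<epsilon> by (simp add: field_simps)
  finally have \<delta>K: "\<delta> * K \<le> \<epsilon> / 2" .
  show thesis
  proof (rule that[OF \<delta>])
    fix M DM assume M: "C1_lift M DM" and close: "C1_close \<delta> M DM G DG"
    have GL: "circle_lift G" and LM: "circle_lift M" using G M by (auto intro: C1_lift_circle_lift)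
    define r where "r x = u x - (\<Sum>i\<in>A. \<Delta> i * ramp (s i) (t i) x)" for x
    have r: "var_le (\<lambda>x. r (M x)) (\<epsilon> / 4)" "var_le (\<lambda>x. r (G x)) (\<epsilon> / 4)"
      unfolding r_def using var_le_comp[OF app circle_lift_mono[OF GL]] var_le_comp[OF app
          circle_lift_mono[OF LM]] GL LM
      by (auto simp: circle_lift_def)
    have "var_le (\<lambda>x. \<Sum>i\<in>A. \<Delta> i * (ramp (s i) (t i) (M x) - ramp (s i) (t i) (G x))) (\<Sum>i\<in>A. \<bar>\<Delta> i\<bar> *
        (\<delta> * (2 / \<beta> + 4 / (t i - s i))))"
    proof (intro var_le_sum var_le_cmult)
      fix i assume i: "i \<in> A"
      have st: "s i < t i" "t i \<le> s i + 1" using A(2) i by auto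
      have "2 * \<delta> < t i - s i" using e2[OF i] st by (simp add: \<delta>_def)
      then show "var_le (\<lambda>x. ramp (s i) (t i) (M x) - ramp (s i) (t i) (G x)) (\<delta> * (2 / \<beta> + 4 / (t i
          - s i)))"
        by (rule var_le_ramp_C1_close[OF G M st \<beta> close])
    qed
    moreover have "(\<Sum>i\<in>A. \<bar>\<Delta> i\<bar> * (\<delta> * (2 / \<beta> + 4 / (t i - s i)))) = \<delta> * K"
      unfolding K_def sum_distrib_left by (intro sum.cong) auto
    ultimately have ramps: "var_le (\<lambda>x. \<Sum>i\<in>A. \<Delta> i * (ramp (s i) (t i) (M x) - ramp (s i) (t i) (G
        x))) (\<epsilon> / 2)"
      using \<delta>K var_le_mono by simp
    have "var_le (\<lambda>x. (\<Sum>i\<in>A. \<Delta> i * (ramp (s i) (t i) (M x) - ramp (s i) (t i) (G x))) + (r (M x) - r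
        (G x))) (\<epsilon> / 2 + (\<epsilon> / 4 + \<epsilon> / 4))"
      by (intro var_le_add var_le_diff ramps r)
    moreover have "(\<Sum>i\<in>A. \<Delta> i * (ramp (s i) (t i) (M x) - ramp (s i) (t i) (G x))) + (r (M x) - r (G
        x)) = u (M x) - u (G x)" for x
      by (simp add: r_def right_diff_distrib sum_subtractf)
    ultimately show "var_le (\<lambda>x. u (M x) - u (G x)) \<epsilon>" by simp
  qed
qed

text \<open>The difference is \<open>u (M^j (M x)) - u (G^j (M x))\<close>, the induction hypothesis
  composed with \<open>M\<close>, plus a single step for the fixed function
  \<open>u \<circ> G^j\<close>. Splitting in this order keeps \<open>M\<close> out of the function
  to which the continuity of composition is applied.\<close>

lemma var_le_funpow_C1_close:
  assumes u: "periodic u" "abs_continuous_on_interval 0 1 u" "var_le u C" and G: "C1_lift G DG" and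
      \<epsilon>: "\<epsilon> > 0"
  shows "\<exists>\<delta>>0. \<forall>M DM. C1_lift M DM \<longrightarrow> C1_close \<delta> M DM G DG \<longrightarrow> var_le (\<lambda>x. u ((M ^^ j) x) - u ((G ^^ j)
      x)) \<epsilon>"
  using \<epsilon>
proof (induction j arbitrary: \<epsilon>)
  case 0
  then show ?case by (intro exI[of _ 1]) (simp add: var_le_const)
next
  case (Suc j)
  then have e2: "\<epsilon> / 2 > 0" by simp
  have Gj: "C1_lift (G ^^ j) (\<lambda>x. exp (orbit_sum G j (\<lambda>x. ln (DG x)) x))" by (rule C1_lift_funpow[OF G])
  have GjL: "circle_lift (G ^^ j)" by (rule C1_lift_circle_lift[OF Gj])
  obtain \<delta>1 where \<delta>1: "\<delta>1 > 0" "\<And>M DM. C1_lift M DM \<Longrightarrow> C1_close \<delta>1 M DM G DG \<Longrightarrow> var_le (\<lambda>x. u ((M ^^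
      j) x) - u ((G ^^ j) x)) (\<epsilon> / 2)"
    using Suc.IH[OF e2] by blast
  have per: "periodic (\<lambda>x. u ((G ^^ j) x))" using GjL by (intro periodic_comp[OF u(1)]) (simp add:
      circle_lift_def)
  have ac: "abs_continuous_on_interval 0 1 (\<lambda>x. u ((G ^^ j) x))" by (rule abs_continuous_comp[OF
      u(1,2) Gj])
  have var: "var_le (\<lambda>x. u ((G ^^ j) x)) C" using GjL by (intro var_le_comp[OF u(3)]
      circle_lift_mono) (simp_all add: circle_lift_def)
  obtain \<delta>2 where \<delta>2: "\<delta>2 > 0" "\<And>M DM. C1_lift M DM \<Longrightarrow> C1_close \<delta>2 M DM G DG \<Longrightarrow> var_le (\<lambda>x. u ((G ^^
      j) (M x)) - u ((G ^^ j) (G x))) (\<epsilon> / 2)"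
    using var_le_comp_C1_close[OF per ac var G e2] by blast
  show ?case
  proof (intro exI[of _ "min \<delta>1 \<delta>2"] conjI allI impI)
    fix M DM assume M: "C1_lift M DM" and close: "C1_close (min \<delta>1 \<delta>2) M DM G DG"
    have LM: "circle_lift M" by (rule C1_lift_circle_lift[OF M])
    have 1: "var_le (\<lambda>x. u ((M ^^ j) x) - u ((G ^^ j) x)) (\<epsilon> / 2)" by (rule \<delta>1(2)[OF M
        C1_close_mono[OF close]]) simp
    have "var_le (\<lambda>x. u ((M ^^ j) (M x)) - u ((G ^^ j) (M x))) (\<epsilon> / 2)"
      using var_le_comp[OF 1 circle_lift_mono[OF LM]] LM by (simp add: circle_lift_def)
    moreover have "var_le (\<lambda>x. u ((G ^^ j) (M x)) - u ((G ^^ j) (G x))) (\<epsilon> / 2)"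
      by (rule \<delta>2(2)[OF M C1_close_mono[OF close]]) simp
    ultimately have "var_le (\<lambda>x. (u ((M ^^ j) (M x)) - u ((G ^^ j) (M x))) + (u ((G ^^ j) (M x)) - u
        ((G ^^ j) (G x)))) (\<epsilon> / 2 + \<epsilon> / 2)"
      by (rule var_le_add)
    then show "var_le (\<lambda>x. u ((M ^^ Suc j) x) - u ((G ^^ Suc j) x)) \<epsilon>"
      by (simp add: funpow_Suc_right del: funpow.simps)
  qed (use \<delta>1 \<delta>2 in simp)
qed

lemma var_le_average_C1_close:
  assumes u: "periodic u" "abs_continuous_on_interval 0 1 u" "var_le u C" and G: "C1_lift G DG" and
      \<epsilon>: "\<epsilon> > 0"
  shows "\<exists>\<delta>>0. \<forall>M DM. C1_lift M DM \<longrightarrow> C1_close \<delta> M DM G DG \<longrightarrow> var_le (\<lambda>x. average M n u x - average G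
      n u x) \<epsilon>"
proof -
  have "\<forall>j. \<exists>\<delta>>0. \<forall>M DM. C1_lift M DM \<longrightarrow> C1_close \<delta> M DM G DG \<longrightarrow> var_le (\<lambda>x. u ((M ^^ j) x) - u ((G ^^
      j) x)) \<epsilon>"
    using var_le_funpow_C1_close[OF u G \<epsilon>] by blast
  from choice[OF this] obtain d where d: "\<And>j. d j > 0" "\<And>j M DM. C1_lift M DM \<Longrightarrow> C1_close (d j) M DM
      G DG \<Longrightarrow>
     var_le (\<lambda>x. u ((M ^^ j) x) - u ((G ^^ j) x)) \<epsilon>" by blast
  define \<delta> where "\<delta> = Min (insert 1 (d ` {..<n}))"
  have "\<delta> \<in> insert 1 (d ` {..<n})" unfolding \<delta>_def by (intro Min_in) auto
  then have "\<delta> > 0" using d(1) by auto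
  moreover have \<delta>d: "\<delta> \<le> d j" if "j < n" for j unfolding \<delta>_def using that by (intro Min_le) auto
  moreover have "var_le (\<lambda>x. average M n u x - average G n u x) \<epsilon>" if M: "C1_lift M DM" and close:
      "C1_close \<delta> M DM G DG" for M DM
  proof -
    have "var_le (\<lambda>x. 1 / real n * (\<Sum>j<n. u ((M ^^ j) x) - u ((G ^^ j) x))) (\<bar>1 / real n\<bar> * (\<Sum>j<n. \<epsilon>))"
      by (intro var_le_cmult var_le_sum d(2)[OF M C1_close_mono[OF close \<delta>d]]) simp
    then have "var_le (\<lambda>x. 1 / real n * (\<Sum>j<n. u ((M ^^ j) x) - u ((G ^^ j) x))) \<epsilon>"
      by (rule var_le_mono) (use \<epsilon> in simp)
    then show ?thesis by (simp add: average_def[abs_def] orbit_sum_def sum_subtractf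
        diff_divide_distrib)
  qed
  ultimately show ?thesis by blast
qed

text \<open>\<open>u\<close> differs from its average over \<open>m\<close> steps by a mean of
  coboundaries whose Birkhoff sums have variation at most \<open>2 * m * C\<close>. A bound at one
  time \<open>m\<close> thus carries over to long averages, with an error that does not depend on
  \<open>M\<close>.\<close>

lemma var_le_average_long:
  assumes M: "circle_lift M" and u: "var_le u C" and m: "m > 0" "var_le (average M m u) B" and n: "n
      > 0"
  shows "var_le (average M n u) (B + 2 * real m * C / real n)"
proof -
  have C: "C \<ge> 0" by (rule var_le_nonneg[OF u])
  define v where "v x = 1 / real m * (\<Sum>j<m. orbit_sum M n (\<lambda>x. u x - u ((M ^^ j) x)) x)" for x
  have "var_le v (\<bar>1 / real m\<bar> * (\<Sum>j<m. 2 * real m * C))"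
    unfolding v_def
  proof (intro var_le_cmult var_le_sum)
    fix j assume "j \<in> {..<m}"
    then have "2 * real j * C \<le> 2 * real m * C" using C by (intro mult_right_mono) auto
    then show "var_le (orbit_sum M n (\<lambda>x. u x - u ((M ^^ j) x))) (2 * real m * C)"
      using var_le_orbit_sum_coboundary[OF M u] var_le_mono by blast
  qed
  then have v: "var_le v (2 * real m * C)" using m by simp
  have "var_le (\<lambda>x. average M n (average M m u) x + 1 / real n * v x) (B + \<bar>1 / real n\<bar> * (2 * real
      m * C))"
    by (intro var_le_add var_le_cmult v var_le_average[OF M m(2)])
  moreover have "average M n (average M m u) x + 1 / real n * v x = average M n u x" for x
  proof -
    have "(\<Sum>j<m. orbit_sum M n (\<lambda>x. u x - u ((M ^^ j) x)) x) = (\<Sum>i<n. \<Sum>j<m. u ((M ^^ i) x) - u ((M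
        ^^ j) ((M ^^ i) x)))"
      unfolding orbit_sum_def by (rule sum.swap)
    also have "\<dots> = (\<Sum>i<n. real m * u ((M ^^ i) x) - orbit_sum M m u ((M ^^ i) x))"
      by (simp add: sum_subtractf orbit_sum_def)
    also have "\<dots> = (\<Sum>i<n. real m * (u ((M ^^ i) x) - average M m u ((M ^^ i) x)))"
      using m by (simp add: average_def right_diff_distrib)
    also have "\<dots> = real m * (orbit_sum M n u x - orbit_sum M n (average M m u) x)"
      by (simp add: sum_distrib_left[symmetric] sum_subtractf orbit_sum_def)
    finally have "v x = orbit_sum M n u x - orbit_sum M n (average M m u) x" using m by (simp add:
        v_def)
    then show ?thesis by (simp add: average_def[of M n] diff_divide_distrib)
  qed
  ultimately show ?thesis by simp
qed

text \<open>Convergence together with derivatives is established first, from the uniform smallness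
  of \<open>e\<close>, and is then used to bound the variation of \<open>e\<close>: \<open>m\<close>
  is fixed by \<open>G\<close>, closeness at time \<open>m\<close> follows from the convergence, and
  \<open>n\<close> is large against \<open>m\<close>.\<close>

theorem conjugates_converge:
  assumes F: "C1_irrational_lift F \<rho> D V" and G: "C1_irrational_lift G \<rho> DG W"
    and acF: "abs_continuous_on_interval 0 1 (\<lambda>x. ln (D x))"
    and acG: "abs_continuous_on_interval 0 1 (\<lambda>x. ln (DG x))"
  obtains H E DM :: "nat \<Rightarrow> real \<Rightarrow> real" where "\<And>n. C1_lift (H n) (E n)" "\<And>n. \<exists>B. var_le (\<lambda>x. ln (E n
      x)) B"
    "\<And>n. C1_lift (\<lambda>y. H n (F (inv (H n) y))) (DM n)"
    "\<And>\<epsilon>. \<epsilon> > 0 \<Longrightarrow> \<exists>N. \<forall>n\<ge>N. C1_close \<epsilon> (\<lambda>y. H n (F (inv (H n) y))) (DM n) G DG \<and>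
       var_le (\<lambda>x. ln (1 / DG (inv G (H n (F (inv (H n) x)))) * DM n x)) \<epsilon> \<and>
       var_le (\<lambda>x. ln (DM n (inv G x) * (1 / DG (inv G x)))) \<epsilon>"
proof -
  interpret F: C1_irrational_lift F \<rho> D V by (rule F)
  interpret G: C1_irrational_lift G \<rho> DG W by (rule G)
  define w where "w x = ln (DG x)" for x
  define \<phi> where "\<phi> x = ln (D x)" for x
  have w: "periodic w" "abs_continuous_on_interval 0 1 w" "var_le w W"
    using G.periodic_log acG G.var_log by (simp_all add: w_def[abs_def])
  have \<phi>: "periodic \<phi>" "abs_continuous_on_interval 0 1 \<phi>" "var_le \<phi> V"
    using F.periodic_log acF F.var_log by (simp_all add: \<phi>_def[abs_def])
  have wc: "continuous_on UNIV w"
    unfolding w_def using C1_liftD(3,4)[OF G.C1] by (auto intro!: continuous_intros simp: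
        order_less_imp_not_eq2)
  have "\<forall>n. \<exists>H E DM. C1_lift H E \<and> C1_lift (\<lambda>y. H (F (inv H y))) DM \<and>
    (\<forall>y. ln (DM y) = w y - average (\<lambda>y. H (F (inv H y))) (Suc n) w y + average F (Suc n) \<phi> (inv H y)) \<and>
    (\<exists>B. var_le (\<lambda>x. ln (E x)) B)"
  proof
    fix n
    obtain H E DM where "C1_lift H E" "C1_lift (\<lambda>y. H (F (inv H y))) DM"
      "\<And>y. ln (DM y) = w y - average (\<lambda>y. H (F (inv H y))) (Suc n) w y + average F (Suc n) (\<lambda>x. ln
          (D x)) (inv H y)"
      "\<And>C V. var_le w C \<Longrightarrow> var_le (\<lambda>x. ln (D x)) V \<Longrightarrow> \<exists>B. var_le (\<lambda>x. ln (E x)) B"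
      by (rule approximate_conjugacy[OF F.C1 w(1) wc, of "Suc n"]) auto
    then show "\<exists>H E DM. C1_lift H E \<and> C1_lift (\<lambda>y. H (F (inv H y))) DM \<and>
      (\<forall>y. ln (DM y) = w y - average (\<lambda>y. H (F (inv H y))) (Suc n) w y + average F (Suc n) \<phi> (inv H
          y)) \<and>
      (\<exists>B. var_le (\<lambda>x. ln (E x)) B)"
      using w(3) F.var_log unfolding \<phi>_def[abs_def] by blast
  qed
  then obtain H E DM where HE: "\<And>n. C1_lift (H n) (E n)" and M0: "\<And>n. C1_lift (\<lambda>y. H n (F (inv (H n)
      y))) (DM n)"
    and ln0: "\<And>n y. ln (DM n y) = w y - average (\<lambda>y. H n (F (inv (H n) y))) (Suc n) w y + average F
        (Suc n) \<phi> (inv (H n) y)"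
    and varE: "\<And>n. \<exists>B. var_le (\<lambda>x. ln (E n x)) B"
    by metis
  define M where "M n y = H n (F (inv (H n) y))" for n y
  have M: "C1_lift (M n) (DM n)" for n using M0[of n] by (simp add: M_def[abs_def])
  define e where "e n y = average (M n) (Suc n) w y - average F (Suc n) \<phi> (inv (H n) y)" for n y
  have lnM: "ln (DM n y) = w y - e n y" for n y unfolding e_def M_def[abs_def] ln0 by simp
  have HL: "circle_lift (H n)" for n by (rule C1_lift_circle_lift[OF HE])
  have HiL: "circle_lift (inv (H n))" for n by (rule circle_lift_inv[OF HL])
  have LM: "circle_lift (M n)" for n by (rule C1_lift_circle_lift[OF M])
  have HH: "inv (H n) (H n x) = x" for n x using circle_lift_bij[OF HL] by (simp add: bij_is_inj)
  have Mtr: "translation_number (M n) \<rho>" for n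
  proof (rule translation_number_conj[OF _ _ F.trans HL[of n]])
    show "mono F" "degree_one F" "mono (M n)" "degree_one (M n)"
      using F.lift LM circle_lift_mono by (auto simp: circle_lift_def)
    show "M n (H n x) = H n (F x)" for x by (simp add: M_def HH)
  qed
  have pos: "DM n x > 0" "DG x > 0" for n x using C1_liftD(3)[OF M] C1_liftD(3)[OF G.C1] by auto
  obtain BG where BG: "\<And>x. \<bar>DG x\<bar> \<le> BG"
    using periodic_continuous_bound[OF C1_lift_periodic[OF G.C1] C1_liftD(4)[OF G.C1]] by blast
  have BG0: "BG > 0" using BG[of 0] pos(2)[of 0] by linarith
  have e_small: "\<exists>N. \<forall>n\<ge>N. \<forall>x. \<bar>e n x\<bar> \<le> \<epsilon>" if \<epsilon>: "\<epsilon> > 0" for \<epsilon>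
  proof -
    have e2: "\<epsilon> / 2 > 0" using \<epsilon> by simp
    obtain N1 where N1: "\<And>n M u x y. n \<ge> N1 \<Longrightarrow> circle_lift M \<Longrightarrow> translation_number M \<rho> \<Longrightarrow> periodic u \<Longrightarrow>
     var_le u W \<Longrightarrow> \<bar>average M n u x - average M n u y\<bar> \<le> \<epsilon> / 2"
      using average_oscillation[OF G.irr e2, of W] by blast
    obtain N2 where N2: "\<And>n M u x y. n \<ge> N2 \<Longrightarrow> circle_lift M \<Longrightarrow> translation_number M \<rho> \<Longrightarrow> periodic u \<Longrightarrow>
     var_le u V \<Longrightarrow> \<bar>average M n u x - average M n u y\<bar> \<le> \<epsilon> / 2"
      using average_oscillation[OF G.irr e2, of V] by blast
    have "\<bar>e n x\<bar> \<le> \<epsilon>" if n: "n \<ge> max N1 N2" for n x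
    proof -
      \<comment> \<open>\<open>M n - G\<close> is periodic, so the two derivatives agree somewhere,
        and there \<open>e n\<close> vanishes.\<close>
      obtain \<xi> where \<xi>: "DM n \<xi> = DG \<xi>"
      proof -
        have "((\<lambda>x. M n x - G x) has_real_derivative DM n x - DG x) (at x)" for x
          by (rule DERIV_diff[OF C1_liftD(2)[OF M] C1_liftD(2)[OF G.C1]])
        then obtain \<xi> where "(M n 1 - G 1) - (M n 0 - G 0) = (1 - 0) * (DM n \<xi> - DG \<xi>)"
          using MVT2[of 0 1 "\<lambda>x. M n x - G x" "\<lambda>x. DM n x - DG x"] by auto
        moreover have "M n (0 + 1) = M n 0 + 1" "G (0 + 1) = G 0 + 1"
          using C1_liftD(1)[OF M[of n]] C1_liftD(1)[OF G.C1] unfolding degree_one_def by blast+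
        ultimately have "DM n \<xi> = DG \<xi>" by simp
        then show ?thesis by (rule that)
      qed
      then have "e n \<xi> = 0" using lnM[of n \<xi>] by (simp add: w_def)
      moreover have "\<bar>average (M n) (Suc n) w x - average (M n) (Suc n) w \<xi>\<bar> \<le> \<epsilon> / 2"
        by (rule N1[OF _ LM Mtr w(1,3)]) (use n in simp)
      moreover have "\<bar>average F (Suc n) \<phi> (inv (H n) x) - average F (Suc n) \<phi> (inv (H n) \<xi>)\<bar> \<le> \<epsilon> / 2"
        by (rule N2[OF _ F.lift F.trans \<phi>(1,3)]) (use n in simp)
      ultimately show ?thesis unfolding e_def by linarith
    qed
    then show ?thesis by blast
  qed
  have close: "\<exists>N. \<forall>n\<ge>N. C1_close \<epsilon> (M n) (DM n) G DG" if \<epsilon>: "\<epsilon> > 0" for \<epsilon>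
  proof -
    \<comment> \<open>Makes \<open>BG * (exp \<eta> - 1)\<close> equal to
      \<open>\<epsilon> / 2\<close>.\<close>
    define \<eta> where "\<eta> = ln (1 + \<epsilon> / (2 * BG))"
    have \<eta>: "\<eta> > 0" "exp \<eta> = 1 + \<epsilon> / (2 * BG)" using \<epsilon> BG0 by (simp_all add: \<eta>_def add_pos_pos)
    obtain N where N: "\<And>n x. n \<ge> N \<Longrightarrow> \<bar>e n x\<bar> \<le> \<eta>" using e_small[OF \<eta>(1)] by blast
    have "C1_close \<epsilon> (M n) (DM n) G DG" if n: "n \<ge> N" for n
    proof -
      have D: "\<bar>DM n x - DG x\<bar> \<le> \<epsilon> / 2" for x
      proof -
        have "DM n x = exp (ln (DM n x))" using pos by simp
        also have "\<dots> = DG x * exp (- e n x)" unfolding lnM w_def exp_diff exp_minus using pos by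
            (simp add: divide_inverse)
        finally have eq: "DM n x - DG x = DG x * (exp (- e n x) - 1)" by (simp add: algebra_simps)
        have "exp (- e n x) \<le> exp \<eta>" "exp (- \<eta>) \<le> exp (- e n x)" using N[OF n, of x] by (auto simp:
            abs_le_iff)
        \<comment> \<open>This is \<open>cosh \<eta> \<ge> 1\<close>; it makes the lower bound for
          \<open>exp (- e n x) - 1\<close> no worse than the upper one.\<close>
        moreover have "2 - exp \<eta> \<le> exp (- \<eta>)"
        proof -
          have "0 \<le> (exp \<eta> - 1)\<^sup>2 / exp \<eta>" by simp
          also have "(exp \<eta> - 1)\<^sup>2 / exp \<eta> = exp \<eta> - 2 + exp (- \<eta>)" by (simp add: exp_minus
              field_simps power2_eq_square)
          finally show ?thesis by simp
        qed
        ultimately have "\<bar>exp (- e n x) - 1\<bar> \<le> \<epsilon> / (2 * BG)" using \<eta>(2) by linarith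
        then have "\<bar>DG x\<bar> * \<bar>exp (- e n x) - 1\<bar> \<le> BG * (\<epsilon> / (2 * BG))" using BG BG0 by (intro
            mult_mono) auto
        then show ?thesis unfolding eq abs_mult using BG0 by simp
      qed
      have osc: "\<bar>(M n x - G x) - (M n y - G y)\<bar> \<le> \<epsilon> / 2" for x y
      proof -
        have main: "\<bar>(M n y - G y) - (M n x - G x)\<bar> \<le> \<epsilon> / 2" if xy: "x \<le> y" "y \<le> x + 1" for x y
        proof (cases "x = y")
          case False
          then have lt: "x < y" using xy by simp
          have "((\<lambda>x. M n x - G x) has_real_derivative DM n x - DG x) (at x)" for x
            by (rule DERIV_diff[OF C1_liftD(2)[OF M] C1_liftD(2)[OF G.C1]])
          then obtain \<xi> where "(M n y - G y) - (M n x - G x) = (y - x) * (DM n \<xi> - DG \<xi>)"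
            using MVT2[OF lt, of "\<lambda>x. M n x - G x" "\<lambda>x. DM n x - DG x"] by auto
          then have "\<bar>(M n y - G y) - (M n x - G x)\<bar> = (y - x) * \<bar>DM n \<xi> - DG \<xi>\<bar>" using lt by (simp
              add: abs_mult)
          also have "\<dots> \<le> 1 * (\<epsilon> / 2)" using xy D[of \<xi>] by (intro mult_mono) auto
          finally show ?thesis by simp
        qed (use \<epsilon> in simp)
        have "periodic (\<lambda>x. M n x - G x)"
          using LM[of n] G.lift by (intro periodic_diff_degree_one) (auto simp: circle_lift_def)
        then obtain z where "x \<le> z" "z < x + 1" "M n z - G z = M n y - G y"
          using periodic_reduce[of "\<lambda>x. M n x - G x" x y] by metis
        then show ?thesis using main[of x z] by (simp add: abs_minus_commute)
      qed
      have "\<bar>M n x - G x\<bar> \<le> \<epsilon>" for x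
        by (rule G.translation_number_rigid[OF \<epsilon> circle_lift_mono[OF LM] Mtr osc])
      moreover have "\<bar>DM n x - DG x\<bar> \<le> \<epsilon>" for x using D[of x] \<epsilon> by linarith
      ultimately show ?thesis by (simp add: C1_close_def)
    qed
    then show ?thesis by blast
  qed
  have var_e: "\<exists>N. \<forall>n\<ge>N. var_le (e n) \<epsilon>" if \<epsilon>: "\<epsilon> > 0" for \<epsilon>
  proof -
    have e2: "\<epsilon> / 2 > 0" and e8: "\<epsilon> / 8 > 0" using \<epsilon> by simp_all
    obtain N1 where N1: "\<And>n. n \<ge> N1 \<Longrightarrow> var_le (average F n \<phi>) (\<epsilon> / 2)"
      using F.average_variation_tendsto_0[OF \<phi> e2] by blast
    obtain m0 where m0: "\<And>n. n \<ge> m0 \<Longrightarrow> var_le (average G n w) (\<epsilon> / 8)"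
      using G.average_variation_tendsto_0[OF w e8] by blast
    define m where "m = Suc m0"
    have m: "m > 0" "var_le (average G m w) (\<epsilon> / 8)" using m0 by (simp_all add: m_def)
    obtain \<delta> where \<delta>: "\<delta> > 0" "\<And>M DM. C1_lift M DM \<Longrightarrow> C1_close \<delta> M DM G DG \<Longrightarrow> var_le (\<lambda>x. average M m
        w x - average G m w x) (\<epsilon> / 8)"
      using var_le_average_C1_close[OF w G.C1 e8, of m] by blast
    obtain N2 where N2: "\<And>n. n \<ge> N2 \<Longrightarrow> C1_close \<delta> (M n) (DM n) G DG" using close[OF \<delta>(1)] by blast
    obtain N3 :: nat where N3: "8 * real m * W / \<epsilon> < real N3" using reals_Archimedean2 by blast
    have "var_le (e n) \<epsilon>" if n: "n \<ge> max N1 (max N2 N3)" for n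
    proof -
      have "var_le (\<lambda>x. (average (M n) m w x - average G m w x) + average G m w x) (\<epsilon> / 8 + \<epsilon> / 8)"
        by (intro var_le_add m \<delta>(2)[OF M N2]) (use n in simp)
      then have "var_le (average (M n) m w) (\<epsilon> / 4)" by simp
      from var_le_average_long[OF LM w(3) m(1) this, of "Suc n"]
      have "var_le (average (M n) (Suc n) w) (\<epsilon> / 4 + 2 * real m * W / real (Suc n))" by simp
      moreover have "2 * real m * W / real (Suc n) \<le> \<epsilon> / 4"
      proof -
        have "8 * real m * W / \<epsilon> < real (Suc n)" using N3 n by simp
        then show ?thesis using \<epsilon> by (simp add: field_simps del: of_nat_Suc)
      qed
      ultimately have 1: "var_le (average (M n) (Suc n) w) (\<epsilon> / 2)" by (elim var_le_mono) simp
      have 2: "var_le (\<lambda>x. average F (Suc n) \<phi> (inv (H n) x)) (\<epsilon> / 2)"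
        using HiL[of n] n by (intro var_le_comp[OF N1] circle_lift_mono) (auto simp: circle_lift_def)
      from var_le_diff[OF 1 2] show ?thesis by (simp add: e_def[abs_def])
    qed
    then show ?thesis by blast
  qed
  have GiC: "C1_lift (inv G) (\<lambda>x. 1 / DG (inv G x))" by (rule C1_lift_inv[OF G.C1])
  have GiL: "circle_lift (inv G)" by (rule C1_lift_circle_lift[OF GiC])
  have GG: "inv G (G x) = x" for x using G.bijF by (simp add: bij_is_inj)
  have final: "\<exists>N. \<forall>n\<ge>N. C1_close \<epsilon> (M n) (DM n) G DG \<and>
       var_le (\<lambda>x. ln (1 / DG (inv G (M n x)) * DM n x)) \<epsilon> \<and>
       var_le (\<lambda>x. ln (DM n (inv G x) * (1 / DG (inv G x)))) \<epsilon>" if \<epsilon>: "\<epsilon> > 0" for \<epsilon>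
  proof -
    have e2: "\<epsilon> / 2 > 0" using \<epsilon> by simp
    \<comment> \<open>As \<open>w = w' \<circ> G\<close>, the logarithm of the derivative of
      \<open>inv G \<circ> M n\<close> is \<open>- (w' \<circ> M n - w' \<circ> G) - e n\<close>,
      and continuity of composition applies to the first part.\<close>
    define w' where "w' x = w (inv G x)" for x
    have w': "periodic w'" "abs_continuous_on_interval 0 1 w'" "var_le w' W"
      unfolding w'_def using GiL circle_lift_mono[OF GiL] abs_continuous_comp[OF w(1,2) GiC]
      by (auto intro!: periodic_comp[OF w(1)] var_le_comp[OF w(3)] simp: circle_lift_def)
    obtain \<delta> where \<delta>: "\<delta> > 0" "\<And>M DM. C1_lift M DM \<Longrightarrow> C1_close \<delta> M DM G DG \<Longrightarrow> var_le (\<lambda>x. w' (M x) -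
        w' (G x)) (\<epsilon> / 2)"
      using var_le_comp_C1_close[OF w' G.C1 e2] by blast
    obtain N1 where N1: "\<And>n. n \<ge> N1 \<Longrightarrow> var_le (e n) (\<epsilon> / 2)" using var_e[OF e2] by blast
    obtain N2 where N2: "\<And>n. n \<ge> N2 \<Longrightarrow> C1_close \<delta> (M n) (DM n) G DG" using close[OF \<delta>(1)] by blast
    obtain N3 where N3: "\<And>n. n \<ge> N3 \<Longrightarrow> C1_close \<epsilon> (M n) (DM n) G DG" using close[OF \<epsilon>] by blast
    have "C1_close \<epsilon> (M n) (DM n) G DG \<and> var_le (\<lambda>x. ln (1 / DG (inv G (M n x)) * DM n x)) \<epsilon> \<and>
       var_le (\<lambda>x. ln (DM n (inv G x) * (1 / DG (inv G x)))) \<epsilon>" if n: "n \<ge> max N1 (max N2 N3)" for n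
    proof (intro conjI)
      show "C1_close \<epsilon> (M n) (DM n) G DG" using N3 n by simp
      have ve: "var_le (e n) (\<epsilon> / 2)" using N1 n by simp
      have nz: "DG z \<noteq> 0" "DM n z \<noteq> 0" for z using pos(2)[of z] pos(1)[of n z] by simp_all
      have "var_le (\<lambda>x. - (w' (M n x) - w' (G x)) - e n x) (\<epsilon> / 2 + \<epsilon> / 2)"
        by (intro var_le_diff var_le_uminus ve \<delta>(2)[OF M N2]) (use n in simp)
      moreover have eq1: "- (w' (M n x) - w' (G x)) - e n x = ln (1 / DG (inv G (M n x)) * DM n x)"
          for x
      proof -
        have "ln (1 / DG (inv G (M n x)) * DM n x) = ln (DM n x) - ln (DG (inv G (M n x)))"
          using pos nz by (simp add: ln_div)
        then show ?thesis unfolding lnM w'_def GG by (simp add: w_def)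
      qed
      ultimately show "var_le (\<lambda>x. ln (1 / DG (inv G (M n x)) * DM n x)) \<epsilon>" unfolding eq1 by simp
      have "var_le (\<lambda>x. - e n (inv G x)) (\<epsilon> / 2)"
        using GiL by (intro var_le_uminus var_le_comp[OF ve] circle_lift_mono) (auto simp:
            circle_lift_def)
      moreover have eq2: "- e n (inv G x) = ln (DM n (inv G x) * (1 / DG (inv G x)))" for x
        using pos nz lnM[of n "inv G x"] by (simp add: ln_div w_def)
      ultimately have "var_le (\<lambda>x. ln (DM n (inv G x) * (1 / DG (inv G x)))) (\<epsilon> / 2)" by (simp only:
          eq2)
      then show "var_le (\<lambda>x. ln (DM n (inv G x) * (1 / DG (inv G x)))) \<epsilon>" by (rule var_le_mono) (use
          \<epsilon> in simp)
    qed
    then show ?thesis by blast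
  qed
  show thesis by (rule that[OF HE varE M0 final[unfolded M_def[abs_def]]])
qed

section \<open>Circle diffeomorphisms and their lifts\<close>

lemma to_circle_add_int: "to_circle (x + of_int k) = to_circle x"
  by (simp add: to_circle_eq_iff)

lemma dist_to_circle_le: "dist (to_circle x) (to_circle y) \<le> \<bar>x - y\<bar>"
  using Z_dist_le[of "x - y" 0] by (simp add: dist_circle.abs_eq)

lemma near_representative:
  obtains y where "to_circle y = q" "\<bar>y - x\<bar> = dist q (to_circle x)"
proof -
  obtain z where z: "to_circle z = q" using to_circle_surj by blast
  define y where "y = z + of_int (- round (z - x))"
  have "to_circle y = q" unfolding y_def to_circle_add_int by (rule z)
  moreover have "\<bar>y - x\<bar> = dist q (to_circle x)"
    unfolding z[symmetric] dist_circle.abs_eq Z_dist_round by (simp add: y_def algebra_simps)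
  ultimately show ?thesis by (rule that)
qed

lemma continuous_on_to_circle: "continuous_on UNIV to_circle"
  unfolding continuous_on_iff
proof (intro ballI allI impI)
  fix x e :: real assume "e > 0"
  then show "\<exists>d>0. \<forall>x'\<in>UNIV. dist x' x < d \<longrightarrow> dist (to_circle x') (to_circle x) < e"
    using dist_to_circle_le by (intro exI[of _ e]) (auto simp: dist_real_def intro: le_less_trans)
qed

lemma continuous_on_circle_iff:
  fixes u :: "circle \<Rightarrow> real"
  shows "continuous_on UNIV u \<longleftrightarrow> continuous_on UNIV (\<lambda>x. u (to_circle x))"
proof
  assume "continuous_on UNIV u"
  then show "continuous_on UNIV (\<lambda>x. u (to_circle x))"
    using continuous_on_compose2[OF _ continuous_on_to_circle] by blast
next
  assume c: "continuous_on UNIV (\<lambda>x. u (to_circle x))"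
  show "continuous_on UNIV u"
    unfolding continuous_on_iff
  proof (intro ballI allI impI)
    fix p and e :: real assume e: "e > 0"
    obtain x where p: "to_circle x = p" using to_circle_surj by blast
    obtain d where d: "d > 0" "\<And>y. dist y x < d \<Longrightarrow> dist (u (to_circle y)) (u (to_circle x)) < e"
      using c e unfolding continuous_on_iff by blast
    have "dist (u q) (u p) < e" if q: "dist q p < d" for q
    proof -
      obtain y where "to_circle y = q" "\<bar>y - x\<bar> = dist q (to_circle x)" by (rule near_representative)
      then show ?thesis using d(2)[of y] q p by (auto simp: dist_real_def)
    qed
    then show "\<exists>d>0. \<forall>q\<in>UNIV. dist q p < d \<longrightarrow> dist (u q) (u p) < e" using d(1) by blast
  qed
qed

lemma is_lift_shift:
  assumes "is_lift f F" shows "is_lift f (\<lambda>x. F (x + of_int m))"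
  using assms unfolding is_lift_def
  by (auto simp: to_circle_add_int intro!: continuous_intros continuous_on_compose2[of UNIV F])

lemma is_lift_add_int:
  assumes "is_lift f F" shows "is_lift f (\<lambda>x. F x + of_int m)"
  using assms unfolding is_lift_def by (auto simp: to_circle_add_int intro!: continuous_intros)

lemma is_lift_comp:
  assumes "is_lift f F" "is_lift g G" shows "is_lift (f \<circ> g) (\<lambda>x. F (G x))"
  using assms unfolding is_lift_def by (auto intro: continuous_on_compose2[of UNIV F])

lemma has_circle_derivative_lift:
  assumes d: "has_circle_derivative f d (to_circle x)" and F: "is_lift f F"
  shows "(F has_real_derivative d) (at x)"
proof -
  from d obtain G y where G: "is_lift f G" "to_circle y = to_circle x" "(G has_real_derivative d)
      (at y)"
    by (auto simp: has_circle_derivative_def)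
  obtain m :: int where m: "y = x + of_int m"
    using G(2) by (metis to_circle_eq_iff Ints_cases add.commute diff_add_cancel)
  obtain k where k: "\<And>z. F z = G (z + of_int m) + of_int k"
    using is_lift_unique[OF is_lift_shift[OF G(1)] F] by blast
  have "((\<lambda>z. G (z + of_int m)) has_real_derivative d) (at x)"
    using G(3) by (simp add: m DERIV_shift)
  then have "((\<lambda>z. G (z + of_int m) + of_int k) has_real_derivative d) (at x)"
    by (auto intro!: derivative_eq_intros)
  then show ?thesis by (simp add: k[abs_def])
qed

text \<open>Any lift has a degree \<open>k\<close>. It is positive because the lift increases, and
  \<open>k \<ge> 2\<close> would give two points of the circle with the same image by the
  intermediate value theorem.\<close>

lemma circle_C1_diffeo_lift:
  assumes f: "circle_C1_diffeo f"
  obtains F where "is_lift f F" "C1_lift F (\<lambda>x. circle_deriv f (to_circle x))"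
proof -
  define D where "D x = circle_deriv f (to_circle x)" for x
  have inj: "inj f" using f by (simp add: circle_C1_diffeo_def bij_is_inj)
  have d: "has_circle_derivative f (circle_deriv f p) p" for p
    using f by (simp add: circle_C1_diffeo_def circle_C1_def)
  obtain F where F: "is_lift f F" using d[of "to_circle 0"] by (auto simp: has_circle_derivative_def)
  have der: "(F has_real_derivative D x) (at x)" for x unfolding D_def by (rule
      has_circle_derivative_lift[OF d F])
  have pos: "D x > 0" for x using f by (simp add: D_def circle_C1_diffeo_def)
  have cont: "continuous_on UNIV D"
    using f unfolding D_def circle_C1_diffeo_def circle_C1_def by (simp add: continuous_on_circle_iff)
  have less: "F x < F y" if "x < y" for x y
    by (rule DERIV_pos_imp_increasing[OF that]) (use der pos in blast)
  obtain k where k: "\<And>x. F (x + 1) = F x + of_int k"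
    using is_lift_unique[OF F is_lift_shift[OF F, of 1]] by auto
  have "k > 0" using less[of 0 1] k[of 0] by simp
  moreover have "\<not> k \<ge> 2"
  proof
    assume "k \<ge> 2"
    then have "F 0 + 1 \<le> F 1" using k[of 0] by simp
    moreover have "continuous_on {0..1} F" using F by (auto simp: is_lift_def intro:
        continuous_on_subset)
    ultimately obtain y where y: "0 \<le> y" "y \<le> 1" "F y = F 0 + 1" using IVT'[of F 0 "F 0 + 1" 1] by auto
    have "f (to_circle y) = f (to_circle 0)"
      using F y(3) to_circle_add_int[of "F 0" 1] unfolding is_lift_def by (metis of_int_1)
    then have "to_circle y = to_circle 0" using inj by (simp add: inj_eq)
    then have "y \<in> \<int>" by (simp add: to_circle_eq_iff)
    then obtain j where j: "y = of_int j" by (rule Ints_cases)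
    have "y \<noteq> 0" using y(3) by auto
    moreover have "y \<noteq> 1" using y(3) k[of 0] \<open>k \<ge> 2\<close> by auto
    ultimately have "0 < y" "y < 1" using y by auto
    then show False using j by simp
  qed
  ultimately have "k = 1" by simp
  then have "C1_lift F D" using k der pos cont by (simp add: C1_lift_def degree_one_def)
  then show ?thesis using that[OF F] by (simp add: D_def[abs_def])
qed

lemma circle_deriv_lift:
  assumes "is_lift f F" "C1_lift F D"
  shows "circle_deriv f (to_circle x) = D x" and "circle_C1 f"
proof -
  have h: "has_circle_derivative f (D x) (to_circle x)" for x
    using assms C1_liftD(2)[OF assms(2)] unfolding has_circle_derivative_def by blast
  have eq: "circle_deriv f (to_circle x) = D x" for x
    unfolding circle_deriv_def using h has_circle_derivative_unique by (intro the_equality) blast+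
  then show "circle_deriv f (to_circle x) = D x" .
  have "has_circle_derivative f (circle_deriv f p) p" for p using h eq to_circle_surj by metis
  moreover have "continuous_on UNIV (circle_deriv f)"
    unfolding continuous_on_circle_iff eq using C1_liftD(4)[OF assms(2)] .
  ultimately show "circle_C1 f" by (simp add: circle_C1_def)
qed

lemma lift_inv:
  assumes f: "is_lift f F" and F: "C1_lift F D"
  shows "bij f" and "is_lift (inv f) (inv F)"
proof -
  have FL: "circle_lift F" by (rule C1_lift_circle_lift[OF F])
  have bF: "bij F" by (rule circle_lift_bij[OF FL])
  have FF: "F (inv F x) = x" "inv F (F x) = x" for x using bF by (simp_all add: bij_is_inj
      bij_is_surj surj_f_inv_f)
  have tc: "to_circle (F x) = f (to_circle x)" for x using f by (simp add: is_lift_def)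
  have "inj f"
  proof (rule injI)
    fix p q assume pq: "f p = f q"
    obtain x y where xy: "to_circle x = p" "to_circle y = q" using to_circle_surj by metis
    then have "to_circle (F x) = to_circle (F y)" using pq by (simp add: tc)
    then obtain k where "F x - F y = of_int k" by (auto simp: to_circle_eq_iff elim: Ints_cases)
    then have "F x = F (y + of_int k)" using degree_one_int[OF C1_liftD(1)[OF F], of y k] by simp
    then have "x = y + of_int k" using bF by (simp add: bij_is_inj inj_eq)
    then show "p = q" using xy to_circle_add_int[of y k] by simp
  qed
  moreover have "surj f"
    unfolding surj_def
  proof
    fix p
    obtain x where "to_circle x = p" using to_circle_surj by blast
    then have "p = f (to_circle (inv F x))" by (simp add: tc[symmetric] FF)
    then show "\<exists>q. p = f q" by blast
  qed
  ultimately show bf: "bij f" by (simp add: bij_def)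
  have "inv f (to_circle x) = to_circle (inv F x)" for x
    using tc[of "inv F x"] bf by (simp add: FF bij_is_inj)
  then show "is_lift (inv f) (inv F)"
    using circle_lift_inv[OF FL] by (simp add: is_lift_def circle_lift_def)
qed

lemma lift_circle_C1_diffeo:
  assumes f: "is_lift f F" and F: "C1_lift F D" shows "circle_C1_diffeo f"
proof -
  have "circle_deriv f p > 0" for p
  proof -
    obtain x where "to_circle x = p" using to_circle_surj by blast
    then show ?thesis using circle_deriv_lift(1)[OF f F, of x] C1_liftD(3)[OF F, of x] by simp
  qed
  then show ?thesis
    using lift_inv[OF f F] circle_deriv_lift(2)[OF f F] circle_deriv_lift(2)[OF lift_inv(2)[OF f F]
        C1_lift_inv[OF F]]
    by (simp add: circle_C1_diffeo_def)
qed

text \<open>For lifts of degree one the class of the image does not depend on the chosen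
  representative (\<open>is_lift_project\<close>).\<close>

definition project :: "(real \<Rightarrow> real) \<Rightarrow> circle \<Rightarrow> circle" where
  "project F p = to_circle (F (SOME x. to_circle x = p))"

lemma is_lift_project:
  assumes "circle_lift F" shows "is_lift (project F) F"
proof -
  have "to_circle (F x) = project F (to_circle x)" for x
  proof -
    define y where "y = (SOME y. to_circle y = to_circle x)"
    have "to_circle y = to_circle x" unfolding y_def by (rule someI[of _ x]) simp
    then obtain k where "y = x + of_int k"
      by (metis to_circle_eq_iff Ints_cases add.commute diff_add_cancel)
    then have "F y = F x + of_int k" using assms degree_one_int[of F x k] by (simp add: circle_lift_def)
    then show ?thesis by (simp add: project_def y_def[symmetric] to_circle_add_int)
  qed
  then show ?thesis using assms by (simp add: is_lift_def circle_lift_def)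
qed

lemma circle_var_le_iff:
  assumes "V \<ge> 0" shows "circle_var u \<le> ennreal V \<longleftrightarrow> var_le (\<lambda>x. u (to_circle x)) V"
proof -
  have "circle_var u \<le> ennreal V \<longleftrightarrow> (\<forall>n x. (\<forall>i<n. x i \<le> x (Suc i)) \<and> x n = x 0 + 1 \<longrightarrow>
      (\<Sum>i<n. ennreal \<bar>u (to_circle (x (Suc i))) - u (to_circle (x i))\<bar>) \<le> ennreal V)"
    unfolding circle_var_def by (auto simp: SUP_le_iff)
  also have "\<dots> \<longleftrightarrow> (\<forall>n x. (\<forall>i<n. x i \<le> x (Suc i)) \<and> x n = x 0 + 1 \<longrightarrow>
      (\<Sum>i<n. \<bar>u (to_circle (x (Suc i))) - u (to_circle (x i))\<bar>) \<le> V)"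
    using assms by (simp add: sum_ennreal ennreal_le_iff)
  also have "\<dots> \<longleftrightarrow> var_le (\<lambda>x. u (to_circle x)) V"
    unfolding var_le_def partition_seq_def by auto
  finally show ?thesis .
qed

lemma circle_var_finite:
  assumes "circle_var u < \<infinity>" obtains V where "var_le (\<lambda>x. u (to_circle x)) V"
proof -
  obtain V where "V \<ge> 0" "circle_var u = ennreal V" using assms by (cases "circle_var u") auto
  then show ?thesis using circle_var_le_iff[of V u] that by simp
qed

lemma funpow_add_int:
  assumes "degree_one F" shows "((\<lambda>x. F x + of_int k) ^^ n) x = (F ^^ n) x + real n * of_int k"
proof (induction n)
  case (Suc n)
  then show ?case using degree_one_int[OF assms, of "(F ^^ n) x" "int n * k"] by (simp add:
      algebra_simps)
qed simp

text \<open>Any other lift differs by an integer, which shifts the limit by the same integer; this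
  gives the uniqueness that the definite description in \<open>rotation_number\<close>
  requires.\<close>

lemma rotation_number_lift:
  assumes f: "is_lift f F" and F: "degree_one F" and \<rho>: "translation_number F \<rho>"
  shows "rotation_number f = to_circle \<rho>"
  unfolding rotation_number_def
proof (rule the_equality)
  show "\<exists>F' x r. is_lift f F' \<and> (\<lambda>n. (F' ^^ n) x / real n) \<longlonglongrightarrow> r \<and> to_circle \<rho> = to_circle r"
    using f translation_number_limit[OF \<rho>] by blast
next
  fix \<sigma> assume "\<exists>F' x r. is_lift f F' \<and> (\<lambda>n. (F' ^^ n) x / real n) \<longlonglongrightarrow> r \<and> \<sigma> = to_circle r"
  then obtain F' x r where F': "is_lift f F'" "(\<lambda>n. (F' ^^ n) x / real n) \<longlonglongrightarrow> r" "\<sigma> = to_circle r" by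
      blast
  obtain k where "\<And>x. F' x = F x + of_int k" using is_lift_unique[OF f F'(1)] by blast
  then have F'_eq: "F' = (\<lambda>x. F x + of_int k)" by blast
  have "(\<lambda>n. (F ^^ n) x / real n + of_int k) \<longlonglongrightarrow> \<rho> + of_int k"
    by (intro tendsto_intros translation_number_limit[OF \<rho>])
  moreover have "\<forall>\<^sub>F n in sequentially. (F ^^ n) x / real n + of_int k = (F' ^^ n) x / real n"
    using eventually_gt_at_top[of 0]
    by eventually_elim (simp add: F'_eq funpow_add_int[OF F] add_divide_distrib)
  ultimately have "(\<lambda>n. (F' ^^ n) x / real n) \<longlonglongrightarrow> \<rho> + of_int k" by (rule Lim_transform_eventually)
  then have "r = \<rho> + of_int k" using F'(2) LIMSEQ_unique by blast
  then show "\<sigma> = to_circle \<rho>" using F'(3) to_circle_add_int by simp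
qed

lemma translation_number_add_int:
  assumes "degree_one F" "translation_number F \<rho>"
  shows "translation_number (\<lambda>x. F x + of_int k) (\<rho> + of_int k)"
  using assms(2) unfolding translation_number_def funpow_add_int[OF assms(1)] by (simp add:
      algebra_simps)

text \<open>\<open>D\<close> has a positive lower bound \<open>\<beta>\<close>, above which
  \<open>ln\<close> is Lipschitz with constant \<open>1 / \<beta>\<close>.\<close>

lemma abs_continuous_ln:
  assumes F: "C1_lift F D" and ac: "abs_continuous_on_interval 0 1 D"
  shows "abs_continuous_on_interval 0 1 (\<lambda>x. ln (D x))"
proof -
  obtain \<beta> where \<beta>: "\<beta> > 0" "\<And>x. \<beta> \<le> D x" using C1_lift_lower_bound[OF F] by blast
  have *: "ln u - ln v \<le> 1 / \<beta> * \<bar>u - v\<bar>" if "\<beta> \<le> u" "\<beta> \<le> v" for u v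
  proof -
    have pos: "u > 0" "v > 0" using that \<beta>(1) by auto
    have "ln u - ln v \<le> (u - v) / v" using ln_diff_le[OF pos] .
    also have "\<dots> \<le> \<bar>u - v\<bar> / v" using pos by (intro divide_right_mono) auto
    also have "\<dots> \<le> \<bar>u - v\<bar> / \<beta>" using pos that \<beta> by (intro divide_left_mono) auto
    finally show ?thesis by simp
  qed
  show ?thesis
  proof (rule abs_continuous_lipschitz[OF ac])
    show "1 / \<beta> > 0" using \<beta> by simp
    fix x y
    show "\<bar>ln (D y) - ln (D x)\<bar> \<le> 1 / \<beta> * \<bar>D y - D x\<bar>"
      using *[OF \<beta>(2)[of y] \<beta>(2)[of x]] *[OF \<beta>(2)[of x] \<beta>(2)[of y]] by (simp add: abs_le_iff
          abs_minus_commute)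
  qed
qed

lemma circle_C1bv_diffeo_lift:
  assumes f: "circle_C1bv_diffeo f" and ac: "circle_abs_continuous (circle_deriv f)"
  obtains F D V \<rho> where "is_lift f F" "C1_lift F D" "var_le (\<lambda>x. ln (D x)) V" "translation_number F \<rho>"
    "abs_continuous_on_interval 0 1 (\<lambda>x. ln (D x))" "rotation_number f = to_circle \<rho>"
proof -
  have diffeo: "circle_C1_diffeo f" and bv: "circle_var (\<lambda>p. ln (circle_deriv f p)) < \<infinity>"
    using f by (simp_all add: circle_C1bv_diffeo_def)
  obtain F where F: "is_lift f F" "C1_lift F (\<lambda>x. circle_deriv f (to_circle x))"
    using circle_C1_diffeo_lift[OF diffeo] .
  obtain V where V: "var_le (\<lambda>x. ln (circle_deriv f (to_circle x))) V" using circle_var_finite[OF bv] .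
  have FL: "circle_lift F" by (rule C1_lift_circle_lift[OF F(2)])
  obtain \<rho> where \<rho>: "translation_number F \<rho>"
    using translation_number_exists[OF circle_lift_mono[OF FL]] FL by (auto simp: circle_lift_def)
  show thesis
  proof (rule that[OF F V \<rho>])
    show "abs_continuous_on_interval 0 1 (\<lambda>x. ln (circle_deriv f (to_circle x)))"
      using ac by (intro abs_continuous_ln[OF F(2)]) (simp add: circle_abs_continuous_def)
    show "rotation_number f = to_circle \<rho>" using FL by (intro rotation_number_lift[OF F(1) _ \<rho>])
        (simp add: circle_lift_def)
  qed
qed

lemma circle_uniform_limitI:
  fixes u :: "nat \<Rightarrow> circle \<Rightarrow> 'a :: metric_space"
  assumes "\<And>\<epsilon>. \<epsilon> > 0 \<Longrightarrow> \<exists>N. \<forall>n\<ge>N. \<forall>x. dist (u n (to_circle x)) (v (to_circle x)) \<le> \<epsilon>"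
  shows "uniform_limit UNIV u v sequentially"
proof (rule uniform_limitI)
  fix e :: real assume "e > 0"
  then obtain N where N: "\<And>n x. n \<ge> N \<Longrightarrow> dist (u n (to_circle x)) (v (to_circle x)) \<le> e / 2"
    using assms[of "e / 2"] by auto
  have "dist (u n p) (v p) < e" if "n \<ge> N" for n p
  proof -
    obtain x where "to_circle x = p" using to_circle_surj by blast
    then show ?thesis using N[OF that, of x] \<open>e > 0\<close> by auto
  qed
  then show "\<forall>\<^sub>F n in sequentially. \<forall>p\<in>UNIV. dist (u n p) (v p) < e"
    by (auto simp: eventually_sequentially)
qed

lemma circle_var_tendsto_0:
  assumes "\<And>\<epsilon>. \<epsilon> > 0 \<Longrightarrow> \<exists>N. \<forall>n\<ge>N. var_le (\<lambda>x. u n (to_circle x)) \<epsilon>"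
  shows "(\<lambda>n. circle_var (u n)) \<longlonglongrightarrow> 0"
proof (rule tendsto_zero_ennreal)
  fix r :: real assume r: "0 < r"
  then obtain N where N: "\<And>n. n \<ge> N \<Longrightarrow> var_le (\<lambda>x. u n (to_circle x)) (r / 2)" using assms[of "r /
      2"] by auto
  have "circle_var (u n) < ennreal r" if "n \<ge> N" for n
  proof -
    have "circle_var (u n) \<le> ennreal (r / 2)" using N[OF that] r by (subst circle_var_le_iff) auto
    also have "\<dots> < ennreal r" using r by (simp add: ennreal_less_iff)
    finally show ?thesis .
  qed
  then show "\<forall>\<^sub>F n in sequentially. circle_var (u n) < ennreal r" by (auto simp:
      eventually_sequentially)
qed

theorem corollary1:
  fixes f g :: "circle \<Rightarrow> circle"
  assumes "circle_C1bv_diffeo f" and "circle_C1bv_diffeo g"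
    and "rotation_number f = rotation_number g"
    and "rotation_number f \<notin> to_circle ` \<rat>"
    and "circle_abs_continuous (circle_deriv f)"
    and "circle_abs_continuous (circle_deriv g)"
  shows "\<exists>h :: nat \<Rightarrow> circle \<Rightarrow> circle.
    (\<forall>n. circle_C1bv_diffeo (h n)) \<and>
    C1_tendsto (\<lambda>n. h n \<circ> f \<circ> inv (h n)) g \<and>
    (\<lambda>n. circle_var (\<lambda>p. ln (circle_deriv (inv g \<circ> (h n \<circ> f \<circ> inv (h n))) p)))
      \<longlonglongrightarrow> 0 \<and>
    (\<lambda>n. circle_var (\<lambda>p. ln (circle_deriv ((h n \<circ> f \<circ> inv (h n)) \<circ> inv g) p)))
      \<longlonglongrightarrow> 0"
proof -
  obtain F D V \<rho> where F: "is_lift f F" "C1_lift F D" "var_le (\<lambda>x. ln (D x)) V" "translation_number F \<rho>"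
    "abs_continuous_on_interval 0 1 (\<lambda>x. ln (D x))" "rotation_number f = to_circle \<rho>"
    using circle_C1bv_diffeo_lift[OF assms(1,5)] .
  obtain G0 DG W \<sigma> where G0: "is_lift g G0" "C1_lift G0 DG" "var_le (\<lambda>x. ln (DG x)) W"
      "translation_number G0 \<sigma>"
    "abs_continuous_on_interval 0 1 (\<lambda>x. ln (DG x))" "rotation_number g = to_circle \<sigma>"
    using circle_C1bv_diffeo_lift[OF assms(2,6)] .
  have irr: "\<rho> \<notin> \<rat>" using assms(4) F(6) by auto
  \<comment> \<open>Equal rotation numbers fix the translation numbers of lifts only modulo
    integers; the lift of \<open>g\<close> is adjusted by \<open>k\<close> so that they agree
    exactly.\<close>
  obtain k where k: "\<rho> = \<sigma> + of_int k"
    using assms(3) unfolding F(6) G0(6) to_circle_eq_iff by (metis Ints_cases add.commute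
        diff_add_cancel)
  define G where "G x = G0 x + of_int k" for x
  have G: "is_lift g G" "C1_lift G DG" "translation_number G \<rho>"
    unfolding G_def[abs_def]
    using is_lift_add_int[OF G0(1)] G0(2) translation_number_add_int[OF C1_liftD(1)[OF G0(2)] G0(4),
        of k]
    by (auto simp: k C1_lift_def degree_one_def intro!: derivative_eq_intros)
  have FI: "C1_irrational_lift F \<rho> D V" and GI: "C1_irrational_lift G \<rho> DG W"
    using F G G0 irr C1_lift_circle_lift by unfold_locales auto
  obtain H E DM :: "nat \<Rightarrow> real \<Rightarrow> real" where HE: "\<And>n. C1_lift (H n) (E n)" and varE: "\<And>n. \<exists>B. var_le
      (\<lambda>x. ln (E n x)) B"
    and M: "\<And>n. C1_lift (\<lambda>y. H n (F (inv (H n) y))) (DM n)"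
    and lim: "\<And>\<epsilon>. \<epsilon> > 0 \<Longrightarrow> \<exists>N. \<forall>n\<ge>N. C1_close \<epsilon> (\<lambda>y. H n (F (inv (H n) y))) (DM n) G DG \<and>
       var_le (\<lambda>x. ln (1 / DG (inv G (H n (F (inv (H n) x)))) * DM n x)) \<epsilon> \<and>
       var_le (\<lambda>x. ln (DM n (inv G x) * (1 / DG (inv G x)))) \<epsilon>"
  proof (rule conjugates_converge[OF FI GI F(5) G0(5)], goal_cases)
    case (1 H E DM)
    show ?case by (rule that[OF 1(2-5)])
  qed
  define h where "h n = project (H n)" for n
  define \<mu> where "\<mu> n = h n \<circ> f \<circ> inv (h n)" for n
  have h: "is_lift (h n) (H n)" for n
    unfolding h_def by (rule is_lift_project[OF C1_lift_circle_lift[OF HE]])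
  have \<mu>: "is_lift (\<mu> n) (\<lambda>y. H n (F (inv (H n) y)))" for n
    unfolding \<mu>_def by (rule is_lift_comp[OF is_lift_comp[OF h F(1)] lift_inv(2)[OF h HE]])
  have Gi: "is_lift (inv g) (inv G)" "C1_lift (inv G) (\<lambda>x. 1 / DG (inv G x))"
    using lift_inv(2)[OF G(1,2)] C1_lift_inv[OF G(2)] by auto
  have bv: "circle_C1bv_diffeo (h n)" for n
  proof -
    obtain B where "var_le (\<lambda>x. ln (E n x)) B" using varE by blast
    then have "circle_var (\<lambda>p. ln (circle_deriv (h n) p)) \<le> ennreal B"
      using var_le_nonneg by (subst circle_var_le_iff) (auto simp: circle_deriv_lift(1)[OF h HE])
    then have "circle_var (\<lambda>p. ln (circle_deriv (h n) p)) < \<infinity>" by (rule le_less_trans) simp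
    then show ?thesis using lift_circle_C1_diffeo[OF h HE] by (simp add: circle_C1bv_diffeo_def)
  qed
  have C1: "C1_tendsto \<mu> g"
    unfolding C1_tendsto_def
  proof (intro conjI circle_uniform_limitI)
    fix \<epsilon> :: real assume "\<epsilon> > 0"
    from lim[OF this] obtain N where
      N: "\<And>n. n \<ge> N \<Longrightarrow> C1_close \<epsilon> (\<lambda>y. H n (F (inv (H n) y))) (DM n) G DG" by blast
    have "dist (\<mu> n (to_circle x)) (g (to_circle x)) \<le> \<epsilon>" if "n \<ge> N" for n x
    proof -
      have "dist (\<mu> n (to_circle x)) (g (to_circle x)) = dist (to_circle (H n (F (inv (H n) x))))
          (to_circle (G x))"
        using \<mu>[of n] G(1) by (simp add: is_lift_def)
      also have "\<dots> \<le> \<bar>H n (F (inv (H n) x)) - G x\<bar>" by (rule dist_to_circle_le)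
      also have "\<dots> \<le> \<epsilon>" using N[OF that] by (simp add: C1_close_def)
      finally show ?thesis .
    qed
    then show "\<exists>N. \<forall>n\<ge>N. \<forall>x. dist (\<mu> n (to_circle x)) (g (to_circle x)) \<le> \<epsilon>" by blast
  next
    fix \<epsilon> :: real assume "\<epsilon> > 0"
    from lim[OF this] obtain N where
      N: "\<And>n. n \<ge> N \<Longrightarrow> C1_close \<epsilon> (\<lambda>y. H n (F (inv (H n) y))) (DM n) G DG" by blast
    then show "\<exists>N. \<forall>n\<ge>N. \<forall>x. dist (circle_deriv (\<mu> n) (to_circle x)) (circle_deriv g (to_circle x)) \<le> \<epsilon>"
      unfolding circle_deriv_lift(1)[OF \<mu> M] circle_deriv_lift(1)[OF G(1,2)] dist_real_def
          C1_close_def by blast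
  qed
  \<comment> \<open>The functions in \<open>lim\<close> are written exactly as the chain rule
    \<open>C1_lift_comp\<close> produces them for the two compositions.\<close>
  have v1: "(\<lambda>n. circle_var (\<lambda>p. ln (circle_deriv (inv g \<circ> \<mu> n) p))) \<longlonglongrightarrow> 0"
    by (rule circle_var_tendsto_0)
      (use lim in \<open>simp only: circle_deriv_lift(1)[OF is_lift_comp[OF Gi(1) \<mu>] C1_lift_comp[OF Gi(2)
          M]], blast\<close>)
  have v2: "(\<lambda>n. circle_var (\<lambda>p. ln (circle_deriv (\<mu> n \<circ> inv g) p))) \<longlonglongrightarrow> 0"
    by (rule circle_var_tendsto_0)
      (use lim in \<open>simp only: circle_deriv_lift(1)[OF is_lift_comp[OF \<mu> Gi(1)] C1_lift_comp[OF M
          Gi(2)]], blast\<close>)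
  show ?thesis
    using bv C1 v1 v2 unfolding \<mu>_def by blast
qed

end
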